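(* Let $(M,J,g,F)$ be an almost Hermitian manifold of real dimension $m=2n$, let $f\in C^\infty(M)$ be real-valued, and let $\tilde g=e^{2f}g$, $\tilde F=e^{2f}F$. Let $\rho,r,\sigma$ be the first, second and third Ricci forms of the Chern connection of $(J,g)$ and $\tilde\rho,\tilde r,\tilde\sigma$ those of $(J,\tilde g)$. Then $$\tilde{\rho} = \rho - n\, dd^cf,\qquad \tilde{r} = r - \Lambda(d d^cf)\, F,\qquad \tilde{\sigma} = \sigma - dd^cf .$$
   Context: $J$ is an almost complex structure orthogonal for $g$, and $F=g(J\cdot,\cdot)$. The Chern connection $\nabla$ is the unique connection on $TM$ with $\nabla g=0$, $\nabla J=0$ whose torsion $T_{XY}=\nabla_XY-\nabla_YX-[X,Y]$ satisfies $T_{JX,JY}=-T_{XY}$; its curvature is $R_{XY}=[\nabla_X,\nabla_Y]-\nabla_{[X,Y]}$. For a function, $d^cf=J\,df=-df\circ J$ ($J$ acts on forms by $(J^{-1})^*$). The Lefschetz trace of a $2$-form is $\Lambda(\phi)=\frac12\sum_i\phi(e_i,Je_i)$ in a local $g$-orthonormal frame $(e_i)$ with $e_{2\alpha}=Je_{2\alpha-1}$. First Ricci form: $\rho(X,Y)=\operatorname{tr}_{\mathbb{C}}(J\circ R_{XY})=-\frac12\sum_i g(R_{XY}e_i,Je_i)$. Second Ricci form: $r(X,Y)=-\frac12\sum_i g(R_{e_i,Je_i}X,Y)$. Third Ricci form: let $(z_\alpha)$ be a local complex frame of $T^{1,0}$, with conjugate frame $(\bar z_{\bar\alpha})$ of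 $T^{0,1}$ and dual coframes $z^\alpha,\bar z^{\bar\alpha}$. Extend $g$ and $R$ complex-multilinearly, put $h_{\alpha\bar\beta}=g(z_\alpha,\bar z_{\bar\beta})$, define $h^{\alpha\bar\beta}$ by $h_{\alpha\bar\gamma}h^{\beta\bar\gamma}=\delta_\alpha^\beta$, and write $R_{abcd}=g(R_{z_az_b}z_c,z_d)$ for indices $a,b,c,d$ barred or unbarred (a barred index referring to $\bar z$), raising indices in place with $h$: $R_{ab}{}^{\alpha}{}_{\lambda}=h^{\alpha\bar\beta}R_{ab\bar\beta\lambda}$ and $R_{\bar\mu}{}^{\alpha}{}_{\alpha\bar\lambda}=h^{\alpha\bar\beta}R_{\bar\mu\bar\beta\alpha\bar\lambda}$. Then, with summation convention, $$\sigma=\tfrac{i}{2}R_{\mu\alpha}{}^{\alpha}{}_{\lambda}\,z^\lambda\wedge z^\mu+iR_{\bar\mu\alpha}{}^{\alpha}{}_{\lambda}\,z^\lambda\wedge\bar z^{\bar\mu}-\tfrac{i}{2}R_{\bar\mu}{}^{\alpha}{}_{\alpha\bar\lambda}\,\bar z^{\bar\lambda}\wedge\bar z^{\bar\mu}.$$ The forms $\tilde\rho,\tilde r,\tilde\sigma$ are defined in the same way from $(J,\tilde g)$, using $\tilde g$ for all metric contractions and index raising. *)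

theory Defs
  imports "HOL-Analysis.Analysis"
begin

section \<open>Smooth manifolds\<close>

primrec C_k_on :: "nat \<Rightarrow> 'e::euclidean_space set \<Rightarrow> ('e \<Rightarrow> 'b::real_normed_vector) \<Rightarrow> bool" where
  "C_k_on 0 S f \<longleftrightarrow> continuous_on S f"
| "C_k_on (Suc k) S f \<longleftrightarrow>
     (\<forall>x\<in>S. f differentiable at x) \<and>
     (\<forall>v. C_k_on k S (\<lambda>x. frechet_derivative f (at x) v))"

text \<open>Only meaningful for open sets.\<close>

definition smooth_on :: "'e::euclidean_space set \<Rightarrow> ('e \<Rightarrow> 'b::real_normed_vector) \<Rightarrow> bool" where
  "smooth_on S f \<longleftrightarrow> (\<forall>k. C_k_on k S f)"

text \<open>
  The underlying set of the manifold is the whole type \<open>'a\<close>, its dimension is that of the model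
  space \<open>'e\<close>. A chart is a pair of its domain and its coordinate map (with arbitrary values outside
  the domain); the atlas is not required to be maximal.
\<close>

type_synonym ('a, 'e) atlas = "('a set \<times> ('a \<Rightarrow> 'e)) set"

definition smooth_manifold ::
  "('a::{t2_space,second_countable_topology}, 'e::euclidean_space) atlas \<Rightarrow> bool" where
  "smooth_manifold A \<longleftrightarrow>
     (\<Union>(U, \<phi>)\<in>A. U) = UNIV \<and>
     (\<forall>(U, \<phi>)\<in>A. open U \<and> open (\<phi> ` U) \<and> homeomorphism U (\<phi> ` U) \<phi> (inv_into U \<phi>)) \<and>
     (\<forall>(U, \<phi>)\<in>A. \<forall>(V, \<psi>)\<in>A. smooth_on (\<phi> ` (U \<inter> V)) (\<psi> \<circ> inv_into U \<phi>))"

definition smooth_fun :: "('a, 'e::euclidean_space) atlas \<Rightarrow> ('a \<Rightarrow> real) \<Rightarrow> bool" where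
  "smooth_fun A f \<longleftrightarrow> (\<forall>(U, \<phi>)\<in>A. smooth_on (\<phi> ` U) (f \<circ> inv_into U \<phi>))"


section \<open>Tangent vectors, vector fields, exterior derivative\<close>

text \<open>
  Tangent vectors at a point are the point derivations of the algebra of smooth functions. They are
  required to vanish on functions that are not smooth, so that two tangent vectors are equal as HOL
  functions iff they are equal as derivations.
\<close>

type_synonym 'a tvec = "('a \<Rightarrow> real) \<Rightarrow> real"
type_synonym 'a vfield = "'a \<Rightarrow> 'a tvec"

definition tangent_space :: "('a, 'e::euclidean_space) atlas \<Rightarrow> 'a \<Rightarrow> 'a tvec set" where
  "tangent_space A p = {v.
     (\<forall>f. \<not> smooth_fun A f \<longrightarrow> v f = 0) \<and>
     (\<forall>f h a b. smooth_fun A f \<longrightarrow> smooth_fun A h \<longrightarrow>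
        v (\<lambda>q. a * f q + b * h q) = a * v f + b * v h) \<and>
     (\<forall>f h. smooth_fun A f \<longrightarrow> smooth_fun A h \<longrightarrow>
        v (\<lambda>q. f q * h q) = v f * h p + f p * v h)}"

definition vector_fields :: "('a, 'e::euclidean_space) atlas \<Rightarrow> 'a vfield set" where
  "vector_fields A = {X.
     (\<forall>p. X p \<in> tangent_space A p) \<and>
     (\<forall>f. smooth_fun A f \<longrightarrow> smooth_fun A (\<lambda>p. X p f))}"

definition bracket :: "'a vfield \<Rightarrow> 'a vfield \<Rightarrow> 'a vfield" where
  "bracket X Y = (\<lambda>p f. X p (\<lambda>q. Y q f) - Y p (\<lambda>q. X q f))"

text \<open>
  Expressions that are tensorial in vector fields are evaluated on tangent vectors at a point by
  means of arbitrary extensions to vector fields.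
\<close>

definition extend :: "('a, 'e::euclidean_space) atlas \<Rightarrow> 'a \<Rightarrow> 'a tvec \<Rightarrow> 'a vfield" where
  "extend A p u = (SOME X. X \<in> vector_fields A \<and> X p = u)"

type_synonym 'a one_form = "'a \<Rightarrow> 'a tvec \<Rightarrow> real"
type_synonym 'a two_tensor = "'a \<Rightarrow> 'a tvec \<Rightarrow> 'a tvec \<Rightarrow> real"

text \<open>Without the factor \<open>1/2\<close>; accordingly \<open>wedge\<close> below has no factor \<open>1/2\<close> either.\<close>

definition ext_deriv :: "('a, 'e::euclidean_space) atlas \<Rightarrow> 'a one_form \<Rightarrow> 'a two_tensor" where
  "ext_deriv A \<alpha> p u v =
     (let X = extend A p u; Y = extend A p v in
        X p (\<lambda>q. \<alpha> q (Y q)) - Y p (\<lambda>q. \<alpha> q (X q)) - \<alpha> p (bracket X Y p))"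


section \<open>Almost Hermitian structures\<close>

type_synonym 'a endo = "'a \<Rightarrow> 'a tvec \<Rightarrow> 'a tvec"

definition almost_complex :: "('a, 'e::euclidean_space) atlas \<Rightarrow> 'a endo \<Rightarrow> bool" where
  "almost_complex A J \<longleftrightarrow>
     (\<forall>p. \<forall>u\<in>tangent_space A p. J p u \<in> tangent_space A p \<and> J p (J p u) = (\<lambda>f. - u f)) \<and>
     (\<forall>p. \<forall>u\<in>tangent_space A p. \<forall>v\<in>tangent_space A p. \<forall>a b.
        J p (\<lambda>f. a * u f + b * v f) = (\<lambda>f. a * J p u f + b * J p v f)) \<and>
     (\<forall>X\<in>vector_fields A. (\<lambda>p. J p (X p)) \<in> vector_fields A)"

definition riemannian_metric :: "('a, 'e::euclidean_space) atlas \<Rightarrow> 'a two_tensor \<Rightarrow> bool" where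
  "riemannian_metric A g \<longleftrightarrow>
     (\<forall>p. \<forall>u\<in>tangent_space A p. \<forall>v\<in>tangent_space A p. g p u v = g p v u) \<and>
     (\<forall>p. \<forall>u\<in>tangent_space A p. \<forall>v\<in>tangent_space A p. \<forall>w\<in>tangent_space A p. \<forall>a b.
        g p (\<lambda>f. a * u f + b * v f) w = a * g p u w + b * g p v w) \<and>
     (\<forall>p. \<forall>u\<in>tangent_space A p. u \<noteq> (\<lambda>f. 0) \<longrightarrow> g p u u > 0) \<and>
     (\<forall>X\<in>vector_fields A. \<forall>Y\<in>vector_fields A. smooth_fun A (\<lambda>p. g p (X p) (Y p)))"

definition almost_hermitian ::
  "('a::{t2_space,second_countable_topology}, 'e::euclidean_space) atlas
     \<Rightarrow> 'a endo \<Rightarrow> 'a two_tensor \<Rightarrow> bool" where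
  "almost_hermitian A J g \<longleftrightarrow>
     smooth_manifold A \<and> almost_complex A J \<and> riemannian_metric A g \<and>
     (\<forall>p. \<forall>u\<in>tangent_space A p. \<forall>v\<in>tangent_space A p. g p (J p u) (J p v) = g p u v)"

definition fundamental_form :: "'a endo \<Rightarrow> 'a two_tensor \<Rightarrow> 'a two_tensor" where
  "fundamental_form J g p u v = g p (J p u) v"

definition conformal :: "('a \<Rightarrow> real) \<Rightarrow> 'a two_tensor \<Rightarrow> 'a two_tensor" where
  "conformal f g p u v = exp (2 * f p) * g p u v"

text \<open>\<open>d\<^sup>c f = J df = - df \<circ> J\<close>, where \<open>df (w) = w f\<close>.\<close>

definition dc :: "'a endo \<Rightarrow> ('a \<Rightarrow> real) \<Rightarrow> 'a one_form" where
  "dc J f p u = - (J p u) f"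

definition ddc :: "('a, 'e::euclidean_space) atlas \<Rightarrow> 'a endo \<Rightarrow> ('a \<Rightarrow> real) \<Rightarrow> 'a two_tensor" where
  "ddc A J f = ext_deriv A (dc J f)"


section \<open>Connections and curvature\<close>

type_synonym 'a connection = "'a vfield \<Rightarrow> 'a vfield \<Rightarrow> 'a vfield"

definition tangent_connection :: "('a, 'e::euclidean_space) atlas \<Rightarrow> 'a connection \<Rightarrow> bool" where
  "tangent_connection A D \<longleftrightarrow>
     (\<forall>X\<in>vector_fields A. \<forall>Y\<in>vector_fields A. D X Y \<in> vector_fields A) \<and>
     (\<forall>X\<in>vector_fields A. \<forall>Y\<in>vector_fields A. \<forall>Z\<in>vector_fields A.
        D (\<lambda>p f. X p f + Y p f) Z = (\<lambda>p f. D X Z p f + D Y Z p f) \<and>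
        D X (\<lambda>p f. Y p f + Z p f) = (\<lambda>p f. D X Y p f + D X Z p f)) \<and>
     (\<forall>X\<in>vector_fields A. \<forall>Y\<in>vector_fields A. \<forall>h. smooth_fun A h \<longrightarrow>
        D (\<lambda>p f. h p * X p f) Y = (\<lambda>p f. h p * D X Y p f) \<and>
        D X (\<lambda>p f. h p * Y p f) = (\<lambda>p f. X p h * Y p f + h p * D X Y p f))"

definition torsion :: "'a connection \<Rightarrow> 'a vfield \<Rightarrow> 'a vfield \<Rightarrow> 'a vfield" where
  "torsion D X Y = (\<lambda>p f. D X Y p f - D Y X p f - bracket X Y p f)"

definition curvature :: "'a connection \<Rightarrow> 'a vfield \<Rightarrow> 'a vfield \<Rightarrow> 'a vfield \<Rightarrow> 'a vfield" where
  "curvature D X Y Z = (\<lambda>p f. D X (D Y Z) p f - D Y (D X Z) p f - D (bracket X Y) Z p f)"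

definition curvature_at ::
  "('a, 'e::euclidean_space) atlas \<Rightarrow> 'a connection \<Rightarrow> 'a \<Rightarrow> 'a tvec \<Rightarrow> 'a tvec \<Rightarrow> 'a tvec \<Rightarrow> 'a tvec" where
  "curvature_at A D p u v w = curvature D (extend A p u) (extend A p v) (extend A p w) p"

definition chern_connection ::
  "('a, 'e::euclidean_space) atlas \<Rightarrow> 'a endo \<Rightarrow> 'a two_tensor \<Rightarrow> 'a connection \<Rightarrow> bool" where
  "chern_connection A J g D \<longleftrightarrow>
     tangent_connection A D \<and>
     (\<forall>X\<in>vector_fields A. \<forall>Y\<in>vector_fields A. \<forall>Z\<in>vector_fields A. \<forall>p.
        X p (\<lambda>q. g q (Y q) (Z q)) = g p (D X Y p) (Z p) + g p (Y p) (D X Z p)) \<and>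
     (\<forall>X\<in>vector_fields A. \<forall>Y\<in>vector_fields A.
        D X (\<lambda>p. J p (Y p)) = (\<lambda>p. J p (D X Y p))) \<and>
     (\<forall>X\<in>vector_fields A. \<forall>Y\<in>vector_fields A.
        torsion D (\<lambda>p. J p (X p)) (\<lambda>p. J p (Y p)) = (\<lambda>p f. - torsion D X Y p f))"


section \<open>Lefschetz trace, first and second Ricci forms\<close>

text \<open>
  Traces only depend on the value of a local frame at the point under consideration, so a frame here
  is a basis of a single tangent space. Real frames are indexed by \<open>1, \<dots>, m\<close>.
\<close>

definition adapted_frame ::
  "('a, 'e::euclidean_space) atlas \<Rightarrow> 'a endo \<Rightarrow> 'a two_tensor \<Rightarrow> 'a \<Rightarrow> (nat \<Rightarrow> 'a tvec) \<Rightarrow> bool" where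
  "adapted_frame A J g p e \<longleftrightarrow>
     (\<forall>i\<in>{1..DIM('e)}. e i \<in> tangent_space A p) \<and>
     (\<forall>v\<in>tangent_space A p. \<exists>c. v = (\<lambda>f. \<Sum>i=1..DIM('e). c i * e i f)) \<and>
     (\<forall>i\<in>{1..DIM('e)}. \<forall>j\<in>{1..DIM('e)}. g p (e i) (e j) = (if i = j then 1 else 0)) \<and>
     (\<forall>\<alpha>\<in>{1..DIM('e) div 2}. e (2 * \<alpha>) = J p (e (2 * \<alpha> - 1)))"

definition some_adapted_frame ::
  "('a, 'e::euclidean_space) atlas \<Rightarrow> 'a endo \<Rightarrow> 'a two_tensor \<Rightarrow> 'a \<Rightarrow> nat \<Rightarrow> 'a tvec" where
  "some_adapted_frame A J g p = (SOME e. adapted_frame A J g p e)"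

definition lefschetz_trace ::
  "('a, 'e::euclidean_space) atlas \<Rightarrow> 'a endo \<Rightarrow> 'a two_tensor \<Rightarrow> 'a two_tensor \<Rightarrow> 'a \<Rightarrow> real" where
  "lefschetz_trace A J g \<phi> p =
     (let e = some_adapted_frame A J g p in (1/2) * (\<Sum>i=1..DIM('e). \<phi> p (e i) (J p (e i))))"

definition first_ricci ::
  "('a, 'e::euclidean_space) atlas \<Rightarrow> 'a endo \<Rightarrow> 'a two_tensor \<Rightarrow> 'a connection \<Rightarrow> 'a two_tensor" where
  "first_ricci A J g D p u v =
     (let e = some_adapted_frame A J g p in
        - (1/2) * (\<Sum>i=1..DIM('e). g p (curvature_at A D p u v (e i)) (J p (e i))))"

definition second_ricci ::
  "('a, 'e::euclidean_space) atlas \<Rightarrow> 'a endo \<Rightarrow> 'a two_tensor \<Rightarrow> 'a connection \<Rightarrow> 'a two_tensor" where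
  "second_ricci A J g D p u v =
     (let e = some_adapted_frame A J g p in
        - (1/2) * (\<Sum>i=1..DIM('e). g p (curvature_at A D p (e i) (J p (e i)) u) v))"


section \<open>Complexified tangent space, third Ricci form\<close>

text \<open>Elements of the complexified tangent space are complex-valued derivations at the point.\<close>

type_synonym 'a cvec = "('a \<Rightarrow> real) \<Rightarrow> complex"

definition re_vec :: "'a cvec \<Rightarrow> 'a tvec" where "re_vec z = (\<lambda>f. Re (z f))"
definition im_vec :: "'a cvec \<Rightarrow> 'a tvec" where "im_vec z = (\<lambda>f. Im (z f))"
definition cnj_vec :: "'a cvec \<Rightarrow> 'a cvec" where "cnj_vec z = (\<lambda>f. cnj (z f))"
definition real_vec :: "'a tvec \<Rightarrow> 'a cvec" where "real_vec u = (\<lambda>f. complex_of_real (u f))"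

definition ctangent_space :: "('a, 'e::euclidean_space) atlas \<Rightarrow> 'a \<Rightarrow> 'a cvec set" where
  "ctangent_space A p = {z. re_vec z \<in> tangent_space A p \<and> im_vec z \<in> tangent_space A p}"

text \<open>Complex-multilinear extension: \<open>z = part 0 z + \<i> * part 1 z\<close> in each argument.\<close>

definition part :: "nat \<Rightarrow> 'a cvec \<Rightarrow> 'a tvec" where
  "part k z = (if k = 0 then re_vec z else im_vec z)"

definition cext2 :: "('a tvec \<Rightarrow> 'a tvec \<Rightarrow> real) \<Rightarrow> 'a cvec \<Rightarrow> 'a cvec \<Rightarrow> complex" where
  "cext2 b z w = (\<Sum>j<2. \<Sum>k<2. \<i> ^ (j + k) * complex_of_real (b (part j z) (part k w)))"

definition cext4 ::
  "('a tvec \<Rightarrow> 'a tvec \<Rightarrow> 'a tvec \<Rightarrow> 'a tvec \<Rightarrow> real)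
     \<Rightarrow> 'a cvec \<Rightarrow> 'a cvec \<Rightarrow> 'a cvec \<Rightarrow> 'a cvec \<Rightarrow> complex" where
  "cext4 T z1 z2 z3 z4 =
     (\<Sum>j<2. \<Sum>k<2. \<Sum>l<2. \<Sum>m<2. \<i> ^ (j + k + l + m) *
        complex_of_real (T (part j z1) (part k z2) (part l z3) (part m z4)))"

definition T10 :: "('a, 'e::euclidean_space) atlas \<Rightarrow> 'a endo \<Rightarrow> 'a \<Rightarrow> 'a cvec set" where
  "T10 A J p = {z \<in> ctangent_space A p.
     (\<lambda>f. Complex (J p (re_vec z) f) (J p (im_vec z) f)) = (\<lambda>f. \<i> * z f)}"

definition complex_frame ::
  "('a, 'e::euclidean_space) atlas \<Rightarrow> 'a endo \<Rightarrow> 'a \<Rightarrow> (nat \<Rightarrow> 'a cvec) \<Rightarrow> bool" where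
  "complex_frame A J p z \<longleftrightarrow>
     (\<forall>\<alpha>\<in>{1..DIM('e) div 2}. z \<alpha> \<in> T10 A J p) \<and>
     (\<forall>w\<in>T10 A J p. \<exists>c. w = (\<lambda>f. \<Sum>\<alpha>=1..DIM('e) div 2. c \<alpha> * z \<alpha> f)) \<and>
     (\<forall>c. (\<lambda>f. \<Sum>\<alpha>=1..DIM('e) div 2. c \<alpha> * z \<alpha> f) = (\<lambda>f. 0) \<longrightarrow>
        (\<forall>\<alpha>\<in>{1..DIM('e) div 2}. c \<alpha> = 0))"

type_synonym 'a covec = "'a cvec \<Rightarrow> complex"

definition complex_covector :: "('a, 'e::euclidean_space) atlas \<Rightarrow> 'a \<Rightarrow> 'a covec \<Rightarrow> bool" where
  "complex_covector A p \<zeta> \<longleftrightarrow>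
     (\<forall>x\<in>ctangent_space A p. \<forall>y\<in>ctangent_space A p. \<forall>a b.
        \<zeta> (\<lambda>f. a * x f + b * y f) = a * \<zeta> x + b * \<zeta> y)"

text \<open>\<open>\<zeta>\<close> and \<open>\<eta>\<close> are the coframes \<open>z\<^sup>\<alpha>\<close> and its conjugate, dual to the frame \<open>z\<close> and its conjugate.\<close>

definition dual_coframes ::
  "('a, 'e::euclidean_space) atlas \<Rightarrow> 'a \<Rightarrow> (nat \<Rightarrow> 'a cvec) \<Rightarrow> (nat \<Rightarrow> 'a covec) \<Rightarrow> (nat \<Rightarrow> 'a covec) \<Rightarrow> bool" where
  "dual_coframes A p z \<zeta> \<eta> \<longleftrightarrow>
     (\<forall>\<alpha>\<in>{1..DIM('e) div 2}.
        complex_covector A p (\<zeta> \<alpha>) \<and> complex_covector A p (\<eta> \<alpha>) \<and>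
        (\<forall>\<beta>\<in>{1..DIM('e) div 2}.
           \<zeta> \<alpha> (z \<beta>) = (if \<alpha> = \<beta> then 1 else 0) \<and> \<zeta> \<alpha> (cnj_vec (z \<beta>)) = 0 \<and>
           \<eta> \<alpha> (z \<beta>) = 0 \<and> \<eta> \<alpha> (cnj_vec (z \<beta>)) = (if \<alpha> = \<beta> then 1 else 0)))"

text \<open>\<open>H \<alpha> \<beta>\<close> is \<open>h\<^sup>\<alpha>\<^sup>\<beta>\<close> with \<open>\<beta>\<close> barred.\<close>

definition inverse_metric ::
  "('a, 'e::euclidean_space) atlas \<Rightarrow> 'a two_tensor \<Rightarrow> 'a \<Rightarrow> (nat \<Rightarrow> 'a cvec) \<Rightarrow> (nat \<Rightarrow> nat \<Rightarrow> complex) \<Rightarrow> bool" where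
  "inverse_metric A g p z H \<longleftrightarrow>
     (\<forall>\<alpha>\<in>{1..DIM('e) div 2}. \<forall>\<beta>\<in>{1..DIM('e) div 2}.
        (\<Sum>\<gamma>=1..DIM('e) div 2. cext2 (g p) (z \<alpha>) (cnj_vec (z \<gamma>)) * H \<beta> \<gamma>) =
          (if \<alpha> = \<beta> then 1 else 0))"

definition wedge :: "'a covec \<Rightarrow> 'a covec \<Rightarrow> 'a cvec \<Rightarrow> 'a cvec \<Rightarrow> complex" where
  "wedge \<alpha> \<beta> x y = \<alpha> x * \<beta> y - \<alpha> y * \<beta> x"

definition third_ricci ::
  "('a, 'e::euclidean_space) atlas \<Rightarrow> 'a endo \<Rightarrow> 'a two_tensor \<Rightarrow> 'a connection
     \<Rightarrow> 'a \<Rightarrow> 'a tvec \<Rightarrow> 'a tvec \<Rightarrow> complex" where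
  "third_ricci A J g D p u v =
     (let (z, \<zeta>, \<eta>, H) = (SOME (z, \<zeta>, \<eta>, H).
            complex_frame A J p z \<and> dual_coframes A p z \<zeta> \<eta> \<and> inverse_metric A g p z H);
          zb = (\<lambda>\<alpha>. cnj_vec (z \<alpha>));
          R = cext4 (\<lambda>x y w t. g p (curvature_at A D p x y w) t);
          I = {1..DIM('e) div 2}
      in (\<i> / 2) * (\<Sum>\<mu>\<in>I. \<Sum>\<kappa>\<in>I.
            (\<Sum>\<alpha>\<in>I. \<Sum>\<beta>\<in>I. H \<alpha> \<beta> * R (z \<mu>) (z \<alpha>) (zb \<beta>) (z \<kappa>)) *
            wedge (\<zeta> \<kappa>) (\<zeta> \<mu>) (real_vec u) (real_vec v))
       + \<i> * (\<Sum>\<mu>\<in>I. \<Sum>\<kappa>\<in>I.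
            (\<Sum>\<alpha>\<in>I. \<Sum>\<beta>\<in>I. H \<alpha> \<beta> * R (zb \<mu>) (z \<alpha>) (zb \<beta>) (z \<kappa>)) *
            wedge (\<zeta> \<kappa>) (\<eta> \<mu>) (real_vec u) (real_vec v))
       - (\<i> / 2) * (\<Sum>\<mu>\<in>I. \<Sum>\<kappa>\<in>I.
            (\<Sum>\<alpha>\<in>I. \<Sum>\<beta>\<in>I. H \<alpha> \<beta> * R (zb \<mu>) (zb \<beta>) (z \<alpha>) (zb \<kappa>)) *
            wedge (\<eta> \<kappa>) (\<eta> \<mu>) (real_vec u) (real_vec v)))"

end

theory Submission
  imports Defs
begin

text \<open>
  The Chern connection of \<open>e\<^sup>2\<^sup>f g\<close> is \<open>D' X Y = D X Y + df X \<cdot> Y + d\<^sup>cf X \<cdot> J Y\<close>. Indeed the right-hand side is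
  metric for \<open>e\<^sup>2\<^sup>f g\<close>, commutes with \<open>J\<close>, and the change of torsion is anti-invariant under
  \<open>(X, Y) \<mapsto> (J X, J Y)\<close>; two connections with these properties coincide (\<open>chern_difference_zero\<close>,
  \<open>chern_connection_conformal\<close>). The added terms are one-forms times the parallel and commuting endomorphisms
  \<open>Id\<close> and \<open>J\<close>, so the curvature changes only by their exterior derivatives,
  \<open>R' X Y = R X Y + dd\<^sup>cf (X, Y) J\<close> (\<open>curvature_conformal\<close>).

  The three formulas are three contractions of the tensor \<open>dd\<^sup>cf (X, Y) g (J Z, W)\<close>. Contracting the second
  factor gives the real dimension times \<open>dd\<^sup>cf\<close>, contracting the first gives the Lefschetz trace of \<open>dd\<^sup>cf\<close>
  times \<open>F\<close>, and contracting across the two factors gives \<open>dd\<^sup>cf\<close> back.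

  Curvature and exterior derivative at a point are defined by arbitrary extensions of tangent vectors, and the
  Ricci forms by arbitrary frames, chosen independently for the two metrics. The first choice is harmless because
  the expressions are tensorial. For this, tangent vectors, which are derivations of the algebra of
  smooth functions, have to be expressed by coordinate fields: \<open>local_frame\<close>, proved with Hadamard's lemma,
  writes every vector field as a combination of finitely many fields with global smooth coefficients, up to a
  multiple of itself that vanishes at the point. The second choice is harmless because the contractions do not depend
  on the frame (\<open>trace_frame_independent\<close>). The third Ricci form, defined with a complex frame, dual coframes and
  an inverse metric, equals an expression in any real adapted frame (\<open>third_form_eq\<close>): the
  inverse metric is the contraction of the coframes over the real frame. It then suffices to compare a frame \<open>e\<close>
  for \<open>g\<close> with the frame \<open>e\<^sup>-\<^sup>f e\<close> for \<open>e\<^sup>2\<^sup>f g\<close>.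
\<close>

section \<open>Calculus of iterated derivatives\<close>

lemma C_k_on_SucD:
  assumes "C_k_on (Suc k) S f" "x \<in> S"
  shows "(f has_derivative frechet_derivative f (at x)) (at x)"
  using assms by (simp add: frechet_derivative_works)

lemma C_k_on_cong:
  fixes f g :: "'e::euclidean_space \<Rightarrow> 'b::real_normed_vector"
  assumes "open S" "\<And>x. x \<in> S \<Longrightarrow> f x = g x" "C_k_on k S f"
  shows "C_k_on k S g"
  using assms(2,3)
proof (induction k arbitrary: f g)
  case 0
  then show ?case using continuous_on_cong by fastforce
next
  case (Suc k)
  have d: "(g has_derivative frechet_derivative f (at x)) (at x)" if "x \<in> S" for x
    using has_derivative_transform_within_open[OF C_k_on_SucD[OF Suc.prems(2) that] assms(1) that]
      Suc.prems(1) by auto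
  have "frechet_derivative f (at x) = frechet_derivative g (at x)" if "x \<in> S" for x
    using frechet_derivative_at[OF d[OF that]] .
  then show ?case
    using Suc.IH[of "\<lambda>x. frechet_derivative f (at x) v" "\<lambda>x. frechet_derivative g (at x) v" for v]
      Suc.prems(2) d by (auto simp: differentiable_def)
qed

text \<open>
  A derivative given by an explicit formula may replace the Frechet derivative in the recursion
  that defines \<open>C_k_on\<close>.
\<close>

lemma C_k_on_SucI:
  fixes f :: "'e::euclidean_space \<Rightarrow> 'b::real_normed_vector"
  assumes "open S" "\<And>x. x \<in> S \<Longrightarrow> (f has_derivative F x) (at x)" "\<And>v. C_k_on k S (\<lambda>x. F x v)"
  shows "C_k_on (Suc k) S f"
proof -
  have "F x = frechet_derivative f (at x)" if "x \<in> S" for x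
    using frechet_derivative_at[OF assms(2)[OF that]] .
  then have "C_k_on k S (\<lambda>x. frechet_derivative f (at x) v)" for v
    using C_k_on_cong[OF assms(1) _ assms(3)[of v]] by simp
  then show ?thesis using assms(2) by (auto simp: differentiable_def)
qed

lemma C_k_on_subset: "C_k_on k S f \<Longrightarrow> T \<subseteq> S \<Longrightarrow> C_k_on k T f"
  by (induction k arbitrary: f) (auto intro: continuous_on_subset)

lemma C_k_on_local:
  assumes "\<And>x. x \<in> S \<Longrightarrow> \<exists>T. open T \<and> x \<in> T \<and> C_k_on k T f"
  shows "C_k_on k S f"
  using assms
proof (induction k arbitrary: f)
  case 0
  show ?case
  proof (simp, intro continuous_at_imp_continuous_on ballI)
    fix x assume "x \<in> S"
    then show "isCont f x" using 0 continuous_on_eq_continuous_at by fastforce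
  qed
next
  case (Suc k)
  show ?case
  proof (simp, intro conjI allI ballI)
    fix x assume "x \<in> S" then show "f differentiable at x" using Suc.prems by fastforce
  next
    fix v show "C_k_on k S (\<lambda>x. frechet_derivative f (at x) v)"
      using Suc.prems by (intro Suc.IH) fastforce
  qed
qed

lemma C_k_on_Suc_imp: "C_k_on (Suc k) S f \<Longrightarrow> C_k_on k S f"
proof (induction k arbitrary: f)
  case 0
  then show ?case
    by (simp add: continuous_at_imp_continuous_on differentiable_imp_continuous_within)
next
  case (Suc k)
  then show ?case by (metis C_k_on.simps(2))
qed

lemma C_k_on_continuous: "C_k_on k S f \<Longrightarrow> continuous_on S f"
proof (induction k)
  case (Suc k)
  then show ?case using C_k_on_Suc_imp by blast
qed simp

lemma C_k_on_const: "C_k_on k S (\<lambda>x. c)"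
proof (induction k arbitrary: c)
  case (Suc k)
  then show ?case by (simp add: frechet_derivative_const)
qed simp

lemma C_k_on_add:
  fixes f g :: "'e::euclidean_space \<Rightarrow> 'b::real_normed_vector"
  assumes "open S" "C_k_on k S f" "C_k_on k S g"
  shows "C_k_on k S (\<lambda>x. f x + g x)"
  using assms(2,3)
proof (induction k arbitrary: f g)
  case (Suc k)
  show ?case
    by (rule C_k_on_SucI[OF assms(1) has_derivative_add[OF C_k_on_SucD C_k_on_SucD]])
      (use Suc in auto)
qed (auto intro: continuous_on_add)

lemma C_k_on_sum:
  fixes f :: "'i \<Rightarrow> 'e::euclidean_space \<Rightarrow> 'b::real_normed_vector"
  assumes "open S" "\<And>i. i \<in> I \<Longrightarrow> C_k_on k S (f i)"
  shows "C_k_on k S (\<lambda>x. \<Sum>i\<in>I. f i x)"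
  using assms(2)
  by (induction I rule: infinite_finite_induct) (auto intro: C_k_on_const C_k_on_add[OF assms(1)])

lemma C_k_on_bounded_linear:
  fixes f :: "'e::euclidean_space \<Rightarrow> 'b::real_normed_vector"
  assumes "open S" "bounded_linear L" "C_k_on k S f"
  shows "C_k_on k S (\<lambda>x. L (f x))"
  using assms(3)
proof (induction k arbitrary: f)
  case 0
  then show ?case using bounded_linear.continuous_on[OF assms(2)] by auto
next
  case (Suc k)
  show ?case
    by (rule C_k_on_SucI[OF assms(1) bounded_linear.has_derivative[OF assms(2) C_k_on_SucD]])
      (use Suc in auto)
qed

lemma C_k_on_mult:
  fixes f g :: "'e::euclidean_space \<Rightarrow> real"
  assumes "open S" "C_k_on k S f" "C_k_on k S g"
  shows "C_k_on k S (\<lambda>x. f x * g x)"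
  using assms(2,3)
proof (induction k arbitrary: f g)
  case (Suc k)
  show ?case
    by (rule C_k_on_SucI[OF assms(1) has_derivative_mult[OF C_k_on_SucD C_k_on_SucD]])
      (use Suc.prems C_k_on_Suc_imp[OF Suc.prems(1)] C_k_on_Suc_imp[OF Suc.prems(2)]
        in \<open>auto intro!: C_k_on_add[OF assms(1)] Suc.IH\<close>)
qed (auto intro: continuous_on_mult)

text \<open>
  The derivative of the composition is \<open>F' (f x) (f' x v)\<close>, where the argument of the linear map varies
  too. Expanding this argument in the basis turns it into a sum of products of real functions, to
  which the induction hypothesis applies.
\<close>

lemma C_k_on_compose:
  fixes f :: "'e::euclidean_space \<Rightarrow> 'b::euclidean_space" and F :: "'b \<Rightarrow> real"
  assumes "open S" "C_k_on k T F" "C_k_on k S f" "f ` S \<subseteq> T"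
  shows "C_k_on k S (\<lambda>x. F (f x))"
  using assms(2,3)
proof (induction k arbitrary: F)
  case 0
  then show ?case using assms(4) continuous_on_compose2[of T F S f] by auto
next
  case (Suc k)
  let ?F = "\<lambda>x. frechet_derivative F (at (f x))" and ?f = "\<lambda>x. frechet_derivative f (at x)"
  have d: "((\<lambda>x. F (f x)) has_derivative (\<lambda>v. ?F x (?f x v))) (at x)" if "x \<in> S" for x
    using has_derivative_compose[OF C_k_on_SucD[OF Suc.prems(2) that]
        C_k_on_SucD[OF Suc.prems(1)]] assms(4) that by auto
  have eq: "(\<Sum>b\<in>Basis. (?f x v \<bullet> b) * ?F x b) = ?F x (?f x v)" if "x \<in> S" for x v
  proof -
    have "linear (?F x)"
      using C_k_on_SucD[OF Suc.prems(1), of "f x"] assms(4) that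
      by (auto dest: has_derivative_linear)
    then have "?F x (\<Sum>b\<in>Basis. (?f x v \<bullet> b) *\<^sub>R b) = (\<Sum>b\<in>Basis. (?f x v \<bullet> b) * ?F x b)"
      by (simp add: linear_sum linear_scale)
    then show ?thesis by (simp add: euclidean_representation)
  qed
  have "C_k_on k S (\<lambda>x. \<Sum>b\<in>Basis. (?f x v \<bullet> b) * ?F x b)" for v
  proof (intro C_k_on_sum C_k_on_mult assms(1))
    fix b :: 'b
    show "C_k_on k S (\<lambda>x. ?f x v \<bullet> b)"
      using Suc.prems(2) by (intro C_k_on_bounded_linear[OF assms(1) bounded_linear_inner_left]) auto
    show "C_k_on k S (\<lambda>x. ?F x b)"
      using Suc.prems C_k_on_Suc_imp[OF Suc.prems(2)]
      by (intro Suc.IH[where F = "\<lambda>y. frechet_derivative F (at y) b"]) auto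
  qed
  then have "C_k_on k S (\<lambda>x. ?F x (?f x v))" for v
    by (rule C_k_on_cong[OF assms(1) eq[where v = v], rotated])
  then show ?case using d by (intro C_k_on_SucI[OF assms(1)])
qed

lemma smooth_on_cong:
  "open S \<Longrightarrow> (\<And>x. x \<in> S \<Longrightarrow> f x = g x) \<Longrightarrow> smooth_on S f \<Longrightarrow> smooth_on S g"
  unfolding smooth_on_def using C_k_on_cong by blast
lemma smooth_on_subset: "smooth_on S f \<Longrightarrow> T \<subseteq> S \<Longrightarrow> smooth_on T f"
  unfolding smooth_on_def using C_k_on_subset by blast
lemma smooth_on_local:
  "(\<And>x. x \<in> S \<Longrightarrow> \<exists>T. open T \<and> x \<in> T \<and> smooth_on T f) \<Longrightarrow> smooth_on S f"
  unfolding smooth_on_def by (meson C_k_on_local)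
lemma smooth_on_const: "smooth_on S (\<lambda>x. c)"
  unfolding smooth_on_def using C_k_on_const by blast
lemma smooth_on_add:
  "open S \<Longrightarrow> smooth_on S f \<Longrightarrow> smooth_on S g \<Longrightarrow> smooth_on S (\<lambda>x. f x + g x)"
  unfolding smooth_on_def using C_k_on_add by blast
lemma smooth_on_bounded_linear:
  "open S \<Longrightarrow> bounded_linear L \<Longrightarrow> smooth_on S f \<Longrightarrow> smooth_on S (\<lambda>x. L (f x))"
  unfolding smooth_on_def using C_k_on_bounded_linear by blast
lemma smooth_on_mult:
  fixes f g :: "'e::euclidean_space \<Rightarrow> real"
  shows "open S \<Longrightarrow> smooth_on S f \<Longrightarrow> smooth_on S g \<Longrightarrow> smooth_on S (\<lambda>x. f x * g x)"
  unfolding smooth_on_def using C_k_on_mult by blast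
lemma smooth_on_compose:
  fixes f :: "'e::euclidean_space \<Rightarrow> 'b::euclidean_space" and F :: "'b \<Rightarrow> real"
  shows "open S \<Longrightarrow> smooth_on T F \<Longrightarrow> smooth_on S f \<Longrightarrow> f ` S \<subseteq> T \<Longrightarrow> smooth_on S (\<lambda>x. F (f x))"
  unfolding smooth_on_def using C_k_on_compose by blast
lemma smooth_on_derivative:
  "smooth_on S f \<Longrightarrow> smooth_on S (\<lambda>x. frechet_derivative f (at x) v)"
  unfolding smooth_on_def by (metis C_k_on.simps(2))
lemma smooth_on_has_derivative:
  "smooth_on S f \<Longrightarrow> x \<in> S \<Longrightarrow> (f has_derivative frechet_derivative f (at x)) (at x)"
  unfolding smooth_on_def by (metis C_k_on_SucD)
lemma smooth_on_continuous: "smooth_on S f \<Longrightarrow> continuous_on S f"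
  unfolding smooth_on_def by (metis C_k_on.simps(1))

lemma smooth_on_id: "open S \<Longrightarrow> smooth_on S (\<lambda>x. x)"
proof -
  assume S: "open S"
  have "C_k_on k S (\<lambda>x. x)" for k
  proof (cases k)
    case (Suc j)
    show ?thesis unfolding Suc
      by (rule C_k_on_SucI[OF S has_derivative_ident C_k_on_const])
  qed (simp add: continuous_on_id)
  then show ?thesis unfolding smooth_on_def by blast
qed

lemma smooth_on_exp: "smooth_on UNIV (exp :: real \<Rightarrow> real)"
proof -
  have "C_k_on k UNIV (exp :: real \<Rightarrow> real)" for k
  proof (induction k)
    case (Suc k)
    show ?case
      by (rule C_k_on_SucI[where F = "\<lambda>x v. v * exp x"])
        (use Suc in \<open>auto intro!: C_k_on_mult C_k_on_const derivative_eq_intros\<close>)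
  qed (simp add: continuous_on_exp)
  then show ?thesis unfolding smooth_on_def by blast
qed

section \<open>Bump functions and Hadamard's lemma\<close>

text \<open>
  For \<open>n = 0\<close> this is the standard smooth function that is flat at the origin. The powers of \<open>1 / t\<close> are
  there because the resulting family is closed under differentiation.
\<close>

definition flat :: "nat \<Rightarrow> real \<Rightarrow> real" where
  "flat n t = (if t > 0 then inverse t ^ n * exp (- inverse t) else 0)"

text \<open>
  This one limit is all that differentiability at the origin needs, since the difference quotient of
  \<open>flat n\<close> there is \<open>flat (Suc n)\<close>.
\<close>

lemma flat_tendsto_0: "(flat n \<longlongrightarrow> 0) (at 0)"
proof -
  have 1: "((\<lambda>t. inverse t ^ n * exp (- inverse t)) \<longlongrightarrow> (0::real)) (at_right 0)"
  proof -
    have "((\<lambda>s::real. s ^ n / exp s) \<longlongrightarrow> 0) at_top" by (rule tendsto_power_div_exp_0)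
    then have "((\<lambda>s::real. inverse s ^ n / exp (inverse s)) \<longlongrightarrow> 0) (at_right 0)"
      using filterlim_compose[OF _ filterlim_inverse_at_top_right] by blast
    then show ?thesis by (simp add: exp_minus divide_inverse)
  qed
  have "(flat n \<longlongrightarrow> 0) (at_right 0)"
    by (rule Lim_transform_eventually[OF 1])
      (auto simp: flat_def eventually_at_filter)
  moreover have "(flat n \<longlongrightarrow> 0) (at_left 0)"
    by (rule Lim_transform_eventually[OF tendsto_const])
      (auto simp: flat_def eventually_at_filter)
  ultimately show ?thesis by (simp add: filterlim_split_at)
qed

lemma flat_deriv:
  "(flat n has_real_derivative (flat (n + 2) t - real n * flat (n + 1) t)) (at t)"
proof -
  consider "t > 0" | "t < 0" | "t = 0" by linarith
  then show ?thesis
  proof cases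
    case 1
    have "((\<lambda>t. inverse t ^ n * exp (- inverse t)) has_real_derivative
        (flat (n + 2) t - real n * flat (n + 1) t)) (at t)"
    proof -
      have "((\<lambda>t. inverse t ^ n * exp (- inverse t)) has_real_derivative
          (inverse t ^ n * (exp (- inverse t) * (inverse t)\<^sup>2)
            - real n * (inverse t)\<^sup>2 * inverse t ^ (n - 1) * exp (- inverse t))) (at t)"
        using 1 by (auto intro!: derivative_eq_intros simp: power2_eq_square algebra_simps)
      then show ?thesis using 1 by (cases n) (auto simp: flat_def power2_eq_square algebra_simps)
    qed
    then show ?thesis
      by (rule has_field_derivative_transform_within_open[where S = "{0<..}"])
        (use 1 in \<open>auto simp: flat_def\<close>)
  next
    case 2
    have "((\<lambda>t. 0) has_real_derivative (flat (n + 2) t - real n * flat (n + 1) t)) (at t)"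
      using 2 by (simp add: flat_def)
    then show ?thesis
      by (rule has_field_derivative_transform_within_open[where S = "{..<0}"])
        (use 2 in \<open>auto simp: flat_def\<close>)
  next
    case 3
    have "((\<lambda>h. (flat n (0 + h) - flat n 0) / h) \<longlongrightarrow> 0) (at 0)"
      by (rule Lim_transform_eventually[OF flat_tendsto_0[of "Suc n"]])
        (auto simp: flat_def eventually_at_filter divide_inverse)
    then show ?thesis using 3 by (simp add: DERIV_def flat_def)
  qed
qed

lemma smooth_on_flat: "smooth_on UNIV (flat n)"
proof -
  have "C_k_on k UNIV (flat n)" for k
  proof (induction k arbitrary: n)
    case 0
    show ?case using DERIV_isCont[OF flat_deriv] by (auto simp: continuous_on_eq_continuous_at)
  next
    case (Suc k)
    have "C_k_on k UNIV (\<lambda>x. (flat (n + 2) x + (- real n) * flat (n + 1) x) * v)" for v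
      by (intro C_k_on_mult C_k_on_add C_k_on_const Suc open_UNIV)
    then show ?case
      using flat_deriv[of n] 
      by (intro C_k_on_SucI[where F = "\<lambda>x v. (flat (n + 2) x - real n * flat (n + 1) x) * v"])
        (auto simp: has_field_derivative_def)
  qed
  then show ?thesis unfolding smooth_on_def by blast
qed

text \<open>
  The function \<open>flat 0\<close> evaluated at \<open>r\<^sup>2 - (dist x0 x)\<^sup>2\<close> and normalised. A bump that is \<open>1\<close> only at the
  centre suffices: the frame built from it has the bump as a factor instead of being exact near the
  point.
\<close>

lemma bump_function:
  fixes x0 :: "'e::euclidean_space"
  assumes "r > 0"
  obtains \<beta> :: "'e \<Rightarrow> real"
  where "smooth_on UNIV \<beta>" "\<beta> x0 = 1" "\<And>x. x \<notin> ball x0 r \<Longrightarrow> \<beta> x = 0"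
proof
  let ?q = "\<lambda>x. r\<^sup>2 + (-1) * (\<Sum>b\<in>Basis. ((x + (- x0)) \<bullet> b) * ((x + (- x0)) \<bullet> b))"
  let ?\<beta> = "\<lambda>x. flat 0 (?q x) * inverse (flat 0 (r\<^sup>2))"
  have q: "?q x = r\<^sup>2 - (dist x0 x)\<^sup>2" for x
  proof -
    have "(\<Sum>b\<in>Basis. ((x + (- x0)) \<bullet> b) * ((x + (- x0)) \<bullet> b)) = (x - x0) \<bullet> (x - x0)"
      by (simp add: euclidean_inner[of "x - x0" "x - x0"])
    then show ?thesis by (simp add: dist_norm dot_square_norm norm_minus_commute)
  qed
  have "smooth_on UNIV ?q"
    unfolding smooth_on_def
  proof (intro allI C_k_on_add C_k_on_mult C_k_on_sum C_k_on_const open_UNIV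
      C_k_on_bounded_linear[OF open_UNIV bounded_linear_inner_left])
    fix k show "C_k_on k UNIV (\<lambda>x::'e. x)" using smooth_on_id[OF open_UNIV] by (auto simp: smooth_on_def)
    then show "C_k_on k UNIV (\<lambda>x::'e. x)" .
  qed
  then show "smooth_on UNIV ?\<beta>"
    by (intro smooth_on_mult smooth_on_const smooth_on_compose[OF _ smooth_on_flat]) auto
  have "flat 0 (r\<^sup>2) \<noteq> 0" using assms by (simp add: flat_def)
  then show "?\<beta> x0 = 1" by (simp add: q)
  show "?\<beta> x = 0" if "x \<notin> ball x0 r" for x
  proof -
    have "r\<^sup>2 \<le> (dist x0 x)\<^sup>2" using that assms by (intro power_mono) auto
    then show ?thesis unfolding q by (simp add: flat_def)
  qed
qed

lemma integral_along_ray_continuous: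
  fixes F :: "'e::euclidean_space \<Rightarrow> real"
  assumes "convex S" "a \<in> S" "continuous_on S F"
  shows "continuous_on (S \<times> cbox 0 1) (\<lambda>(x, t). t ^ j * F (a + t *\<^sub>R (x - a)))"
proof -
  have "a + t *\<^sub>R (x - a) \<in> S" if "x \<in> S" "t \<in> cbox 0 1" for x t
    using convexD_alt[OF assms(1,2) that(1), of t] that(2)
    by (simp add: algebra_simps)
  then show ?thesis
    unfolding case_prod_unfold
    by (intro continuous_intros continuous_on_compose2[OF assms(3)]) auto
qed

text \<open>
  Differentiation under the integral sign in \<open>x\<close> replaces \<open>F\<close> by a directional derivative and produces
  one more factor \<open>t\<close>. The weight \<open>t ^ j\<close> makes the statement stable under this step.
\<close>

lemma integral_along_ray_C_k:
  fixes F :: "'e::euclidean_space \<Rightarrow> real"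
  assumes "open S" "convex S" "a \<in> S" "C_k_on k S F"
  shows "C_k_on k S (\<lambda>x. integral (cbox 0 1) (\<lambda>t. t ^ j * F (a + t *\<^sub>R (x - a))))"
  using assms(4)
proof (induction k arbitrary: F j)
  case 0
  then show ?case
    using integral_continuous_on_param[OF integral_along_ray_continuous[OF assms(2,3)]] by simp
next
  case (Suc k)
  have seg: "a + t *\<^sub>R (x - a) \<in> S" if "x \<in> S" "t \<in> cbox 0 1" for x t
    using convexD_alt[OF assms(2,3) that(1), of t] that(2)
    by (simp add: algebra_simps)
  let ?F' = "\<lambda>x. frechet_derivative F (at x)"
  have bl: "bounded_linear (?F' x)" if "x \<in> S" for x
    using C_k_on_SucD[OF Suc.prems that] has_derivative_bounded_linear by blast
  define fx where "fx = (\<lambda>x (t::real). Blinfun (\<lambda>v. t ^ Suc j * ?F' (a + t *\<^sub>R (x - a)) v))"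
  have fx: "blinfun_apply (fx x t) = (\<lambda>v. t ^ Suc j * ?F' (a + t *\<^sub>R (x - a)) v)"
    if "x \<in> S" "t \<in> cbox 0 1" for x t
    unfolding fx_def
    by (rule bounded_linear_Blinfun_apply)
      (intro bounded_linear_const_mult bl seg that)
  have cont: "continuous_on (S \<times> cbox 0 1) (\<lambda>(x, t). fx x t)"
  proof (rule continuous_on_blinfun_componentwise)
    fix i :: 'e
    have "continuous_on S (\<lambda>x. ?F' x i)"
      using Suc.prems C_k_on_continuous[of k S "\<lambda>x. ?F' x i"] by simp
    from integral_along_ray_continuous[OF assms(2,3) this, of "Suc j"]
    show "continuous_on (S \<times> cbox 0 1) (\<lambda>x. (case x of (x, t) \<Rightarrow> fx x t) i)"
      by (rule continuous_on_eq) (auto simp: fx)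
  qed
  have der: "((\<lambda>x. integral (cbox 0 1) (\<lambda>t. t ^ j * F (a + t *\<^sub>R (x - a)))) has_derivative
      blinfun_apply (integral (cbox 0 1) (fx x))) (at x)" if x: "x \<in> S" for x
  proof -
    have "((\<lambda>x. integral (cbox 0 1) (\<lambda>t. t ^ j * F (a + t *\<^sub>R (x - a)))) has_derivative
      blinfun_apply (integral (cbox 0 1) (fx x))) (at x within S)"
    proof (rule leibniz_rule[OF _ _ cont x assms(2)])
      fix y and t :: real assume yt: "y \<in> S" "t \<in> cbox 0 1"
      have "((\<lambda>y. a + t *\<^sub>R (y - a)) has_derivative (\<lambda>v. t *\<^sub>R v)) (at y within S)"
        by (auto intro!: derivative_eq_intros)
      from has_derivative_compose[OF this C_k_on_SucD[OF Suc.prems seg[OF yt]]]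
      have "((\<lambda>y. F (a + t *\<^sub>R (y - a))) has_derivative
          (\<lambda>v. ?F' (a + t *\<^sub>R (y - a)) (t *\<^sub>R v))) (at y within S)" .
      then have "((\<lambda>y. t ^ j * F (a + t *\<^sub>R (y - a))) has_derivative
          (\<lambda>v. t ^ j * ?F' (a + t *\<^sub>R (y - a)) (t *\<^sub>R v))) (at y within S)"
        by (rule has_derivative_mult_right)
      then show "((\<lambda>y. t ^ j * F (a + t *\<^sub>R (y - a))) has_derivative
          blinfun_apply (fx y t)) (at y within S)"
        using bounded_linear.linear[OF bl[OF seg[OF yt]]]
        by (simp add: fx[OF yt] linear_scale mult_ac)
    next
      fix y assume y: "y \<in> S"
      have "continuous_on (cbox 0 1) (\<lambda>t. (\<lambda>(x, t). t ^ j * F (a + t *\<^sub>R (x - a))) (y, t))"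
        using y C_k_on_continuous[OF Suc.prems]
        by (intro continuous_on_compose2[OF integral_along_ray_continuous[OF assms(2,3)]]
             continuous_intros) auto
      then show "(\<lambda>t. t ^ j * F (a + t *\<^sub>R (y - a))) integrable_on cbox 0 1"
        by (intro integrable_continuous) simp
    qed
    then show ?thesis using at_within_open[OF x assms(1)] by simp
  qed
  have eq: "integral (cbox 0 1) (\<lambda>t. t ^ Suc j * ?F' (a + t *\<^sub>R (x - a)) v)
      = blinfun_apply (integral (cbox 0 1) (fx x)) v" if x: "x \<in> S" for x v
  proof -
    have "fx x integrable_on cbox 0 1"
      using continuous_on_compose2[OF cont continuous_on_Pair[OF continuous_on_const continuous_on_id],
          of x "cbox 0 1"] x
      by (intro integrable_continuous) auto
    then have "blinfun_apply (integral (cbox 0 1) (fx x)) v = integral (cbox 0 1) (\<lambda>t. fx x t v)"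
      by (rule blinfun_apply_integral)
    also have "\<dots> = integral (cbox 0 1) (\<lambda>t. t ^ Suc j * ?F' (a + t *\<^sub>R (x - a)) v)"
      by (rule integral_cong) (use x in \<open>simp add: fx\<close>)
    finally show ?thesis by simp
  qed
  have "C_k_on k S (\<lambda>x. integral (cbox 0 1) (\<lambda>t. t ^ Suc j * ?F' (a + t *\<^sub>R (x - a)) v))" for v
    using Suc.prems by (intro Suc.IH[where F = "\<lambda>y. frechet_derivative F (at y) v"]) simp
  then have "C_k_on k S (\<lambda>x. blinfun_apply (integral (cbox 0 1) (fx x)) v)" for v
    by (rule C_k_on_cong[OF assms(1) eq[where v = v], rotated])
  then show ?case using der by (intro C_k_on_SucI[OF assms(1)])
qed

text \<open>
  The fundamental theorem of calculus on the segment from \<open>a\<close> to \<open>x\<close>, whose integrand is linear in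
  \<open>x - a\<close>. It is what forces a derivation to be a combination of partial derivatives.
\<close>

lemma hadamard:
  fixes F :: "'e::euclidean_space \<Rightarrow> real"
  assumes "open S" "convex S" "a \<in> S" "smooth_on S F"
  obtains G :: "'e \<Rightarrow> 'e \<Rightarrow> real"
  where "\<And>b. smooth_on S (G b)" "\<And>b. G b a = frechet_derivative F (at a) b"
    "\<And>x. x \<in> S \<Longrightarrow> F x - F a = (\<Sum>b\<in>Basis. ((x - a) \<bullet> b) * G b x)"
proof
  let ?F' = "\<lambda>x. frechet_derivative F (at x)"
  let ?G = "\<lambda>b x. integral (cbox 0 1) (\<lambda>t::real. t ^ 0 * ?F' (a + t *\<^sub>R (x - a)) b)"
  show "smooth_on S (?G b)" for b
    using smooth_on_derivative[OF assms(4), of b] unfolding smooth_on_def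
    by (intro allI integral_along_ray_C_k assms) auto
  show "?G b a = ?F' a b" for b by simp
  fix x assume x: "x \<in> S"
  have seg: "a + t *\<^sub>R (x - a) \<in> S" if "t \<in> {0..1}" for t
    using convexD_alt[OF assms(2,3) x, of t] that by (simp add: algebra_simps)
  have d: "((\<lambda>t. F (a + t *\<^sub>R (x - a))) has_vector_derivative ?F' (a + t *\<^sub>R (x - a)) (x - a))
      (at t within {0..1})" if t: "t \<in> {0..1}" for t
  proof -
    note D = smooth_on_has_derivative[OF assms(4) seg[OF t]]
    have "((\<lambda>t. a + t *\<^sub>R (x - a)) has_derivative (\<lambda>s. s *\<^sub>R (x - a))) (at t within {0..1})"
      by (auto intro!: derivative_eq_intros)
    from has_derivative_compose[OF this D] show ?thesis
      unfolding has_vector_derivative_def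
      using linear_scale[OF has_derivative_linear[OF D]] by simp
  qed
  have "((\<lambda>t. ?F' (a + t *\<^sub>R (x - a)) (x - a)) has_integral
      F (a + 1 *\<^sub>R (x - a)) - F (a + 0 *\<^sub>R (x - a))) {0..1}"
    by (rule fundamental_theorem_of_calculus) (use d in auto)
  then have "F x - F a = integral (cbox 0 1) (\<lambda>t. ?F' (a + t *\<^sub>R (x - a)) (x - a))"
    by (simp add: integral_unique)
  also have "\<dots> = integral (cbox 0 1) (\<lambda>t. \<Sum>b\<in>Basis. ((x - a) \<bullet> b) *
      (t ^ 0 * ?F' (a + t *\<^sub>R (x - a)) b))"
  proof (rule integral_cong)
    fix t :: real assume "t \<in> cbox 0 1"
    then have "linear (?F' (a + t *\<^sub>R (x - a)))"
      using smooth_on_has_derivative[OF assms(4) seg] has_derivative_linear by auto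
    then have "?F' (a + t *\<^sub>R (x - a)) (\<Sum>b\<in>Basis. ((x - a) \<bullet> b) *\<^sub>R b)
        = (\<Sum>b\<in>Basis. ((x - a) \<bullet> b) * ?F' (a + t *\<^sub>R (x - a)) b)"
      by (simp add: linear_sum linear_scale)
    then show "?F' (a + t *\<^sub>R (x - a)) (x - a) = (\<Sum>b\<in>Basis. ((x - a) \<bullet> b) *
      (t ^ 0 * ?F' (a + t *\<^sub>R (x - a)) b))"
      by (simp add: euclidean_representation)
  qed
  also have "\<dots> = (\<Sum>b\<in>Basis. ((x - a) \<bullet> b) * ?G b x)"
  proof -
    have "(\<lambda>t. (\<lambda>(x, t). t ^ 0 * ?F' (a + t *\<^sub>R (x - a)) b) (x, t)) integrable_on cbox 0 1" for b
      using smooth_on_continuous[OF smooth_on_derivative[OF assms(4), of b]] x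
      by (intro integrable_continuous continuous_on_compose2[OF integral_along_ray_continuous[OF assms(2,3)]]
             continuous_intros) auto
    then show ?thesis
      by (subst integral_sum) (auto intro!: integrable_on_mult_right)
  qed
  finally show "F x - F a = (\<Sum>b\<in>Basis. ((x - a) \<bullet> b) * ?G b x)" .
qed

section \<open>Derivations and local frames on manifolds\<close>

lemma tangent_space_nonsmooth: "v \<in> tangent_space A p \<Longrightarrow> \<not> smooth_fun A f \<Longrightarrow> v f = 0"
  by (auto simp: tangent_space_def)

lemma tangent_space_lin:
  "v \<in> tangent_space A p \<Longrightarrow> smooth_fun A f \<Longrightarrow> smooth_fun A h \<Longrightarrow>
    v (\<lambda>q. a * f q + b * h q) = a * v f + b * v h"
  by (auto simp: tangent_space_def)

lemma tangent_space_mult: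
  "v \<in> tangent_space A p \<Longrightarrow> smooth_fun A f \<Longrightarrow> smooth_fun A h \<Longrightarrow>
    v (\<lambda>q. f q * h q) = v f * h p + f p * v h"
  by (auto simp: tangent_space_def)

lemma tangent_space_add:
  "v \<in> tangent_space A p \<Longrightarrow> smooth_fun A f \<Longrightarrow> smooth_fun A h \<Longrightarrow>
    v (\<lambda>q. f q + h q) = v f + v h"
  using tangent_space_lin[of v A p f h 1 1] by simp

lemma tangent_space_diff:
  "v \<in> tangent_space A p \<Longrightarrow> smooth_fun A f \<Longrightarrow> smooth_fun A h \<Longrightarrow>
    v (\<lambda>q. f q - h q) = v f - v h"
  using tangent_space_lin[of v A p f h 1 "-1"] by simp

lemma tangent_space_scale:
  "v \<in> tangent_space A p \<Longrightarrow> smooth_fun A f \<Longrightarrow> v (\<lambda>q. a * f q) = a * v f"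
  using tangent_space_lin[of v A p f f a 0] by simp

lemma smooth_fun_const: "smooth_fun A (\<lambda>q. c)"
  by (auto simp: smooth_fun_def o_def smooth_on_const)

lemma tangent_space_const: "v \<in> tangent_space A p \<Longrightarrow> v (\<lambda>q. c) = 0"
proof -
  assume v: "v \<in> tangent_space A p"
  have "v (\<lambda>q. 1) = 0" using tangent_space_mult[OF v, of "\<lambda>q. 1" "\<lambda>q. 1"] by (simp add: smooth_fun_const)
  then show ?thesis using tangent_space_scale[OF v smooth_fun_const, of c 1] by simp
qed

lemma vector_fields_at: "X \<in> vector_fields A \<Longrightarrow> X p \<in> tangent_space A p"
  by (auto simp: vector_fields_def)

lemma vector_fields_smooth: "X \<in> vector_fields A \<Longrightarrow> smooth_fun A f \<Longrightarrow> smooth_fun A (\<lambda>p. X p f)"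
  by (auto simp: vector_fields_def)

locale manifold =
  fixes A :: "('a::{t2_space,second_countable_topology}, 'e::euclidean_space) atlas"
  assumes smooth_manifold: "smooth_manifold A"
begin

lemma chart_open: "(U, \<phi>) \<in> A \<Longrightarrow> open U" "(U, \<phi>) \<in> A \<Longrightarrow> open (\<phi> ` U)"
  and chart_homeo: "(U, \<phi>) \<in> A \<Longrightarrow> homeomorphism U (\<phi> ` U) \<phi> (inv_into U \<phi>)"
  and chart_transition: "(U, \<phi>) \<in> A \<Longrightarrow> (V, \<psi>) \<in> A \<Longrightarrow>
    smooth_on (\<phi> ` (U \<inter> V)) (\<psi> \<circ> inv_into U \<phi>)"
  and chart_cover: "\<exists>U \<phi>. (U, \<phi>) \<in> A \<and> p \<in> U"
  using smooth_manifold unfolding smooth_manifold_def by fast+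

lemma chart_inv: "(U, \<phi>) \<in> A \<Longrightarrow> q \<in> U \<Longrightarrow> inv_into U \<phi> (\<phi> q) = q"
  using homeomorphism_apply1[OF chart_homeo] .

lemma chart_open_image:
  assumes "(U, \<phi>) \<in> A" "open W" "W \<subseteq> U"
  shows "open (\<phi> ` W)"
proof -
  have "\<phi> ` W = {y \<in> \<phi> ` U. inv_into U \<phi> y \<in> W}"
    using assms(3) chart_inv[OF assms(1)] by force
  moreover have "continuous_on (\<phi> ` U) (inv_into U \<phi>)"
    using chart_homeo[OF assms(1)] by (auto simp: homeomorphism_def)
  ultimately show ?thesis
    using continuous_open_preimage[OF _ chart_open(2)[OF assms(1)] assms(2)]
    by (simp add: vimage_def Int_def)
qed

lemma smooth_fun_add: "smooth_fun A f \<Longrightarrow> smooth_fun A h \<Longrightarrow> smooth_fun A (\<lambda>q. f q + h q)"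
  using chart_open(2) by (fastforce simp: smooth_fun_def o_def intro!: smooth_on_add)

lemma smooth_fun_mult: "smooth_fun A f \<Longrightarrow> smooth_fun A h \<Longrightarrow> smooth_fun A (\<lambda>q. f q * h q)"
  using chart_open(2) by (fastforce simp: smooth_fun_def o_def intro!: smooth_on_mult)

lemma smooth_fun_scale: "smooth_fun A f \<Longrightarrow> smooth_fun A (\<lambda>q. c * f q)"
  by (intro smooth_fun_mult smooth_fun_const)

lemma smooth_fun_diff: "smooth_fun A f \<Longrightarrow> smooth_fun A h \<Longrightarrow> smooth_fun A (\<lambda>q. f q - h q)"
  using smooth_fun_add[of f "\<lambda>q. (-1) * h q"] smooth_fun_scale[of h "-1"] by simp

lemma smooth_fun_minus: "smooth_fun A f \<Longrightarrow> smooth_fun A (\<lambda>q. - f q)"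
  using smooth_fun_scale[of f "-1"] by simp

lemma smooth_fun_sum: "(\<And>i. i \<in> I \<Longrightarrow> smooth_fun A (f i)) \<Longrightarrow> smooth_fun A (\<lambda>q. \<Sum>i\<in>I. f i q)"
  by (induction I rule: infinite_finite_induct) (auto intro: smooth_fun_const smooth_fun_add)

lemma smooth_fun_exp: "smooth_fun A f \<Longrightarrow> smooth_fun A (\<lambda>q. exp (f q))"
  using chart_open(2) by (fastforce simp: smooth_fun_def o_def intro!: smooth_on_compose[OF _ smooth_on_exp])

lemma tangent_space_sum:
  assumes "v \<in> tangent_space A p" "\<And>i. i \<in> I \<Longrightarrow> smooth_fun A (f i)"
  shows "v (\<lambda>q. \<Sum>i\<in>I. f i q) = (\<Sum>i\<in>I. v (f i))"
  using assms(2)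
  by (induction I rule: infinite_finite_induct)
    (auto simp: tangent_space_const[OF assms(1)] tangent_space_add[OF assms(1)] smooth_fun_sum)

text \<open>
  Around a point outside \<open>C\<close> the function vanishes, around a point of \<open>W\<close> it is smooth by a change of
  charts. The open set \<open>W\<close> is separate from the chart domain because the coefficients of Hadamard's
  lemma are only available on a ball inside the chart.
\<close>

lemma smooth_fun_extend_by_zero:
  assumes UA: "(U, \<phi>) \<in> A" and "closed C" "open W" "C \<subseteq> W" "W \<subseteq> U"
    and zero: "\<And>q. q \<notin> C \<Longrightarrow> h q = 0"
    and smooth: "smooth_on (\<phi> ` W) (h \<circ> inv_into U \<phi>)"
  shows "smooth_fun A h"
  unfolding smooth_fun_def
proof (clarify)
  fix V \<psi> assume VA: "(V, \<psi>) \<in> A"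
  let ?\<psi>i = "inv_into V \<psi>"
  show "smooth_on (\<psi> ` V) (h \<circ> ?\<psi>i)"
  proof (rule smooth_on_local)
    fix y assume "y \<in> \<psi> ` V"
    then obtain q where q: "q \<in> V" "y = \<psi> q" by auto
    show "\<exists>T. open T \<and> y \<in> T \<and> smooth_on T (h \<circ> ?\<psi>i)"
    proof (cases "q \<in> W")
      case True
      let ?T = "\<psi> ` (V \<inter> W)"
      have T: "open ?T"
        using chart_open_image[OF VA, of "V \<inter> W"] chart_open(1)[OF VA] \<open>open W\<close> by auto
      have "smooth_on ?T (\<lambda>y. (h \<circ> inv_into U \<phi>) ((\<phi> \<circ> ?\<psi>i) y))"
      proof (rule smooth_on_compose[OF T smooth])
        show "smooth_on ?T (\<phi> \<circ> ?\<psi>i)"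
          using chart_transition[OF VA UA] \<open>W \<subseteq> U\<close> by (rule_tac smooth_on_subset) auto
        show "(\<phi> \<circ> ?\<psi>i) ` ?T \<subseteq> \<phi> ` W" using chart_inv[OF VA] by auto
      qed
      then have "smooth_on ?T (h \<circ> ?\<psi>i)"
        by (rule smooth_on_cong[OF T, rotated])
          (use chart_inv[OF VA] chart_inv[OF UA] \<open>W \<subseteq> U\<close> in \<open>auto simp: subset_eq\<close>)
      then show ?thesis using T q True by blast
    next
      case False
      let ?T = "\<psi> ` (V - C)"
      have T: "open ?T"
        using chart_open_image[OF VA, of "V - C"] chart_open(1)[OF VA] \<open>closed C\<close> by auto
      have "smooth_on ?T (h \<circ> ?\<psi>i)"
        by (rule smooth_on_cong[OF T _ smooth_on_const[where c = 0]])
          (use chart_inv[OF VA] zero in auto)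
      moreover have "y \<in> ?T" using q False \<open>C \<subseteq> W\<close> by auto
      ultimately show ?thesis using T by blast
    qed
  qed
qed

lemma tangent_spaceI:
  assumes "\<And>f. \<not> smooth_fun A f \<Longrightarrow> v f = 0"
    "\<And>f h a b. smooth_fun A f \<Longrightarrow> smooth_fun A h \<Longrightarrow> v (\<lambda>q. a * f q + b * h q) = a * v f + b * v h"
    "\<And>f h. smooth_fun A f \<Longrightarrow> smooth_fun A h \<Longrightarrow> v (\<lambda>q. f q * h q) = v f * h p + f p * v h"
  shows "v \<in> tangent_space A p"
  using assms by (simp add: tangent_space_def)

text \<open>
  The fields \<open>E x\<close> are the coordinate fields, the functions \<open>\<xi> b\<close> the coordinates centred at \<open>p\<close>, both cut
  off by a bump \<open>\<theta>\<close> supported in the chart. The last property expresses a derivation \<open>v\<close> at any point \<open>q\<close>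
  by its values on the globally defined \<open>\<xi> b\<close> and \<open>\<theta>\<close>. Informally, the coordinate \<open>x\<^sub>b\<close> is \<open>\<xi> b / \<theta>\<close>, so
  that \<open>\<theta>\<^sup>2 v x\<^sub>b = \<theta> v (\<xi> b) - \<xi> b v \<theta>\<close>, and the third factor \<open>\<theta>\<close> is the one contained in \<open>E b\<close>. For a vector field
  in place of \<open>v\<close> the coefficients are global smooth functions.
\<close>

lemma local_frame:
  obtains E :: "'e \<Rightarrow> 'a vfield" and \<theta> :: "'a \<Rightarrow> real" and \<xi> :: "'e \<Rightarrow> 'a \<Rightarrow> real"
  where "\<And>x. E x \<in> vector_fields A"
    and "\<And>x y a b q. E (a *\<^sub>R x + b *\<^sub>R y) q = (\<lambda>f. a * E x q f + b * E y q f)"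
    and "smooth_fun A \<theta>" "\<theta> p = 1" "\<And>b. smooth_fun A (\<xi> b)" "\<And>b. \<xi> b p = 0"
    and "\<And>x b. E x p (\<xi> b) = x \<bullet> b"
    and "\<And>x h. smooth_fun A h \<Longrightarrow> E x p (\<lambda>q. exp (h q)) = exp (h p) * E x p h"
    and "\<And>q v h. v \<in> tangent_space A q \<Longrightarrow> smooth_fun A h \<Longrightarrow>
      \<theta> q ^ 3 * v h = (\<Sum>b\<in>Basis. (\<theta> q * v (\<xi> b) - \<xi> b q * v \<theta>) * E b q h)"
proof -
  obtain U \<phi> where UA: "(U, \<phi>) \<in> A" and pU: "p \<in> U" using chart_cover by blast
  define \<phi>i where "\<phi>i = inv_into U \<phi>"
  define x0 where "x0 = \<phi> p"
  note inv = chart_inv[OF UA, folded \<phi>i_def]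
  have "x0 \<in> \<phi> ` U" using pU by (simp add: x0_def)
  then obtain r where r: "r > 0" "cball x0 r \<subseteq> \<phi> ` U"
    using chart_open(2)[OF UA] open_contains_cball by blast
  define B where "B = ball x0 r"
  have B: "open B" "convex B" "x0 \<in> B" "B \<subseteq> \<phi> ` U" using r by (auto simp: B_def)
  define W where "W = {q \<in> U. \<phi> q \<in> B}"
  have contphi: "continuous_on U \<phi>" using chart_homeo[OF UA] by (auto simp: homeomorphism_def)
  have W: "open W" "W \<subseteq> U"
    using continuous_open_preimage[OF contphi chart_open(1)[OF UA] B(1)]
    by (auto simp: W_def vimage_def Int_def)
  have \<phi>W: "\<phi> ` W = B" using B(4) by (auto simp: W_def)
  define C where "C = \<phi>i ` cball x0 (r / 2)"
  have CW: "C \<subseteq> W"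
  proof
    fix q assume "q \<in> C"
    then obtain y where y: "y \<in> cball x0 (r / 2)" "q = \<phi>i y" by (auto simp: C_def)
    then have "y \<in> B" using r by (auto simp: B_def)
    then obtain s where "s \<in> U" "y = \<phi> s" using B(4) by auto
    then show "q \<in> W" using y \<open>y \<in> B\<close> inv by (auto simp: W_def)
  qed
  have "continuous_on (cball x0 (r / 2)) \<phi>i"
  proof (rule continuous_on_subset)
    show "continuous_on (\<phi> ` U) \<phi>i"
      using chart_homeo[OF UA] by (auto simp: homeomorphism_def \<phi>i_def)
    show "cball x0 (r / 2) \<subseteq> \<phi> ` U" using r by (auto simp: subset_eq)
  qed
  then have "closed C" unfolding C_def by (intro compact_imp_closed compact_continuous_image) auto
  obtain \<beta> :: "'e \<Rightarrow> real" where \<beta>: "smooth_on UNIV \<beta>" "\<beta> x0 = 1"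
    "\<And>x. x \<notin> ball x0 (r / 2) \<Longrightarrow> \<beta> x = 0"
    using bump_function[of "r / 2" x0] r by auto
  define lift where "lift = (\<lambda>K q. if q \<in> U then \<beta> (\<phi> q) * K (\<phi> q) else 0)"
  have lift_smooth: "smooth_fun A (lift K)" if K: "smooth_on B K" for K
  proof (rule smooth_fun_extend_by_zero[OF UA \<open>closed C\<close> W(1) CW W(2)])
    show "lift K q = 0" if "q \<notin> C" for q
    proof (cases "q \<in> U")
      case True
      then have "\<phi> q \<notin> ball x0 (r / 2)" using that inv[OF True]
        by (auto simp: C_def image_iff dest!: bspec[of _ _ "\<phi> q"])
      then show ?thesis using \<beta>(3) by (simp add: lift_def)
    qed (simp add: lift_def)
    have "smooth_on B (\<lambda>y. \<beta> y * K y)"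
      using smooth_on_mult[OF B(1) smooth_on_subset[OF \<beta>(1)] K] by simp
    then show "smooth_on (\<phi> ` W) (lift K \<circ> inv_into U \<phi>)"
      unfolding \<phi>W
      by (rule smooth_on_cong[OF B(1), rotated])
        (use inv B(4) in \<open>auto simp: lift_def \<phi>i_def[symmetric]\<close>)
  qed
  define cd where "cd = (\<lambda>x (h :: 'a \<Rightarrow> real) y. frechet_derivative (h \<circ> \<phi>i) (at y) x)"
  have coord_smooth: "smooth_on (\<phi> ` U) (h \<circ> \<phi>i)" if "smooth_fun A h" for h
    using that UA by (auto simp: smooth_fun_def \<phi>i_def)
  have deriv: "((h \<circ> \<phi>i) has_derivative (\<lambda>x. cd x h y)) (at y)"
    if "smooth_fun A h" "y \<in> \<phi> ` U" for h y
    unfolding cd_def using smooth_on_has_derivative[OF coord_smooth[OF that(1)] that(2)] by simp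
  have deriv_eq: "cd x h y = L x"
    if "((h \<circ> \<phi>i) has_derivative L) (at y)" for h x y L
    unfolding cd_def using frechet_derivative_at[OF that] by simp
  define E where "E = (\<lambda>x q h. if smooth_fun A h then lift (cd x h) q else 0)"
  define \<theta> where "\<theta> = lift (\<lambda>y. 1)"
  define \<xi> where "\<xi> = (\<lambda>b. lift (\<lambda>y. (y - x0) \<bullet> b))"
  have E_tangent: "E x q \<in> tangent_space A q" for x q
  proof (cases "q \<in> U")
    case True
    show ?thesis
    proof (rule tangent_spaceI)
      fix f h assume fh: "smooth_fun A f" "smooth_fun A h"
      note d = deriv[OF fh(1) imageI[OF True]] deriv[OF fh(2) imageI[OF True]]
      have "cd x (\<lambda>q. f q * h q) (\<phi> q) = cd x f (\<phi> q) * h q + f q * cd x h (\<phi> q)"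
        using deriv_eq[of "\<lambda>q. f q * h q"] has_derivative_mult[OF d] inv[OF True]
        by (simp add: o_def)
      then show "E x q (\<lambda>q. f q * h q) = E x q f * h q + f q * E x q h"
        using True fh by (simp add: E_def lift_def smooth_fun_mult algebra_simps)
      fix a b
      have "cd x (\<lambda>q. a * f q + b * h q) (\<phi> q) = a * cd x f (\<phi> q) + b * cd x h (\<phi> q)"
        using deriv_eq[of "\<lambda>q. a * f q + b * h q"]
          has_derivative_add[OF has_derivative_mult_right[OF d(1), of a] has_derivative_mult_right[OF d(2), of b]]
        by (simp add: o_def)
      then show "E x q (\<lambda>q. a * f q + b * h q) = a * E x q f + b * E x q h"
        using True fh by (simp add: E_def lift_def smooth_fun_scale smooth_fun_add algebra_simps)
    qed (simp add: E_def)
  next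
    case False
    then show ?thesis by (intro tangent_spaceI) (auto simp: E_def lift_def)
  qed
  have smooth_coord_deriv: "smooth_on B (cd x h)" if "smooth_fun A h" for x h
    unfolding cd_def
    using smooth_on_subset[OF smooth_on_derivative[OF coord_smooth[OF that]] B(4)] .
  show thesis
  proof (rule that)
    show "E x \<in> vector_fields A" for x
    proof -
      have "smooth_fun A (\<lambda>q. E x q h)" if h: "smooth_fun A h" for h
      proof -
        have "(\<lambda>q. E x q h) = lift (cd x h)" by (simp add: E_def h)
        then show ?thesis using lift_smooth[OF smooth_coord_deriv[OF h]] by simp
      qed
      then show ?thesis using E_tangent by (simp add: vector_fields_def)
    qed
    show "E (a *\<^sub>R x + b *\<^sub>R y) q = (\<lambda>f. a * E x q f + b * E y q f)" for x y a b q
    proof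
      fix f
      have "cd (a *\<^sub>R x + b *\<^sub>R y) f (\<phi> q) = a * cd x f (\<phi> q) + b * cd y f (\<phi> q)"
        if "smooth_fun A f" "q \<in> U"
        using linear_add[OF has_derivative_linear[OF deriv[OF that(1) imageI[OF that(2)]]]]
          linear_scale[OF has_derivative_linear[OF deriv[OF that(1) imageI[OF that(2)]]]]
        by simp
      then show "E (a *\<^sub>R x + b *\<^sub>R y) q f = a * E x q f + b * E y q f"
        by (simp add: E_def lift_def algebra_simps)
    qed
    show \<theta>: "smooth_fun A \<theta>" unfolding \<theta>_def by (rule lift_smooth[OF smooth_on_const])
    show "\<theta> p = 1" using pU \<beta>(2) by (simp add: \<theta>_def lift_def x0_def)
    show \<xi>: "smooth_fun A (\<xi> b)" for b
    proof -
      have "smooth_on B (\<lambda>y. (y + (- x0)) \<bullet> b)"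
        by (intro smooth_on_bounded_linear[OF B(1) bounded_linear_inner_left] smooth_on_add
            smooth_on_const smooth_on_id B(1))
      then show ?thesis unfolding \<xi>_def by (intro lift_smooth) simp
    qed
    show "\<xi> b p = 0" for b by (simp add: \<xi>_def lift_def x0_def)
    show "E x p (\<xi> b) = x \<bullet> b" for x b
    proof -
      have "((\<lambda>y. \<beta> y * ((y - x0) \<bullet> b)) has_derivative
          (\<lambda>x. \<beta> x0 * (x \<bullet> b) + frechet_derivative \<beta> (at x0) x * ((x0 - x0) \<bullet> b))) (at x0)"
      proof (rule has_derivative_mult)
        show "(\<beta> has_derivative frechet_derivative \<beta> (at x0)) (at x0)"
          using smooth_on_has_derivative[OF \<beta>(1)] by simp
        show "((\<lambda>y. (y - x0) \<bullet> b) has_derivative (\<lambda>x. x \<bullet> b)) (at x0)"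
          by (auto intro!: derivative_eq_intros)
      qed
      then have d: "((\<lambda>y. \<beta> y * ((y - x0) \<bullet> b)) has_derivative (\<lambda>x. x \<bullet> b)) (at x0)"
        using \<beta>(2) by simp
      have "((\<xi> b \<circ> \<phi>i) has_derivative (\<lambda>x. x \<bullet> b)) (at x0)"
      proof (rule has_derivative_transform_within_open[OF d chart_open(2)[OF UA] \<open>x0 \<in> \<phi> ` U\<close>])
        fix y assume "y \<in> \<phi> ` U"
        then obtain s where "s \<in> U" "y = \<phi> s" by blast
        then show "\<beta> y * ((y - x0) \<bullet> b) = (\<xi> b \<circ> \<phi>i) y" using inv[of s] by (simp add: \<xi>_def lift_def)
      qed
      from deriv_eq[OF this] show ?thesis
        using \<beta>(2) pU \<xi> by (simp add: E_def lift_def x0_def)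
    qed
    show "E x p (\<lambda>q. exp (h q)) = exp (h p) * E x p h" if "smooth_fun A h" for x h
    proof -
      note d = deriv[OF that \<open>x0 \<in> \<phi> ` U\<close>]
      have "((\<lambda>y. exp ((h \<circ> \<phi>i) y)) has_derivative (\<lambda>x. exp ((h \<circ> \<phi>i) x0) * cd x h x0)) (at x0)"
        using has_derivative_exp[OF d] by (simp add: mult.commute)
      then have "cd x (\<lambda>q. exp (h q)) x0 = exp (h p) * cd x h x0"
        using deriv_eq[of "\<lambda>q. exp (h q)"] inv[OF pU] by (simp add: o_def x0_def)
      then show ?thesis
        using that pU by (simp add: E_def lift_def smooth_fun_exp x0_def)
    qed
    fix q v h assume v: "v \<in> tangent_space A q" and h: "smooth_fun A h"
    show "\<theta> q ^ 3 * v h = (\<Sum>b\<in>Basis. (\<theta> q * v (\<xi> b) - \<xi> b q * v \<theta>) * E b q h)"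
    proof (cases "\<theta> q = 0")
      case True
      then have "\<xi> b q = 0" for b by (auto simp: \<theta>_def \<xi>_def lift_def)
      then show ?thesis using True by simp
    next
      case False
      then have qU: "q \<in> U" and "\<phi> q \<in> ball x0 (r / 2)" using \<beta>(3)
        by (auto simp: \<theta>_def lift_def split: if_splits)
      then have qB: "\<phi> q \<in> B" using r by (auto simp: B_def)
      obtain G where G: "\<And>b. smooth_on B (G b)" "\<And>b. G b (\<phi> q) = cd b h (\<phi> q)"
        "\<And>y. y \<in> B \<Longrightarrow> (h \<circ> \<phi>i) y - (h \<circ> \<phi>i) (\<phi> q) = (\<Sum>b\<in>Basis. ((y - \<phi> q) \<bullet> b) * G b y)"
        using hadamard[OF B(1,2) qB smooth_on_subset[OF coord_smooth[OF h] B(4)]]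
        unfolding cd_def by metis
      (* The function xi b - c b * theta is the coordinate centred at q, cut off by theta. *)
      define c where "c = (\<lambda>b. (\<phi> q - x0) \<bullet> b)"
      have \<xi>q: "\<xi> b q = c b * \<theta> q" for b by (simp add: \<xi>_def \<theta>_def lift_def c_def)
      (* Hadamard's lemma at q, multiplied by theta twice so that all factors are global functions. *)
      have "\<theta> s * (\<theta> s * (h s - h q)) = (\<Sum>b\<in>Basis. (\<xi> b s - c b * \<theta> s) * lift (G b) s)" for s
      proof (cases "\<theta> s = 0")
        case True
        then have "\<xi> b s = 0" for b by (auto simp: \<theta>_def \<xi>_def lift_def)
        then show ?thesis using True by simp
      next
        case False
        then have sU: "s \<in> U" and "\<phi> s \<in> ball x0 (r / 2)" using \<beta>(3)
          by (auto simp: \<theta>_def lift_def split: if_splits)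
        then have sB: "\<phi> s \<in> B" using r by (auto simp: B_def)
        show ?thesis
          using G(3)[OF sB] sU inv[OF sU] inv[OF qU]
          by (simp add: \<xi>_def \<theta>_def lift_def c_def sum_distrib_left inner_diff_left algebra_simps)
      qed
      then have eq: "(\<lambda>s. \<theta> s * (\<theta> s * (h s - h q)))
          = (\<lambda>s. \<Sum>b\<in>Basis. (\<xi> b s - c b * \<theta> s) * lift (G b) s)" by (rule ext)
      have "v (\<lambda>s. \<theta> s * (\<theta> s * (h s - h q))) = \<theta> q * (\<theta> q * v h)"
        using \<theta> h by (simp add: tangent_space_mult[OF v] tangent_space_diff[OF v]
            tangent_space_const[OF v] smooth_fun_mult smooth_fun_diff smooth_fun_const)
      moreover have "v (\<lambda>s. \<Sum>b\<in>Basis. (\<xi> b s - c b * \<theta> s) * lift (G b) s)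
          = (\<Sum>b\<in>Basis. (v (\<xi> b) - c b * v \<theta>) * lift (G b) q)"
        using \<theta> \<xi> lift_smooth[OF G(1)]
        by (subst tangent_space_sum[OF v]) (simp_all add: tangent_space_mult[OF v] tangent_space_diff[OF v]
            tangent_space_scale[OF v] smooth_fun_mult smooth_fun_diff smooth_fun_scale \<xi>q)
      moreover have "lift (G b) q = E b q h" for b using h G(2) by (simp add: E_def lift_def)
      ultimately have "\<theta> q * (\<theta> q * v h) = (\<Sum>b\<in>Basis. (v (\<xi> b) - c b * v \<theta>) * E b q h)"
        using eq by simp
      then have "\<theta> q * (\<theta> q * (\<theta> q * v h)) = (\<Sum>b\<in>Basis. \<theta> q * ((v (\<xi> b) - c b * v \<theta>) * E b q h))"
        by (simp add: sum_distrib_left)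
      then show ?thesis by (simp add: \<xi>q power3_eq_cube algebra_simps)
    qed
  qed
qed

end

section \<open>Tensoriality\<close>

definition vadd :: "'a vfield \<Rightarrow> 'a vfield \<Rightarrow> 'a vfield" where
  "vadd X Y = (\<lambda>p f. X p f + Y p f)"

definition vscale :: "('a \<Rightarrow> real) \<Rightarrow> 'a vfield \<Rightarrow> 'a vfield" where
  "vscale h X = (\<lambda>p f. h p * X p f)"

lemma vadd_apply [simp]: "vadd X Y p f = X p f + Y p f" by (simp add: vadd_def)
lemma vscale_apply [simp]: "vscale h X p f = h p * X p f" by (simp add: vscale_def)

text \<open>
  Tangent spaces are sets of functions and not types, so linearity is relative to them.
\<close>

definition tlinear :: "('a, 'e::euclidean_space) atlas \<Rightarrow> 'a \<Rightarrow> ('a tvec \<Rightarrow> real) \<Rightarrow> bool" where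
  "tlinear A p L \<longleftrightarrow> (\<forall>u\<in>tangent_space A p. \<forall>v\<in>tangent_space A p. \<forall>a b.
     L (\<lambda>f. a * u f + b * v f) = a * L u + b * L v)"

lemma tlinearD:
  "tlinear A p L \<Longrightarrow> u \<in> tangent_space A p \<Longrightarrow> v \<in> tangent_space A p \<Longrightarrow>
    L (\<lambda>f. a * u f + b * v f) = a * L u + b * L v"
  by (simp add: tlinear_def)

lemma tangent_space_comb:
  assumes "u \<in> tangent_space A p" "v \<in> tangent_space A p"
  shows "(\<lambda>f. a * u f + b * v f) \<in> tangent_space A p"
  using assms by (simp add: tangent_space_def algebra_simps)

lemma tangent_space_smult: "u \<in> tangent_space A p \<Longrightarrow> (\<lambda>f. a * u f) \<in> tangent_space A p"
  using tangent_space_comb[of u A p u a 0] by simp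

lemma tangent_space_uminus: "u \<in> tangent_space A p \<Longrightarrow> (\<lambda>f. - u f) \<in> tangent_space A p"
  using tangent_space_smult[of u A p "-1"] by simp

lemma tangent_space_zero: "(\<lambda>f. 0) \<in> tangent_space A p"
  by (simp add: tangent_space_def)

lemma tangent_space_sum_mem:
  assumes "\<And>i. i \<in> I \<Longrightarrow> u i \<in> tangent_space A p"
  shows "(\<lambda>f. \<Sum>i\<in>I. c i * u i f) \<in> tangent_space A p"
  using assms
proof (induction I rule: infinite_finite_induct)
  case (insert i I)
  then show ?case using tangent_space_comb[of "u i" A p "\<lambda>f. \<Sum>i\<in>I. c i * u i f" "c i" 1] by simp
qed (auto simp: tangent_space_zero)

lemma tlinear_zero: "tlinear A p L \<Longrightarrow> L (\<lambda>f. 0) = 0"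
  using tlinearD[of A p L "\<lambda>f. 0" "\<lambda>f. 0" 0 0] by (simp add: tangent_space_zero)

lemma tlinear_scale: "tlinear A p L \<Longrightarrow> u \<in> tangent_space A p \<Longrightarrow> L (\<lambda>f. a * u f) = a * L u"
  using tlinearD[of A p L u "\<lambda>f. 0" a 0] by (simp add: tangent_space_zero)

lemma tlinear_sum:
  assumes L: "tlinear A p L" and "\<And>i. i \<in> I \<Longrightarrow> u i \<in> tangent_space A p"
  shows "L (\<lambda>f. \<Sum>i\<in>I. c i * u i f) = (\<Sum>i\<in>I. c i * L (u i))"
  using assms(2)
proof (induction I rule: infinite_finite_induct)
  case (insert i I)
  then show ?case
    using tlinearD[OF L, of "u i" "\<lambda>f. \<Sum>i\<in>I. c i * u i f" "c i" 1] tangent_space_sum_mem[of I u A p c]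
    by simp
qed (auto simp: tlinear_zero[OF L])

context manifold begin

lemma vadd_mem [simp]:
  assumes "X \<in> vector_fields A" "Y \<in> vector_fields A"
  shows "vadd X Y \<in> vector_fields A"
  using tangent_space_comb[of "X p" A p "Y p" 1 1 for p] assms
  by (simp add: vector_fields_def vadd_def smooth_fun_add)

lemma vscale_mem [simp]:
  assumes "X \<in> vector_fields A" "smooth_fun A h"
  shows "vscale h X \<in> vector_fields A"
  using tangent_space_comb[of "X p" A p "X p" "h p" 0 for p] assms
  by (simp add: vector_fields_def vscale_def smooth_fun_mult)

lemma bracket_mem [simp]:
  assumes X: "X \<in> vector_fields A" and Y: "Y \<in> vector_fields A"
  shows "bracket X Y \<in> vector_fields A"
proof -
  have "bracket X Y p \<in> tangent_space A p" for p
  proof (rule tangent_spaceI)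
    fix f assume "\<not> smooth_fun A f"
    then show "bracket X Y p f = 0"
      using tangent_space_nonsmooth[OF vector_fields_at[OF X]]
        tangent_space_nonsmooth[OF vector_fields_at[OF Y]]
        tangent_space_const[OF vector_fields_at[OF X], where c = 0] tangent_space_const[OF vector_fields_at[OF Y], where c = 0]
      by (simp add: bracket_def)
  next
    fix f h assume fh: "smooth_fun A f" "smooth_fun A h"
    note sm = vector_fields_smooth[OF X fh(1)] vector_fields_smooth[OF X fh(2)]
      vector_fields_smooth[OF Y fh(1)] vector_fields_smooth[OF Y fh(2)]
    show "bracket X Y p (\<lambda>q. a * f q + b * h q) = a * bracket X Y p f + b * bracket X Y p h" for a b
      using fh sm
      by (simp add: bracket_def tangent_space_lin[OF vector_fields_at[OF X]]
          tangent_space_lin[OF vector_fields_at[OF Y]] algebra_simps)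
    show "bracket X Y p (\<lambda>q. f q * h q) = bracket X Y p f * h p + f p * bracket X Y p h"
      using fh sm
      by (simp add: bracket_def tangent_space_mult[OF vector_fields_at[OF X]] smooth_fun_mult
          tangent_space_mult[OF vector_fields_at[OF Y]] tangent_space_add[OF vector_fields_at[OF X]]
          tangent_space_add[OF vector_fields_at[OF Y]] algebra_simps)
  qed
  then show ?thesis using X Y
    by (simp add: vector_fields_def bracket_def smooth_fun_diff)
qed

lemma vector_fields_eqI:
  assumes "X \<in> vector_fields A" "Y \<in> vector_fields A"
    "\<And>p f. smooth_fun A f \<Longrightarrow> X p f = Y p f"
  shows "X = Y"
proof (intro ext)
  fix p f
  show "X p f = Y p f"
    using assms(3) tangent_space_nonsmooth[OF vector_fields_at[OF assms(1)]]
      tangent_space_nonsmooth[OF vector_fields_at[OF assms(2)]] by (cases "smooth_fun A f") auto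
qed

lemma bracket_apply: "bracket X Y p f = X p (\<lambda>q. Y q f) - Y p (\<lambda>q. X q f)"
  by (simp add: bracket_def)

lemma bracket_swap: "bracket Y X = vscale (\<lambda>p. -1) (bracket X Y)"
  by (auto simp: bracket_def fun_eq_iff)

lemma bracket_vadd:
  assumes "X \<in> vector_fields A" "X' \<in> vector_fields A" "Y \<in> vector_fields A"
  shows "bracket (vadd X X') Y = vadd (bracket X Y) (bracket X' Y)"
proof (rule vector_fields_eqI)
  fix p f assume "smooth_fun A f"
  then show "bracket (vadd X X') Y p f = vadd (bracket X Y) (bracket X' Y) p f"
    using assms by (simp add: bracket_apply tangent_space_add[OF vector_fields_at[OF assms(3)]]
        vector_fields_smooth)
qed (use assms in simp_all)

lemma bracket_vscale:
  assumes "X \<in> vector_fields A" "Y \<in> vector_fields A" "smooth_fun A h"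
  shows "bracket (vscale h X) Y = vadd (vscale h (bracket X Y)) (vscale (\<lambda>p. - Y p h) X)"
proof (rule vector_fields_eqI)
  fix p f assume "smooth_fun A f"
  then show "bracket (vscale h X) Y p f = vadd (vscale h (bracket X Y)) (vscale (\<lambda>p. - Y p h) X) p f"
    using assms by (simp add: bracket_apply tangent_space_mult[OF vector_fields_at[OF assms(2)]]
        vector_fields_smooth algebra_simps)
qed (use assms in \<open>simp_all add: vector_fields_smooth smooth_fun_minus\<close>)

text \<open>
  The map \<open>x \<mapsto> E x p\<close> for a local frame: a linear isomorphism from the model space to the tangent space,
  through which the linear algebra of Euclidean spaces becomes available. Every tangent vector is a
  value of some \<open>E x\<close> and hence extends to a vector field.
\<close>

lemma tangent_space_param:
  obtains \<Phi> :: "'e \<Rightarrow> 'a tvec"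
  where "\<And>x. \<Phi> x \<in> tangent_space A p"
    and "\<And>a b x y. \<Phi> (a *\<^sub>R x + b *\<^sub>R y) = (\<lambda>f. a * \<Phi> x f + b * \<Phi> y f)"
    and "\<And>x. \<Phi> x = (\<lambda>f. 0) \<Longrightarrow> x = 0"
    and "\<And>v. v \<in> tangent_space A p \<Longrightarrow> \<exists>x. v = \<Phi> x"
    and "\<And>x. \<exists>X\<in>vector_fields A. X p = \<Phi> x"
    and "\<And>x h. smooth_fun A h \<Longrightarrow> \<Phi> x (\<lambda>q. exp (h q)) = exp (h p) * \<Phi> x h"
proof -
  obtain E :: "'e \<Rightarrow> 'a vfield" and \<theta> \<xi> where E: "\<And>x. E x \<in> vector_fields A"
    "\<And>x y a b q. E (a *\<^sub>R x + b *\<^sub>R y) q = (\<lambda>f. a * E x q f + b * E y q f)"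
    "smooth_fun A \<theta>" "\<theta> p = 1" "\<And>b. smooth_fun A (\<xi> b)" "\<And>b. \<xi> b p = 0"
    "\<And>x b. E x p (\<xi> b) = x \<bullet> b"
    "\<And>x h. smooth_fun A h \<Longrightarrow> E x p (\<lambda>q. exp (h q)) = exp (h p) * E x p h"
    "\<And>q v h. v \<in> tangent_space A q \<Longrightarrow> smooth_fun A h \<Longrightarrow>
      \<theta> q ^ 3 * v h = (\<Sum>b\<in>Basis. (\<theta> q * v (\<xi> b) - \<xi> b q * v \<theta>) * E b q h)"
    by (rule local_frame[of p]) blast
  let ?\<Phi> = "\<lambda>x. E x p"
  show thesis
  proof (rule that[of ?\<Phi>])
    show "x = 0" if "?\<Phi> x = (\<lambda>f. 0)" for x
      using that E(7)[of x x] by simp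
    show "\<exists>x. v = ?\<Phi> x" if v: "v \<in> tangent_space A p" for v
    proof
      let ?x = "\<Sum>b\<in>Basis. v (\<xi> b) *\<^sub>R b"
      have sum: "E (\<Sum>b\<in>I. c b *\<^sub>R b) p = (\<lambda>f. \<Sum>b\<in>I. c b * E b p f)" if "finite I" for I :: "'e set" and c
        using that
      proof (induction I)
        case empty
        show ?case using E(2)[of 0 0 0 0 p] by simp
      next
        case (insert b I)
        then show ?case using E(2)[of "c b" b 1 "\<Sum>b\<in>I. c b *\<^sub>R b" p] by simp
      qed
      show "v = ?\<Phi> ?x"
      proof
        fix h
        show "v h = ?\<Phi> ?x h"
        proof (cases "smooth_fun A h")
          case True
          then show ?thesis using E(9)[OF v True] E(4,6) by (simp add: sum)
        next
          case False
          then show ?thesis using tangent_space_nonsmooth[OF v]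
              tangent_space_nonsmooth[OF vector_fields_at[OF E(1)]] by simp
        qed
      qed
    qed
  qed (use E(1,2,8) vector_fields_at[OF E(1)] in auto)
qed

lemma tangent_space_exp:
  "v \<in> tangent_space A p \<Longrightarrow> smooth_fun A h \<Longrightarrow> v (\<lambda>q. exp (h q)) = exp (h p) * v h"
  by (rule tangent_space_param[of p]) metis

lemma extend_exists: "u \<in> tangent_space A p \<Longrightarrow> \<exists>X\<in>vector_fields A. X p = u"
  by (rule tangent_space_param[of p]) metis

lemma extend_mem [simp]: "u \<in> tangent_space A p \<Longrightarrow> extend A p u \<in> vector_fields A"
  and extend_at [simp]: "u \<in> tangent_space A p \<Longrightarrow> extend A p u p = u"
  using someI_ex[of "\<lambda>X. X \<in> vector_fields A \<and> X p = u"] extend_exists[of u p]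
  unfolding extend_def by auto

text \<open>
  If \<open>Z\<close> vanishes at \<open>p\<close>, a local frame gives \<open>Z = \<Sum> k\<^sub>b E\<^sub>b + (1 - \<theta>\<^sup>3) Z\<close> on the whole manifold with all
  coefficients vanishing at \<open>p\<close>, so a functional that is linear over functions vanishes on \<open>Z\<close>.
\<close>

lemma tensorial_cong:
  fixes P :: "'a vfield \<Rightarrow> real"
  assumes add: "\<And>X Y. X \<in> vector_fields A \<Longrightarrow> Y \<in> vector_fields A \<Longrightarrow> P (vadd X Y) = P X + P Y"
    and scale: "\<And>X h. X \<in> vector_fields A \<Longrightarrow> smooth_fun A h \<Longrightarrow> P (vscale h X) = h p * P X"
    and XY: "X \<in> vector_fields A" "Y \<in> vector_fields A" "X p = Y p"
  shows "P X = P Y"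
proof -
  obtain E :: "'e \<Rightarrow> 'a vfield" and \<theta> \<xi> where E: "\<And>x. E x \<in> vector_fields A"
    "smooth_fun A \<theta>" "\<theta> p = 1" "\<And>b. smooth_fun A (\<xi> b)"
    "\<And>q v h. v \<in> tangent_space A q \<Longrightarrow> smooth_fun A h \<Longrightarrow>
      \<theta> q ^ 3 * v h = (\<Sum>b\<in>Basis. (\<theta> q * v (\<xi> b) - \<xi> b q * v \<theta>) * E b q h)"
    by (rule local_frame[of p]) blast
  define Z where "Z = vadd X (vscale (\<lambda>q. -1) Y)"
  have Z: "Z \<in> vector_fields A" using XY by (simp add: Z_def smooth_fun_const)
  have Zp: "Z p h = 0" for h using XY(3) by (simp add: Z_def)
  define k where "k = (\<lambda>b q. \<theta> q * Z q (\<xi> b) - \<xi> b q * Z q \<theta>)"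
  have k: "smooth_fun A (k b)" "k b p = 0" for b
    using E(2,4) Z Zp by (simp_all add: k_def smooth_fun_mult smooth_fun_diff vector_fields_smooth)
  define S where "S = (\<lambda>I q h. \<Sum>b\<in>I. k b q * E b q h)"
  have S: "S I \<in> vector_fields A \<and> P (S I) = 0" if "finite I" for I
    using that
  proof (induction I)
    case empty
    have "S {} = vscale (\<lambda>q. 0) X" by (simp add: S_def fun_eq_iff)
    moreover have "P (vscale (\<lambda>q. 0) X) = 0"
      using scale[OF XY(1), of "\<lambda>q. 0"] by (simp add: smooth_fun_const)
    moreover have "vscale (\<lambda>q. 0) X \<in> vector_fields A" using XY(1) by (simp add: smooth_fun_const)
    ultimately show ?case by metis
  next
    case (insert b I)
    have "S (insert b I) = vadd (vscale (k b) (E b)) (S I)"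
      using insert by (simp add: S_def fun_eq_iff)
    moreover have "vadd (vscale (k b) (E b)) (S I) \<in> vector_fields A"
      "P (vadd (vscale (k b) (E b)) (S I)) = 0"
      using insert E(1) k by (simp_all add: add scale)
    ultimately show ?case by metis
  qed
  let ?m = "\<lambda>q. 1 - \<theta> q ^ 3"
  have m: "smooth_fun A ?m"
    using E(2) by (simp add: power3_eq_cube smooth_fun_mult smooth_fun_diff smooth_fun_const)
  have "Z = vadd (S Basis) (vscale ?m Z)"
    using Z m S E(5)[OF vector_fields_at[OF Z]]
    by (intro vector_fields_eqI) (simp_all add: S_def k_def algebra_simps)
  then have "P Z = P (S Basis) + ?m p * P Z"
    using add scale Z m S by (metis finite_Basis vscale_mem)
  then have "P Z = 0" using S E(3) by simp
  then show ?thesis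
    using XY by (simp add: Z_def add scale smooth_fun_const)
qed

text \<open>
  The arbitrary choice made by \<open>extend\<close> does not commute with linear combinations of tangent vectors,
  but the two sides are values of \<open>P\<close> on fields that agree at \<open>p\<close>.
\<close>

lemma tensorial_tlinear:
  fixes P :: "'a vfield \<Rightarrow> real"
  assumes add: "\<And>X Y. X \<in> vector_fields A \<Longrightarrow> Y \<in> vector_fields A \<Longrightarrow> P (vadd X Y) = P X + P Y"
    and scale: "\<And>X h. X \<in> vector_fields A \<Longrightarrow> smooth_fun A h \<Longrightarrow> P (vscale h X) = h p * P X"
  shows "tlinear A p (\<lambda>u. P (extend A p u))"
  unfolding tlinear_def
proof (intro ballI allI)
  fix u v a b assume uv: "u \<in> tangent_space A p" "v \<in> tangent_space A p"
  let ?W = "vadd (vscale (\<lambda>q. a) (extend A p u)) (vscale (\<lambda>q. b) (extend A p v))"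
  have W: "?W \<in> vector_fields A" using uv by (simp add: smooth_fun_const)
  have "?W p = (\<lambda>f. a * u f + b * v f)" using uv by (simp add: fun_eq_iff)
  then have "P (extend A p (\<lambda>f. a * u f + b * v f)) = P ?W"
    using uv W by (intro tensorial_cong[where P = P and p = p] add scale) (auto simp: tangent_space_comb)
  also have "\<dots> = a * P (extend A p u) + b * P (extend A p v)"
    using uv by (simp add: add scale smooth_fun_const)
  finally show "P (extend A p (\<lambda>f. a * u f + b * v f)) = a * P (extend A p u) + b * P (extend A p v)" .
qed

end

section \<open>The curvature of a connection as a tensor\<close>

lemma connection_mem:
  "tangent_connection A D \<Longrightarrow> X \<in> vector_fields A \<Longrightarrow> Y \<in> vector_fields A \<Longrightarrow> D X Y \<in> vector_fields A"
  by (simp add: tangent_connection_def)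

lemma connection_vadd:
  assumes "tangent_connection A D" "X \<in> vector_fields A" "Y \<in> vector_fields A" "Z \<in> vector_fields A"
  shows "D (vadd X Y) Z = vadd (D X Z) (D Y Z)" "D X (vadd Y Z) = vadd (D X Y) (D X Z)"
  using assms by (simp_all add: tangent_connection_def vadd_def)

lemma connection_vscale:
  assumes "tangent_connection A D" "X \<in> vector_fields A" "Y \<in> vector_fields A" "smooth_fun A h"
  shows "D (vscale h X) Y = vscale h (D X Y)"
    "D X (vscale h Y) = vadd (vscale (\<lambda>p. X p h) Y) (vscale h (D X Y))"
  using assms by (simp_all add: tangent_connection_def vadd_def vscale_def)

context manifold begin

context
  fixes D :: "'a connection"
  assumes D: "tangent_connection A D"
begin

lemmas connection_rules = connection_mem[OF D] connection_vadd[OF D] connection_vscale[OF D]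

lemma curvature_mem:
  assumes "X \<in> vector_fields A" "Y \<in> vector_fields A" "Z \<in> vector_fields A"
  shows "curvature D X Y Z \<in> vector_fields A"
proof -
  have "curvature D X Y Z = vadd (D X (D Y Z)) (vscale (\<lambda>p. -1) (vadd (D Y (D X Z)) (D (bracket X Y) Z)))"
    by (simp add: curvature_def fun_eq_iff)
  then show ?thesis using assms by (simp add: connection_rules smooth_fun_const)
qed

lemma curvature_swap:
  assumes "X \<in> vector_fields A" "Y \<in> vector_fields A" "Z \<in> vector_fields A"
  shows "curvature D Y X Z p f = - curvature D X Y Z p f"
  using assms by (simp add: curvature_def bracket_swap[of Y X] connection_rules smooth_fun_const)

lemma curvature_vadd1:
  assumes "X \<in> vector_fields A" "X' \<in> vector_fields A" "Y \<in> vector_fields A" "Z \<in> vector_fields A"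
  shows "curvature D (vadd X X') Y Z p f = curvature D X Y Z p f + curvature D X' Y Z p f"
  using assms by (simp add: curvature_def bracket_vadd connection_rules)

lemma curvature_vscale1:
  assumes "X \<in> vector_fields A" "Y \<in> vector_fields A" "Z \<in> vector_fields A" "smooth_fun A h"
  shows "curvature D (vscale h X) Y Z p f = h p * curvature D X Y Z p f"
  using assms by (simp add: curvature_def bracket_vscale connection_rules smooth_fun_minus vector_fields_smooth algebra_simps)

lemma curvature_vadd3:
  assumes "X \<in> vector_fields A" "Y \<in> vector_fields A" "Z \<in> vector_fields A" "Z' \<in> vector_fields A"
  shows "curvature D X Y (vadd Z Z') p f = curvature D X Y Z p f + curvature D X Y Z' p f"
  using assms by (simp add: curvature_def connection_rules)

lemma curvature_vscale3:
  assumes "X \<in> vector_fields A" "Y \<in> vector_fields A" "Z \<in> vector_fields A" "smooth_fun A h"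
  shows "curvature D X Y (vscale h Z) p f = h p * curvature D X Y Z p f"
  using assms by (simp add: curvature_def connection_rules vector_fields_smooth bracket_apply[of X Y p h] algebra_simps)

lemma curvature_at_mem:
  "u \<in> tangent_space A p \<Longrightarrow> v \<in> tangent_space A p \<Longrightarrow> w \<in> tangent_space A p \<Longrightarrow>
    curvature_at A D p u v w \<in> tangent_space A p"
  by (simp add: curvature_at_def curvature_mem vector_fields_at)

text \<open>
  Function-linearity of the curvature in the first and third field; the second slot follows from the
  first by antisymmetry.
\<close>

lemma curvature_at_tlinear:
  assumes "u \<in> tangent_space A p" "v \<in> tangent_space A p"
  shows "tlinear A p (\<lambda>w. curvature_at A D p u v w f)"
    "tlinear A p (\<lambda>w. curvature_at A D p u w v f)"
    "tlinear A p (\<lambda>w. curvature_at A D p w u v f)"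
proof -
  show "tlinear A p (\<lambda>w. curvature_at A D p u v w f)"
    unfolding curvature_at_def using assms
    by (intro tensorial_tlinear[where P = "\<lambda>W. curvature D _ _ W p f"]) (simp_all add: curvature_vadd3 curvature_vscale3)
  show "tlinear A p (\<lambda>w. curvature_at A D p w u v f)"
    unfolding curvature_at_def using assms
    by (intro tensorial_tlinear[where P = "\<lambda>W. curvature D W _ _ p f"]) (simp_all add: curvature_vadd1 curvature_vscale1)
  have "tlinear A p (\<lambda>w. - curvature D (extend A p w) (extend A p u) (extend A p v) p f)"
    using assms
    by (intro tensorial_tlinear[where P = "\<lambda>W. - curvature D W _ _ p f"]) (simp_all add: curvature_vadd1 curvature_vscale1)
  then show "tlinear A p (\<lambda>w. curvature_at A D p u w v f)"
    using assms by (simp add: tlinear_def curvature_at_def tangent_space_comb curvature_swap[of _ "extend A p u"])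
qed

end
end

section \<open>The Chern connection under a conformal change\<close>

definition vJ :: "'a endo \<Rightarrow> 'a vfield \<Rightarrow> 'a vfield" where
  "vJ J X = (\<lambda>p. J p (X p))"

locale hermitian =
  fixes A :: "('a::{t2_space,second_countable_topology}, 'e::euclidean_space) atlas"
    and J :: "'a endo" and g :: "'a two_tensor"
  assumes almost_hermitian: "almost_hermitian A J g"

sublocale hermitian \<subseteq> manifold A
  using almost_hermitian by unfold_locales (simp add: almost_hermitian_def)

context hermitian begin

lemma J_mem [simp]: "u \<in> tangent_space A p \<Longrightarrow> J p u \<in> tangent_space A p"
  and J_J: "u \<in> tangent_space A p \<Longrightarrow> J p (J p u) = (\<lambda>f. - u f)"
  and J_lin: "u \<in> tangent_space A p \<Longrightarrow> v \<in> tangent_space A p \<Longrightarrow>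
      J p (\<lambda>f. a * u f + b * v f) = (\<lambda>f. a * J p u f + b * J p v f)"
  and vJ_mem [simp]: "X \<in> vector_fields A \<Longrightarrow> vJ J X \<in> vector_fields A"
  and g_sym: "u \<in> tangent_space A p \<Longrightarrow> v \<in> tangent_space A p \<Longrightarrow> g p u v = g p v u"
  and g_pos: "u \<in> tangent_space A p \<Longrightarrow> u \<noteq> (\<lambda>f. 0) \<Longrightarrow> g p u u > 0"
  and g_smooth: "X \<in> vector_fields A \<Longrightarrow> Y \<in> vector_fields A \<Longrightarrow> smooth_fun A (\<lambda>p. g p (X p) (Y p))"
  and g_J_J: "u \<in> tangent_space A p \<Longrightarrow> v \<in> tangent_space A p \<Longrightarrow> g p (J p u) (J p v) = g p u v"
  using almost_hermitian
  by (auto simp: almost_hermitian_def almost_complex_def riemannian_metric_def vJ_def)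

lemma g_tlinear1: "w \<in> tangent_space A p \<Longrightarrow> tlinear A p (\<lambda>u. g p u w)"
  using almost_hermitian
  by (auto simp: almost_hermitian_def riemannian_metric_def tlinear_def)

lemma g_tlinear2: "w \<in> tangent_space A p \<Longrightarrow> tlinear A p (\<lambda>u. g p w u)"
  using g_tlinear1[of w p] by (simp add: tlinear_def g_sym[of w] tangent_space_comb)

lemma J_scale: "u \<in> tangent_space A p \<Longrightarrow> J p (\<lambda>f. a * u f) = (\<lambda>f. a * J p u f)"
  using J_lin[of u p u a 0] by simp

lemma g_scale:
  assumes "u \<in> tangent_space A p" "v \<in> tangent_space A p"
  shows "g p (\<lambda>f. a * u f) v = a * g p u v" "g p u (\<lambda>f. a * v f) = a * g p u v"
  by (rule tlinear_scale[OF g_tlinear1[OF assms(2)] assms(1)], rule tlinear_scale[OF g_tlinear2[OF assms(1)] assms(2)])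

lemma g_uminus:
  assumes "u \<in> tangent_space A p" "v \<in> tangent_space A p"
  shows "g p (\<lambda>f. - u f) v = - g p u v" "g p u (\<lambda>f. - v f) = - g p u v"
  using g_scale[OF assms, of "-1"] by simp_all

lemma J_uminus: "u \<in> tangent_space A p \<Longrightarrow> J p (\<lambda>f. - u f) = (\<lambda>f. - J p u f)"
  using J_scale[of u p "-1"] by simp

lemma J_add: "u \<in> tangent_space A p \<Longrightarrow> v \<in> tangent_space A p \<Longrightarrow>
  J p (\<lambda>f. u f + v f) = (\<lambda>f. J p u f + J p v f)"
  using J_lin[of u p v 1 1] by simp

lemma vJ_vadd: "X \<in> vector_fields A \<Longrightarrow> Y \<in> vector_fields A \<Longrightarrow>
    vJ J (vadd X Y) = vadd (vJ J X) (vJ J Y)"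
  and vJ_vscale: "X \<in> vector_fields A \<Longrightarrow> vJ J (vscale h X) = vscale h (vJ J X)"
  and vJ_vJ: "X \<in> vector_fields A \<Longrightarrow> vJ J (vJ J X) = vscale (\<lambda>p. -1) X"
  by (simp_all add: vJ_def vadd_def vscale_def J_add J_scale J_J vector_fields_at)

lemma g_J_left: "u \<in> tangent_space A p \<Longrightarrow> v \<in> tangent_space A p \<Longrightarrow> g p (J p u) v = - g p u (J p v)"
  using g_J_J[of u p "J p v"] J_J[of v p] tlinear_scale[OF g_tlinear2, of "J p u" p v "-1"] by simp

definition g_field :: "'a vfield \<Rightarrow> 'a vfield \<Rightarrow> 'a \<Rightarrow> real" where
  "g_field X Y = (\<lambda>p. g p (X p) (Y p))"

lemma g_field_vadd:
  "X \<in> vector_fields A \<Longrightarrow> Y \<in> vector_fields A \<Longrightarrow> Z \<in> vector_fields A \<Longrightarrow>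
    g_field (vadd X Y) Z p = g_field X Z p + g_field Y Z p"
  "X \<in> vector_fields A \<Longrightarrow> Y \<in> vector_fields A \<Longrightarrow> Z \<in> vector_fields A \<Longrightarrow>
    g_field Z (vadd X Y) p = g_field Z X p + g_field Z Y p"
  using tlinearD[OF g_tlinear1, of "Z p" p "X p" "Y p" 1 1]
    tlinearD[OF g_tlinear2, of "Z p" p "X p" "Y p" 1 1]
  by (simp_all add: g_field_def vadd_def vector_fields_at)

lemma g_field_vscale:
  "X \<in> vector_fields A \<Longrightarrow> Z \<in> vector_fields A \<Longrightarrow> g_field (vscale h X) Z p = h p * g_field X Z p"
  "X \<in> vector_fields A \<Longrightarrow> Z \<in> vector_fields A \<Longrightarrow> g_field Z (vscale h X) p = h p * g_field Z X p"
  using tlinear_scale[OF g_tlinear1, of "Z p" p "X p" "h p"]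
    tlinear_scale[OF g_tlinear2, of "Z p" p "X p" "h p"]
  by (simp_all add: g_field_def vscale_def vector_fields_at)

lemma g_field_vJ:
  "X \<in> vector_fields A \<Longrightarrow> Y \<in> vector_fields A \<Longrightarrow> g_field (vJ J X) Y p = - g_field X (vJ J Y) p"
  by (simp add: g_field_def vJ_def g_J_left vector_fields_at)

lemma g_field_sym:
  "X \<in> vector_fields A \<Longrightarrow> Y \<in> vector_fields A \<Longrightarrow> g_field X Y p = g_field Y X p"
  by (simp add: g_field_def g_sym vector_fields_at)

end

text \<open>
  Uniqueness of the Chern connection: \<open>\<beta> X Y Z = g (B X Y) Z\<close> for the difference \<open>B\<close> of two connections that
  are Hermitian and whose torsions have no (1,1)-part. The tensor \<open>C X Y = B X Y + B (j X) (j Y)\<close> is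
  symmetric, and it satisfies \<open>C (j X) Y = - j (C X Y)\<close> and \<open>C X (j Y) = j (C X Y)\<close>. Hence \<open>C = 0\<close>, that is,
  \<open>\<beta> (j X) Y Z = \<beta> X (j Y) Z\<close>. As \<open>B\<close> takes values in skew endomorphisms commuting with \<open>j\<close>, moving \<open>j\<close>
  around all slots reverses the sign.
\<close>

lemma chern_difference_zero:
  fixes \<beta> :: "'v \<Rightarrow> 'v \<Rightarrow> 'v \<Rightarrow> real" and j :: "'v \<Rightarrow> 'v"
  assumes j: "\<And>X. X \<in> S \<Longrightarrow> j X \<in> S"
    and jj1: "\<And>X Y Z. X \<in> S \<Longrightarrow> Y \<in> S \<Longrightarrow> Z \<in> S \<Longrightarrow> \<beta> (j (j X)) Y Z = - \<beta> X Y Z"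
    and jj2: "\<And>X Y Z. X \<in> S \<Longrightarrow> Y \<in> S \<Longrightarrow> Z \<in> S \<Longrightarrow> \<beta> X (j (j Y)) Z = - \<beta> X Y Z"
    and j23: "\<And>X Y Z. X \<in> S \<Longrightarrow> Y \<in> S \<Longrightarrow> Z \<in> S \<Longrightarrow> \<beta> X (j Y) Z = - \<beta> X Y (j Z)"
    and skew: "\<And>X Y Z. X \<in> S \<Longrightarrow> Y \<in> S \<Longrightarrow> Z \<in> S \<Longrightarrow> \<beta> X Y Z = - \<beta> X Z Y"
    and tor: "\<And>X Y Z. X \<in> S \<Longrightarrow> Y \<in> S \<Longrightarrow> Z \<in> S \<Longrightarrow>
      \<beta> (j X) (j Y) Z - \<beta> (j Y) (j X) Z = - (\<beta> X Y Z - \<beta> Y X Z)"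
    and S: "X \<in> S" "Y \<in> S" "Z \<in> S"
  shows "\<beta> X Y Z = 0"
proof -
  have 1: "\<beta> (j X) Y Z = \<beta> X (j Y) Z" if s: "X \<in> S" "Y \<in> S" "Z \<in> S" for X Y Z
    using tor[OF s(1) j[OF s(2)] s(3)] tor[OF s(1,2) j[OF s(3)]]
      jj2[OF j[OF s(1)] s(2,3)] jj1[OF s(2) j[OF s(1)] s(3)] jj1[OF s(2,1) s(3)]
      j23[OF s(1,2,3)] j23[OF j[OF s(1)] s(2,3)] j23[OF s(2,1,3)] j23[OF j[OF s(2)] s(1,3)]
      j23[OF j[OF s(1)] j[OF s(2)] s(3)] j23[OF j[OF s(2)] j[OF s(1)] s(3)]
      jj2[OF j[OF s(2)] s(1,3)]
    by linarith
  have 2: "\<beta> (j X) Y Z = 0" if s: "X \<in> S" "Y \<in> S" "Z \<in> S" for X Y Z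
    using 1[OF s] j23[OF s] skew[OF s(1,2) j[OF s(3)]] 1[OF s(1,3,2)] skew[OF j[OF s(1)] s(2,3)]
    by linarith
  show ?thesis using 2[OF j[OF S(1)] S(2,3)] jj1[OF S] by linarith
qed

context hermitian begin

context
  fixes f :: "'a \<Rightarrow> real" and D D' :: "'a connection"
  assumes f: "smooth_fun A f"
    and D: "chern_connection A J g D"
    and D': "chern_connection A J (conformal f g) D'"
begin

lemma conn_D: "tangent_connection A D" and conn_D': "tangent_connection A D'"
  using D D' by (simp_all add: chern_connection_def)

lemma D_vJ: "X \<in> vector_fields A \<Longrightarrow> Y \<in> vector_fields A \<Longrightarrow> D X (vJ J Y) = vJ J (D X Y)"
  and D'_vJ: "X \<in> vector_fields A \<Longrightarrow> Y \<in> vector_fields A \<Longrightarrow> D' X (vJ J Y) = vJ J (D' X Y)"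
  using D D' by (simp_all add: chern_connection_def vJ_def)

lemma D_metric: "X \<in> vector_fields A \<Longrightarrow> Y \<in> vector_fields A \<Longrightarrow> Z \<in> vector_fields A \<Longrightarrow>
    X p (g_field Y Z) = g_field (D X Y) Z p + g_field Y (D X Z) p"
  using D by (simp add: chern_connection_def g_field_def)

text \<open>
  The metric condition for \<open>e\<^sup>2\<^sup>f g\<close> expressed by \<open>g\<close>, after division by the conformal factor.
\<close>

lemma D'_metric:
  assumes X: "X \<in> vector_fields A" and Y: "Y \<in> vector_fields A" and Z: "Z \<in> vector_fields A"
  shows "2 * X p f * g_field Y Z p + X p (g_field Y Z) = g_field (D' X Y) Z p + g_field Y (D' X Z) p"
proof -
  have "X p (\<lambda>q. exp (2 * f q) * g_field Y Z q) = exp (2 * f p) * (g_field (D' X Y) Z p + g_field Y (D' X Z) p)"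
    using D' X Y Z by (simp add: chern_connection_def g_field_def conformal_def algebra_simps)
  moreover have "X p (\<lambda>q. exp (2 * f q) * g_field Y Z q)
      = exp (2 * f p) * (2 * X p f) * g_field Y Z p + exp (2 * f p) * X p (g_field Y Z)"
    using f tangent_space_mult[OF vector_fields_at[OF X], where f = "\<lambda>q. exp (2 * f q)" and h = "g_field Y Z"]
      tangent_space_exp[OF vector_fields_at[OF X], of "\<lambda>q. 2 * f q"]
      tangent_space_scale[OF vector_fields_at[OF X] f, of _ 2] g_smooth[OF Y Z]
    by (simp add: smooth_fun_exp smooth_fun_scale g_field_def)
  ultimately have "exp (2 * f p) * (2 * X p f * g_field Y Z p + X p (g_field Y Z))
      = exp (2 * f p) * (g_field (D' X Y) Z p + g_field Y (D' X Z) p)"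
    by (simp add: algebra_simps)
  then show ?thesis by simp
qed

lemma D_torsion: "X \<in> vector_fields A \<Longrightarrow> Y \<in> vector_fields A \<Longrightarrow>
    torsion D (vJ J X) (vJ J Y) = vscale (\<lambda>p. -1) (torsion D X Y)"
  and D'_torsion: "X \<in> vector_fields A \<Longrightarrow> Y \<in> vector_fields A \<Longrightarrow>
    torsion D' (vJ J X) (vJ J Y) = vscale (\<lambda>p. -1) (torsion D' X Y)"
  using D D' by (simp_all add: chern_connection_def vJ_def vscale_def)

definition dc_field :: "'a vfield \<Rightarrow> 'a \<Rightarrow> real" where
  "dc_field X = (\<lambda>p. - vJ J X p f)"

lemma dc_field_smooth: "X \<in> vector_fields A \<Longrightarrow> smooth_fun A (dc_field X)"
  using f by (simp add: dc_field_def smooth_fun_minus vector_fields_smooth)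

text \<open>
  On a complex manifold this is the term \<open>2 \<partial>f \<otimes> Id\<close> by which the Chern connection of a holomorphic
  bundle changes when its metric is multiplied by \<open>e\<^sup>2\<^sup>f\<close>.
\<close>

definition conformal_shift :: "'a connection" where
  "conformal_shift X Y = vadd (vscale (\<lambda>p. X p f) Y) (vscale (dc_field X) (vJ J Y))"

text \<open>
  Adding \<open>conformal_shift\<close> to \<open>D\<close> gives the three properties that characterise \<open>D'\<close>: the term \<open>df X \<cdot> Y\<close>
  corrects the metric condition, while \<open>d\<^sup>cf X \<cdot> J Y\<close> is skew and makes the change of torsion
  anti-invariant. The difference \<open>B\<close> then vanishes by \<open>chern_difference_zero\<close>.
\<close>

lemma chern_connection_conformal:
  assumes "X \<in> vector_fields A" "Y \<in> vector_fields A"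
  shows "D' X Y = vadd (D X Y) (conformal_shift X Y)"
proof -
  define B where "B = (\<lambda>X Y. vadd (D' X Y) (vscale (\<lambda>p. -1) (vadd (D X Y) (conformal_shift X Y))))"
  let ?S = "vector_fields A"
  note mem = connection_mem[OF conn_D] connection_mem[OF conn_D'] dc_field_smooth smooth_fun_const
    vector_fields_smooth[OF _ f]
  have B_mem: "B X Y \<in> ?S" if "X \<in> ?S" "Y \<in> ?S" for X Y
    using that by (simp add: B_def conformal_shift_def mem)
  have B_vJ: "B X (vJ J Y) = vJ J (B X Y)" if "X \<in> ?S" "Y \<in> ?S" for X Y
    using that by (simp add: B_def conformal_shift_def D_vJ D'_vJ vJ_vadd vJ_vscale mem)
  have B_neg1: "B (vscale (\<lambda>p. -1) X) Y = vscale (\<lambda>p. -1) (B X Y)" if "X \<in> ?S" "Y \<in> ?S" for X Y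
    using that by (simp add: B_def conformal_shift_def connection_vscale[OF conn_D] connection_vscale[OF conn_D']
        mem fun_eq_iff dc_field_def vJ_vscale)
  have B_neg2: "B X (vscale (\<lambda>p. -1) Y) = vscale (\<lambda>p. -1) (B X Y)" if "X \<in> ?S" "Y \<in> ?S" for X Y
    using that by (simp add: B_def conformal_shift_def connection_vscale[OF conn_D] connection_vscale[OF conn_D']
        mem fun_eq_iff vJ_vscale tangent_space_const[OF vector_fields_at])
  have B_skew: "g_field (B X Y) Z p = - g_field Y (B X Z) p" if "X \<in> ?S" "Y \<in> ?S" "Z \<in> ?S" for X Y Z p
    (* The J-terms cancel because J is skew, and the df-terms are those of D'_metric. *)
    using that D_metric[OF that, of p] D'_metric[OF that, of p]
    by (simp add: B_def conformal_shift_def mem g_field_vadd g_field_vscale g_field_vJ algebra_simps)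
  have B_tor: "B (vJ J X) (vJ J Y) p h - B (vJ J Y) (vJ J X) p h = - (B X Y p h - B Y X p h)"
    if "X \<in> ?S" "Y \<in> ?S" for X Y p h
    using fun_cong[OF fun_cong[OF D_torsion[OF that]], of p h]
      fun_cong[OF fun_cong[OF D'_torsion[OF that]], of p h] that
    by (simp add: torsion_def B_def conformal_shift_def vJ_vJ dc_field_def algebra_simps)
  have zero: "g_field (B X Y) Z p = 0" if "X \<in> ?S" "Y \<in> ?S" "Z \<in> ?S" for X Y Z p
  proof (rule chern_difference_zero[where j = "vJ J" and S = ?S
        and \<beta> = "\<lambda>X Y Z. g_field (B X Y) Z p"])
    fix X Y Z assume s: "X \<in> ?S" "Y \<in> ?S" "Z \<in> ?S"
    show "g_field (B (vJ J (vJ J X)) Y) Z p = - g_field (B X Y) Z p"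
      "g_field (B X (vJ J (vJ J Y))) Z p = - g_field (B X Y) Z p"
      using s by (simp_all add: vJ_vJ B_neg1 B_neg2 g_field_vscale B_mem)
    show "g_field (B X (vJ J Y)) Z p = - g_field (B X Y) (vJ J Z) p"
      using s by (simp add: B_vJ g_field_vJ B_mem)
    show "g_field (B X Y) Z p = - g_field (B X Z) Y p"
      using s B_skew[OF s] g_field_sym[of Y "B X Z" p] by (simp add: B_mem)
    have "vadd (B (vJ J X) (vJ J Y)) (vscale (\<lambda>p. -1) (B (vJ J Y) (vJ J X)))
        = vscale (\<lambda>p. -1) (vadd (B X Y) (vscale (\<lambda>p. -1) (B Y X)))"
      using B_tor[OF s(1,2)] by (simp add: fun_eq_iff)
    then have "g_field (vadd (B (vJ J X) (vJ J Y)) (vscale (\<lambda>p. -1) (B (vJ J Y) (vJ J X)))) Z p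
        = g_field (vscale (\<lambda>p. -1) (vadd (B X Y) (vscale (\<lambda>p. -1) (B Y X)))) Z p" by simp
    then show "g_field (B (vJ J X) (vJ J Y)) Z p - g_field (B (vJ J Y) (vJ J X)) Z p
        = - (g_field (B X Y) Z p - g_field (B Y X) Z p)"
      using s by (simp add: g_field_vadd g_field_vscale B_mem smooth_fun_const)
  qed (use that in auto)
  have "B X Y p = (\<lambda>h. 0)" for p
    using zero[OF assms B_mem[OF assms], of p] g_pos[OF vector_fields_at[OF B_mem[OF assms]], of p]
    by (force simp: g_field_def)
  then have "B X Y p h = 0" for p h by (simp add: fun_eq_iff)
  then have "D' X Y p h + (- D X Y p h - conformal_shift X Y p h) = 0" for p h
    by (simp add: B_def)
  then have "D' X Y p h = vadd (D X Y) (conformal_shift X Y) p h" for p h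
    by (simp add: algebra_simps)
  then show ?thesis by (intro ext)
qed

definition ddc_field :: "'a vfield \<Rightarrow> 'a vfield \<Rightarrow> 'a \<Rightarrow> real" where
  "ddc_field X Y = (\<lambda>p. X p (dc_field Y) - Y p (dc_field X) - dc_field (bracket X Y) p)"

text \<open>
  The difference of the connections has values in the span of the identity and \<open>J\<close>, which commute with
  each other and are parallel. So the curvature changes by \<open>d (df) Id + d (d\<^sup>cf) J\<close>, and \<open>d (df) = 0\<close> is
  the definition of the bracket.
\<close>

lemma curvature_conformal:
  assumes X: "X \<in> vector_fields A" and Y: "Y \<in> vector_fields A" and Z: "Z \<in> vector_fields A"
  shows "curvature D' X Y Z p h = curvature D X Y Z p h + ddc_field X Y p * vJ J Z p h"
proof -
  note mem = connection_mem[OF conn_D] connection_mem[OF conn_D'] dc_field_smooth smooth_fun_const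
    vector_fields_smooth[OF _ f]
  have D'D': "D' X (D' Y Z) p h = D X (D Y Z) p h + X p f * D Y Z p h + dc_field X p * vJ J (D Y Z) p h
     + X p (\<lambda>q. Y q f) * Z p h + X p (dc_field Y) * vJ J Z p h
     + Y p f * D X Z p h + dc_field Y p * vJ J (D X Z) p h
     + Y p f * (X p f * Z p h + dc_field X p * vJ J Z p h)
     + dc_field Y p * (X p f * vJ J Z p h - dc_field X p * Z p h)"
    if X: "X \<in> vector_fields A" and Y: "Y \<in> vector_fields A" for X Y
  proof -
    have "D' X (D' Y Z) = vadd (D' X (D Y Z)) (vadd
        (vadd (vscale (\<lambda>p. X p (\<lambda>q. Y q f)) Z) (vscale (\<lambda>p. Y p f) (D' X Z)))
        (vadd (vscale (\<lambda>p. X p (dc_field Y)) (vJ J Z)) (vscale (dc_field Y) (vJ J (D' X Z)))))"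
      using X Y Z
      by (simp add: chern_connection_conformal[OF Y Z] conformal_shift_def mem
          connection_vadd[OF conn_D'] connection_vscale[OF conn_D'] D'_vJ)
    then show ?thesis
      using X Y Z
      by (simp add: chern_connection_conformal conformal_shift_def mem vJ_vadd vJ_vscale vJ_vJ algebra_simps)
  qed
  have "D' (bracket X Y) Z p h = D (bracket X Y) Z p h
      + bracket X Y p f * Z p h + dc_field (bracket X Y) p * vJ J Z p h"
    using X Y Z by (simp add: chern_connection_conformal conformal_shift_def)
  then show ?thesis
    using D'D'[OF X Y] D'D'[OF Y X]
    by (simp add: curvature_def ddc_field_def bracket_apply algebra_simps)
qed

text \<open>
  \<open>curvature_at\<close> and \<open>ddc\<close> extend tangent vectors by the same choice function, so the formula for vector
  fields passes to tangent vectors without an appeal to tensoriality.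
\<close>

lemma ddc_extend: "ddc A J f p u v = ddc_field (extend A p u) (extend A p v) p"
  by (simp add: ddc_def ext_deriv_def ddc_field_def dc_field_def[abs_def] dc_def vJ_def Let_def)

lemma curvature_at_conformal:
  assumes "u \<in> tangent_space A p" "v \<in> tangent_space A p" "w \<in> tangent_space A p"
  shows "curvature_at A D' p u v w = (\<lambda>h. curvature_at A D p u v w h + ddc A J f p u v * J p w h)"
  using assms by (simp add: curvature_at_def curvature_conformal ddc_extend fun_eq_iff vJ_def)

lemma ddc_swap:
  assumes "u \<in> tangent_space A p" "v \<in> tangent_space A p"
  shows "ddc A J f p v u = - ddc A J f p u v"
  using assms
  by (simp add: ddc_extend ddc_field_def bracket_swap[of "extend A p v"] dc_field_def[of "vscale _ _"] vJ_vscale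
      dc_field_def[of "bracket _ _"])

lemma ddc_tlinear:
  assumes v: "v \<in> tangent_space A p"
  shows "tlinear A p (\<lambda>u. ddc A J f p u v)" "tlinear A p (\<lambda>u. ddc A J f p v u)"
proof -
  let ?V = "extend A p v"
  have V: "?V \<in> vector_fields A" using v by simp
  note add = tangent_space_add[OF vector_fields_at[OF V]] and mult = tangent_space_mult[OF vector_fields_at[OF V]]
  have dc_field_add: "dc_field (vadd X Y) = (\<lambda>q. dc_field X q + dc_field Y q)"
    if "X \<in> vector_fields A" "Y \<in> vector_fields A" for X Y
    using that by (simp add: dc_field_def vJ_vadd fun_eq_iff)
  have dc_field_scale: "dc_field (vscale h X) = (\<lambda>q. h q * dc_field X q)"
    if "X \<in> vector_fields A" for X h
    using that by (simp add: dc_field_def vJ_vscale fun_eq_iff)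
  show 1: "tlinear A p (\<lambda>u. ddc A J f p u v)"
    unfolding ddc_extend
  proof (rule tensorial_tlinear[where P = "\<lambda>X. ddc_field X ?V p"])
    fix X Y assume "X \<in> vector_fields A" "Y \<in> vector_fields A"
    then show "ddc_field (vadd X Y) ?V p = ddc_field X ?V p + ddc_field Y ?V p"
      using V by (simp add: ddc_field_def dc_field_add bracket_vadd add dc_field_smooth)
  next
    fix X h assume "X \<in> vector_fields A" "smooth_fun A h"
    then show "ddc_field (vscale h X) ?V p = h p * ddc_field X ?V p"
      using V by (simp add: ddc_field_def dc_field_add dc_field_scale bracket_vscale mult dc_field_smooth
          vector_fields_smooth smooth_fun_minus algebra_simps)
  qed
  then show "tlinear A p (\<lambda>u. ddc A J f p v u)"
    using v by (simp add: tlinear_def tangent_space_comb ddc_swap[of _ _ v] algebra_simps)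
qed

end
end

section \<open>Adapted frames and real traces\<close>

text \<open>
  For an arbitrary inner product \<open>G\<close>: orthonormal vectors are independent, and as many as the dimension
  span. The defect of the expansion is then orthogonal to everything.
\<close>

lemma orthonormal_expansion:
  fixes G :: "'e::euclidean_space \<Rightarrow> 'e \<Rightarrow> real" and e :: "nat \<Rightarrow> 'e"
  assumes bil: "bilinear G" and pos: "\<And>x. x \<noteq> 0 \<Longrightarrow> G x x > 0"
    and on: "\<And>i j. i \<in> I \<Longrightarrow> j \<in> I \<Longrightarrow> G (e i) (e j) = (if i = j then 1 else 0)"
    and I: "finite I" "card I = DIM('e)"
  shows "v = (\<Sum>i\<in>I. G v (e i) *\<^sub>R e i)"
proof -
  have lin: "linear (G x)" "linear (\<lambda>y. G y x)" for x using bil by (auto simp: bilinear_def)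
  have inj: "inj_on e I" using on by (metis inj_onI zero_neq_one)
  have G_sum: "G (\<Sum>i\<in>I. c i *\<^sub>R e i) (e j) = c j" if "j \<in> I" for c j
  proof -
    have "G (\<Sum>i\<in>I. c i *\<^sub>R e i) (e j) = (\<Sum>i\<in>I. c i * G (e i) (e j))"
      by (simp add: linear_sum[OF lin(2)] linear_scale[OF lin(2)])
    also have "\<dots> = (\<Sum>i\<in>I. if i = j then c i else 0)"
      by (intro sum.cong refl) (simp add: on that)
    finally show ?thesis using that I(1) by simp
  qed
  have "independent (e ` I)"
    unfolding independent_explicit
  proof (intro conjI allI impI ballI)
    show "finite (e ` I)" using I by simp
    fix c v assume c: "(\<Sum>v\<in>e ` I. c v *\<^sub>R v) = 0" and "v \<in> e ` I"
    then obtain j where j: "j \<in> I" "v = e j" by blast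
    have "(\<Sum>i\<in>I. c (e i) *\<^sub>R e i) = 0" using c by (simp add: sum.reindex[OF inj])
    then show "c v = 0" using G_sum[OF j(1), of "\<lambda>i. c (e i)"] j(2) linear_0[OF lin(2)] by simp
  qed
  then have "dim (e ` I) = DIM('e)"
    using dim_eq_card_independent card_image[OF inj] I by metis
  then have span: "span (e ` I) = UNIV" by (simp add: dim_eq_full)
  define w where "w = v - (\<Sum>i\<in>I. G v (e i) *\<^sub>R e i)"
  have "G w (e j) = 0" if "j \<in> I" for j
    using G_sum[OF that, of "\<lambda>i. G v (e i)"] by (simp add: w_def linear_diff[OF lin(2)])
  note w = this
  have "G w x = 0" if "x \<in> span (e ` I)" for x
    by (rule span_induct[OF that])
      (use w in \<open>auto simp: subspace_def linear_add[OF lin(1)]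
        linear_scale[OF lin(1)] linear_0[OF lin(1)]\<close>)
  then have "G w w = 0" using span by simp
  then have "w = 0" using pos by force
  then show ?thesis by (simp add: w_def)
qed

text \<open>
  Gram-Schmidt in steps of two: a unit vector \<open>v\<close> orthogonal to the vectors found so far is added
  together with \<open>K v\<close>. The second is orthogonal to the old vectors because these are permuted by \<open>K\<close> up
  to sign, and orthogonal to \<open>v\<close> because \<open>K\<close> is skew.
\<close>

lemma adapted_basis_exists:
  fixes G :: "'e::euclidean_space \<Rightarrow> 'e \<Rightarrow> real" and K :: "'e \<Rightarrow> 'e"
  assumes bil: "bilinear G" and pos: "\<And>x. x \<noteq> 0 \<Longrightarrow> G x x > 0" and sym: "\<And>x y. G x y = G y x"
    and K: "linear K" "\<And>x. K (K x) = - x" "\<And>x y. G (K x) (K y) = G x y"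
  shows "2 * k \<le> DIM('e) \<Longrightarrow> \<exists>e :: nat \<Rightarrow> 'e.
    (\<forall>i\<in>{1..2*k}. \<forall>j\<in>{1..2*k}. G (e i) (e j) = (if i = j then 1 else 0)) \<and>
    (\<forall>\<alpha>\<in>{1..k}. e (2 * \<alpha>) = K (e (2 * \<alpha> - 1)))"
proof (induction k)
  case (Suc k)
  have lin: "linear (G x)" "linear (\<lambda>y. G y x)" for x using bil by (auto simp: bilinear_def)
  have "2 * k \<le> DIM('e)" using Suc.prems by simp
  from Suc.IH[OF this] obtain e :: "nat \<Rightarrow> 'e" where e:
    "\<forall>i\<in>{1..2*k}. \<forall>j\<in>{1..2*k}. G (e i) (e j) = (if i = j then 1 else 0)"
    "\<forall>\<alpha>\<in>{1..k}. e (2 * \<alpha>) = K (e (2 * \<alpha> - 1))"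
    by (elim exE conjE)
  note on = e(1)[rule_format] and eK = e(2)[rule_format]
  have "dim (e ` {1..2*k}) \<le> 2 * k"
    using dim_le_card'[of "e ` {1..2*k}"] card_image_le[of "{1..2*k}" e] by simp
  then have "span (e ` {1..2*k}) \<noteq> UNIV" using Suc.prems dim_eq_full[of "e ` {1..2*k}"] by simp
  then obtain x where x: "x \<notin> span (e ` {1..2*k})" by auto
  define y where "y = x - (\<Sum>i\<in>{1..2*k}. G x (e i) *\<^sub>R e i)"
  have "y \<noteq> 0"
  proof
    assume "y = 0"
    then have "x = (\<Sum>i\<in>{1..2*k}. G x (e i) *\<^sub>R e i)" by (simp add: y_def)
    then show False using x by (metis (no_types, lifting) image_eqI span_base span_scale span_sum)
  qed
  have y: "G y (e j) = 0" if "j \<in> {1..2*k}" for j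
  proof -
    have "G (\<Sum>i\<in>{1..2*k}. G x (e i) *\<^sub>R e i) (e j) = (\<Sum>i\<in>{1..2*k}. G x (e i) * G (e i) (e j))"
      by (simp add: linear_sum[OF lin(2)] linear_scale[OF lin(2)])
    also have "\<dots> = (\<Sum>i\<in>{1..2*k}. if i = j then G x (e i) else 0)"
      by (intro sum.cong refl) (subst on[OF _ that], simp_all)
    finally show ?thesis using that by (simp add: y_def linear_diff[OF lin(2)])
  qed
  define v where "v = (1 / sqrt (G y y)) *\<^sub>R y"
  have vv: "G v v = 1"
    using pos[OF \<open>y \<noteq> 0\<close>] by (simp add: v_def linear_scale[OF lin(1)] linear_scale[OF lin(2)] field_simps)
  have ve: "G v (e j) = 0" if "j \<in> {1..2*k}" for j
    using y[OF that] by (simp add: v_def linear_scale[OF lin(2)])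
  have GK: "G (K a) b = - G a (K b)" for a b
    using K(3)[of a "K b"] by (simp add: K(2) linear_neg[OF lin(1)])
  have Ke: "\<exists>i\<in>{1..2*k}. K (e j) = e i \<or> K (e j) = - e i" if "j \<in> {1..2*k}" for j
  proof (cases "even j")
    case True
    then obtain \<alpha> where "j = 2 * \<alpha>" by blast
    then have \<alpha>: "\<alpha> \<in> {1..k}" using that by auto
    show ?thesis using eK[OF \<alpha>] \<open>j = 2 * \<alpha>\<close> \<alpha> by (intro bexI[of _ "2 * \<alpha> - 1"]) (auto simp: K(2))
  next
    case False
    then obtain \<alpha> where "j = 2 * \<alpha> + 1" by (metis oddE)
    then have \<alpha>: "Suc \<alpha> \<in> {1..k}" using that by auto
    show ?thesis using eK[OF \<alpha>] \<open>j = 2 * \<alpha> + 1\<close> \<alpha> by (intro bexI[of _ "2 * Suc \<alpha>"]) auto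
  qed
  have Kve: "G (K v) (e j) = 0" if "j \<in> {1..2*k}" for j
    using Ke[OF that] ve by (auto simp: GK linear_neg[OF lin(1)])
  have vKv: "G v (K v) = 0" using GK[of v v] sym[of "K v" v] by simp
  have ev: "G (e j) v = 0" "G (e j) (K v) = 0" if "j \<in> {1..2*k}" for j
    using ve[OF that] Kve[OF that] sym by metis+
  have Kvv: "G (K v) v = 0" using vKv sym by metis
  have KvKv: "G (K v) (K v) = 1" using vv K(3) by metis
  let ?e = "e(Suc (2 * k) := v, Suc (Suc (2 * k)) := K v)"
  have "G (?e i) (?e j) = (if i = j then 1 else 0)" if "i \<in> {1..2 * Suc k}" "j \<in> {1..2 * Suc k}" for i j
  proof -
    have "i \<in> {1..2*k} \<or> i = Suc (2 * k) \<or> i = Suc (Suc (2 * k))"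
      "j \<in> {1..2*k} \<or> j = Suc (2 * k) \<or> j = Suc (Suc (2 * k))" using that by auto
    then show ?thesis
      by (elim disjE) (use on in \<open>simp_all add: ve Kve vv vKv ev Kvv KvKv\<close>)
  qed
  moreover have "?e (2 * \<alpha>) = K (?e (2 * \<alpha> - 1))" if "\<alpha> \<in> {1..Suc k}" for \<alpha>
  proof (cases "\<alpha> = Suc k")
    case False
    then have "\<alpha> \<in> {1..k}" using that by auto
    then show ?thesis using eK by auto
  qed simp
  ultimately show ?case by blast
qed simp

context hermitian begin

lemma adapted_frame_exists:
  assumes "DIM('e) = 2 * n"
  shows "\<exists>e. adapted_frame A J g p e"
proof -
  obtain \<Phi> :: "'e \<Rightarrow> 'a tvec" where \<Phi>: "\<And>x. \<Phi> x \<in> tangent_space A p"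
    "\<And>a b x y. \<Phi> (a *\<^sub>R x + b *\<^sub>R y) = (\<lambda>f. a * \<Phi> x f + b * \<Phi> y f)"
    "\<And>x. \<Phi> x = (\<lambda>f. 0) \<Longrightarrow> x = 0"
    "\<And>v. v \<in> tangent_space A p \<Longrightarrow> \<exists>x. v = \<Phi> x"
    by (rule tangent_space_param[of p]) blast
  have \<Phi>_add: "\<Phi> (x + y) = (\<lambda>f. \<Phi> x f + \<Phi> y f)" for x y using \<Phi>(2)[of 1 x 1 y] by simp
  have \<Phi>_scale: "\<Phi> (c *\<^sub>R x) = (\<lambda>f. c * \<Phi> x f)" for c x using \<Phi>(2)[of c x 0 x] by simp
  have \<Phi>_sum: "\<Phi> (\<Sum>i\<in>I. c i *\<^sub>R x i) = (\<lambda>f. \<Sum>i\<in>I. c i * \<Phi> (x i) f)" if "finite I" for I :: "nat set" and c x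
    using that
  proof (induction I)
    case empty
    show ?case using \<Phi>(2)[of 0 0 0 0] by simp
  qed (simp add: \<Phi>_add \<Phi>_scale)
  have inj: "x = y" if "\<Phi> x = \<Phi> y" for x y
    using \<Phi>(3)[of "x - y"] \<Phi>(2)[of 1 x "-1" y] that by simp
  define G where "G = (\<lambda>x y. g p (\<Phi> x) (\<Phi> y))"
  define K where "K = (\<lambda>x. SOME y. J p (\<Phi> x) = \<Phi> y)"
  have \<Phi>K: "\<Phi> (K x) = J p (\<Phi> x)" for x
    unfolding K_def using someI_ex[OF \<Phi>(4)[OF J_mem[OF \<Phi>(1)]]] by metis
  have bil: "bilinear G"
    unfolding bilinear_def
  proof (intro conjI allI linearI)
    fix x y z c
    show "G x (y + z) = G x y + G x z" "G (y + z) x = G y x + G z x"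
      using tlinearD[OF g_tlinear2[OF \<Phi>(1)[of x]] \<Phi>(1)[of y] \<Phi>(1)[of z], of 1 1]
        tlinearD[OF g_tlinear1[OF \<Phi>(1)[of x]] \<Phi>(1)[of y] \<Phi>(1)[of z], of 1 1]
      by (simp_all add: G_def \<Phi>_add \<Phi>(1))
    show "G x (c *\<^sub>R y) = c *\<^sub>R G x y" "G (c *\<^sub>R y) x = c *\<^sub>R G y x"
      using tlinear_scale[OF g_tlinear2[OF \<Phi>(1)[of x]] \<Phi>(1)[of y], of c]
        tlinear_scale[OF g_tlinear1[OF \<Phi>(1)[of x]] \<Phi>(1)[of y], of c]
      by (simp_all add: G_def \<Phi>_scale \<Phi>(1))
  qed
  have pos: "G x x > 0" if "x \<noteq> 0" for x
    unfolding G_def using g_pos[OF \<Phi>(1)] \<Phi>(3) that by blast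
  have sym: "G x y = G y x" for x y by (simp add: G_def g_sym \<Phi>(1))
  have K: "linear K" "K (K x) = - x" "G (K x) (K y) = G x y" for x y
  proof -
    show "linear K"
      by (intro linearI inj) (simp_all add: \<Phi>K \<Phi>_add \<Phi>_scale J_add J_scale \<Phi>(1))
    show "K (K x) = - x"
      using \<Phi>_scale[of "-1" x] by (intro inj) (simp add: \<Phi>K J_J \<Phi>(1))
    show "G (K x) (K y) = G x y" by (simp add: G_def \<Phi>K g_J_J \<Phi>(1))
  qed
  have "2 * n \<le> DIM('e)" using assms by simp
  then have "\<exists>e :: nat \<Rightarrow> 'e.
    (\<forall>i\<in>{1..2*n}. \<forall>j\<in>{1..2*n}. G (e i) (e j) = (if i = j then 1 else 0)) \<and>
    (\<forall>\<alpha>\<in>{1..n}. e (2 * \<alpha>) = K (e (2 * \<alpha> - 1)))"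
    using pos by (intro adapted_basis_exists[OF bil _ sym K])
  then obtain e :: "nat \<Rightarrow> 'e" where e:
    "\<forall>i\<in>{1..2*n}. \<forall>j\<in>{1..2*n}. G (e i) (e j) = (if i = j then 1 else 0)"
    "\<forall>\<alpha>\<in>{1..n}. e (2 * \<alpha>) = K (e (2 * \<alpha> - 1))"
    by (elim exE conjE)
  have exp: "v = (\<Sum>i\<in>{1..2*n}. G v (e i) *\<^sub>R e i)" for v
    using assms by (intro orthonormal_expansion[OF bil pos e(1)[rule_format]]) auto
  have "\<exists>c. v = (\<lambda>f. \<Sum>i=1..2*n. c i * \<Phi> (e i) f)" if v: "v \<in> tangent_space A p" for v
  proof -
    obtain x where "v = \<Phi> x" using \<Phi>(4)[OF v] by blast
    then have "v = \<Phi> (\<Sum>i\<in>{1..2*n}. G x (e i) *\<^sub>R e i)" using exp[of x] by simp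
    then show ?thesis unfolding \<Phi>_sum[OF finite_atLeastAtMost] by (intro exI[of _ "\<lambda>i. G x (e i)"])
  qed
  then show ?thesis
    using \<Phi>(1) e by (intro exI[of _ "\<lambda>i. \<Phi> (e i)"]) (simp add: adapted_frame_def assms G_def \<Phi>K)
qed

context
  fixes p :: 'a and e :: "nat \<Rightarrow> 'a tvec"
  assumes e: "adapted_frame A J g p e"
begin

lemma frame_mem [simp]: "i \<in> {1..DIM('e)} \<Longrightarrow> e i \<in> tangent_space A p"
  using e[unfolded adapted_frame_def, THEN conjunct1] by blast

lemma frame_orthonormal:
  "i \<in> {1..DIM('e)} \<Longrightarrow> j \<in> {1..DIM('e)} \<Longrightarrow> g p (e i) (e j) = (if i = j then 1 else 0)"
  using e[unfolded adapted_frame_def, THEN conjunct2, THEN conjunct2, THEN conjunct1] by blast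

lemma frame_J: "\<alpha> \<in> {1..DIM('e) div 2} \<Longrightarrow> e (2 * \<alpha>) = J p (e (2 * \<alpha> - 1))"
  using e[unfolded adapted_frame_def, THEN conjunct2, THEN conjunct2, THEN conjunct2] by blast

lemma frame_expansion:
  assumes v: "v \<in> tangent_space A p"
  shows "v = (\<lambda>f. \<Sum>i=1..DIM('e). g p v (e i) * e i f)"
proof -
  obtain c where c: "v = (\<lambda>f. \<Sum>i=1..DIM('e). c i * e i f)"
    using e[unfolded adapted_frame_def, THEN conjunct2, THEN conjunct1] v by blast
  have "g p v (e j) = c j" if j: "j \<in> {1..DIM('e)}" for j
  proof -
    have "g p v (e j) = (\<Sum>i=1..DIM('e). c i * g p (e i) (e j))"
      unfolding c by (rule tlinear_sum[OF g_tlinear1[OF frame_mem[OF j]] frame_mem])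
    also have "\<dots> = (\<Sum>i=1..DIM('e). if i = j then c i else 0)"
      by (intro sum.cong refl) (subst frame_orthonormal[OF _ j], simp_all)
    finally show ?thesis using j by simp
  qed
  then have "(\<Sum>i=1..DIM('e). g p v (e i) * e i f) = (\<Sum>i=1..DIM('e). c i * e i f)" for f
    by (intro sum.cong) simp_all
  then show ?thesis by (subst c) simp
qed

lemma tlinear_frame:
  assumes "tlinear A p L" "v \<in> tangent_space A p"
  shows "L v = (\<Sum>i=1..DIM('e). g p v (e i) * L (e i))"
  by (subst frame_expansion[OF assms(2)]) (rule tlinear_sum[OF assms(1) frame_mem])

end

text \<open>
  Expand the second frame in the first and the first in the second. All Ricci forms are defined by
  frames chosen separately for \<open>g\<close> and for the rescaled metric, which have nothing to do with each
  other; this lemma allows a frame to be fixed for one metric and rescaled for the other.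
\<close>

lemma trace_frame_independent:
  assumes e: "adapted_frame A J g p e" and e': "adapted_frame A J g p e'"
    and B: "\<And>x. x \<in> tangent_space A p \<Longrightarrow> tlinear A p (\<lambda>y. B x y)"
      "\<And>y. y \<in> tangent_space A p \<Longrightarrow> tlinear A p (\<lambda>x. B x y)"
  shows "(\<Sum>i=1..DIM('e). B (e i) (e i)) = (\<Sum>i=1..DIM('e). B (e' i) (e' i))"
proof -
  let ?I = "{1..DIM('e)}"
  have "(\<Sum>j\<in>?I. B (e' j) (e' j)) = (\<Sum>j\<in>?I. \<Sum>i\<in>?I. g p (e' j) (e i) * B (e i) (e' j))"
    using frame_mem[OF e'] by (intro sum.cong refl tlinear_frame[OF e] B(2)) auto
  also have "\<dots> = (\<Sum>i\<in>?I. \<Sum>j\<in>?I. g p (e i) (e' j) * B (e i) (e' j))"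
    using frame_mem[OF e'] frame_mem[OF e] by (subst sum.swap) (simp add: g_sym)
  also have "\<dots> = (\<Sum>i\<in>?I. B (e i) (e i))"
    using frame_mem[OF e] by (intro sum.cong refl tlinear_frame[OF e', symmetric] B(1)) auto
  finally show ?thesis by simp
qed

lemma some_adapted_frame:
  "adapted_frame A J g p e \<Longrightarrow> adapted_frame A J g p (some_adapted_frame A J g p)"
  unfolding some_adapted_frame_def using someI[of "adapted_frame A J g p" e] by blast

lemma tlinear_compose_J: "tlinear A p L \<Longrightarrow> tlinear A p (\<lambda>u. L (J p u))"
  by (auto simp: tlinear_def J_lin)

lemma lefschetz_trace_eq:
  assumes e: "adapted_frame A J g p e"
    and B: "\<And>x. x \<in> tangent_space A p \<Longrightarrow> tlinear A p (\<lambda>y. \<phi> p x y)"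
      "\<And>y. y \<in> tangent_space A p \<Longrightarrow> tlinear A p (\<lambda>x. \<phi> p x y)"
  shows "lefschetz_trace A J g \<phi> p = (1/2) * (\<Sum>i=1..DIM('e). \<phi> p (e i) (J p (e i)))"
  unfolding lefschetz_trace_def Let_def
  by (subst trace_frame_independent[OF e some_adapted_frame[OF e], where B = "\<lambda>x y. \<phi> p x (J p y)"])
    (auto intro: tlinear_compose_J B)

context
  fixes D :: "'a connection" and p :: 'a
  assumes D: "tangent_connection A D"
begin

definition Rm :: "'a tvec \<Rightarrow> 'a tvec \<Rightarrow> 'a tvec \<Rightarrow> 'a tvec \<Rightarrow> real" where
  "Rm u v w t = g p (curvature_at A D p u v w) t"

lemma Rm_tlinear:
  assumes "u \<in> tangent_space A p" "v \<in> tangent_space A p" "w \<in> tangent_space A p"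
  shows "tlinear A p (\<lambda>x. Rm x u v w)" "tlinear A p (\<lambda>x. Rm u x v w)"
    "tlinear A p (\<lambda>x. Rm u v x w)" "tlinear A p (\<lambda>x. Rm u v w x)"
proof -
  have *: "tlinear A p (\<lambda>x. g p (F x) w)"
    if "\<And>h. tlinear A p (\<lambda>x. F x h)" "\<And>x. x \<in> tangent_space A p \<Longrightarrow> F x \<in> tangent_space A p" for F
  proof -
    have "F (\<lambda>h. a * x h + b * y h) = (\<lambda>h. a * F x h + b * F y h)"
      if "x \<in> tangent_space A p" "y \<in> tangent_space A p" for x y a b
      using tlinearD[OF \<open>\<And>h. tlinear A p (\<lambda>x. F x h)\<close> that] by auto
    then show ?thesis using tlinearD[OF g_tlinear1[OF assms(3)]] that(2) by (simp add: tlinear_def)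
  qed
  show "tlinear A p (\<lambda>x. Rm x u v w)" "tlinear A p (\<lambda>x. Rm u x v w)" "tlinear A p (\<lambda>x. Rm u v x w)"
    unfolding Rm_def using curvature_at_tlinear[OF D] curvature_at_mem[OF D] assms
    by (auto intro!: *)
  show "tlinear A p (\<lambda>x. Rm u v w x)"
    unfolding Rm_def using curvature_at_mem[OF D] assms by (intro g_tlinear2)
qed

lemma first_ricci_eq:
  assumes e: "adapted_frame A J g p e" and uv: "u \<in> tangent_space A p" "v \<in> tangent_space A p"
  shows "first_ricci A J g D p u v = - (1/2) * (\<Sum>i=1..DIM('e). Rm u v (e i) (J p (e i)))"
  unfolding first_ricci_def Let_def Rm_def[symmetric]
  by (subst trace_frame_independent[OF e some_adapted_frame[OF e], where B = "\<lambda>x y. Rm u v x (J p y)"])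
    (auto intro!: tlinear_compose_J Rm_tlinear uv)

lemma second_ricci_eq:
  assumes e: "adapted_frame A J g p e" and uv: "u \<in> tangent_space A p" "v \<in> tangent_space A p"
  shows "second_ricci A J g D p u v = - (1/2) * (\<Sum>i=1..DIM('e). Rm (e i) (J p (e i)) u v)"
  unfolding second_ricci_def Let_def Rm_def[symmetric]
  by (subst trace_frame_independent[OF e some_adapted_frame[OF e], where B = "\<lambda>x y. Rm x (J p y) u v"])
    (auto intro!: tlinear_compose_J[where L = "\<lambda>y. Rm _ y _ _"] Rm_tlinear uv)

end
end

section \<open>Complex multilinear extensions\<close>

text \<open>
  The complex extension of a real functional. In each single slot, the multilinear extensions \<open>cext2\<close>
  and \<open>cext4\<close> are combinations of such extensions, which is how their complex linearity is derived.
\<close>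

definition cext1 :: "('a tvec \<Rightarrow> real) \<Rightarrow> 'a cvec \<Rightarrow> complex" where
  "cext1 L z = (\<Sum>j<2. \<i> ^ j * complex_of_real (L (part j z)))"

lemma cext1_eq: "cext1 L z = complex_of_real (L (re_vec z)) + \<i> * complex_of_real (L (im_vec z))"
  by (simp add: cext1_def part_def numeral_2_eq_2)

lemma covectorD:
  "complex_covector A p L \<Longrightarrow> x \<in> ctangent_space A p \<Longrightarrow> y \<in> ctangent_space A p \<Longrightarrow>
    L (\<lambda>f. a * x f + b * y f) = a * L x + b * L y"
  by (simp add: complex_covector_def)

lemma ctangent_space_comb:
  assumes "x \<in> ctangent_space A p" "y \<in> ctangent_space A p"
  shows "(\<lambda>f. a * x f + b * y f) \<in> ctangent_space A p"
proof -
  have m: "re_vec x \<in> tangent_space A p" "im_vec x \<in> tangent_space A p"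
    "re_vec y \<in> tangent_space A p" "im_vec y \<in> tangent_space A p"
    using assms by (auto simp: ctangent_space_def)
  have "re_vec (\<lambda>f. a * x f + b * y f) = (\<lambda>f. 1 * (Re a * re_vec x f + (- Im a) * im_vec x f)
      + 1 * (Re b * re_vec y f + (- Im b) * im_vec y f))"
    "im_vec (\<lambda>f. a * x f + b * y f) = (\<lambda>f. 1 * (Im a * re_vec x f + Re a * im_vec x f)
      + 1 * (Im b * re_vec y f + Re b * im_vec y f))"
    by (auto simp: re_vec_def im_vec_def)
  moreover have "(\<lambda>f. 1 * (r * re_vec x f + s * im_vec x f) + 1 * (r' * re_vec y f + s' * im_vec y f))
      \<in> tangent_space A p" for r s r' s'
    by (intro tangent_space_comb m)
  ultimately show ?thesis by (simp only: ctangent_space_def mem_Collect_eq conj_absorb)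
qed

lemma ctangent_space_zero: "(\<lambda>f. 0) \<in> ctangent_space A p"
  by (simp add: ctangent_space_def re_vec_def im_vec_def tangent_space_zero)

lemma ctangent_space_sum:
  assumes "\<And>i. i \<in> I \<Longrightarrow> x i \<in> ctangent_space A p"
  shows "(\<lambda>f. \<Sum>i\<in>I. c i * x i f) \<in> ctangent_space A p"
  using assms
proof (induction I rule: infinite_finite_induct)
  case (insert i I)
  then show ?case using ctangent_space_comb[of "x i" A p "\<lambda>f. \<Sum>i\<in>I. c i * x i f" "c i" 1] by simp
qed (auto simp: ctangent_space_zero)

lemma covector_zero: "complex_covector A p L \<Longrightarrow> L (\<lambda>f. 0) = 0"
  using covectorD[of A p L "\<lambda>f. 0" "\<lambda>f. 0" 0 0] by (simp add: ctangent_space_zero)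

lemma covector_sum:
  assumes L: "complex_covector A p L" and "\<And>i. i \<in> I \<Longrightarrow> x i \<in> ctangent_space A p"
  shows "L (\<lambda>f. \<Sum>i\<in>I. c i * x i f) = (\<Sum>i\<in>I. c i * L (x i))"
  using assms(2)
proof (induction I rule: infinite_finite_induct)
  case (insert i I)
  then show ?case
    using covectorD[OF L, of "x i" "\<lambda>f. \<Sum>i\<in>I. c i * x i f" "c i" 1] ctangent_space_sum[of I x A p c]
    by simp
qed (auto simp: covector_zero[OF L])

lemma covector_scale:
  "complex_covector A p L \<Longrightarrow> x \<in> ctangent_space A p \<Longrightarrow> L (\<lambda>f. a * x f) = a * L x"
  using covectorD[of A p L x x a 0] by simp

lemma covector_add:
  "complex_covector A p L \<Longrightarrow> x \<in> ctangent_space A p \<Longrightarrow> y \<in> ctangent_space A p \<Longrightarrow>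
    L (\<lambda>f. x f + y f) = L x + L y"
  using covectorD[of A p L x y 1 1] by simp

lemma covector_sum_pointwise:
  "(\<And>i. i \<in> I \<Longrightarrow> complex_covector A p (L i)) \<Longrightarrow> complex_covector A p (\<lambda>z. \<Sum>i\<in>I. c i * L i z)"
  by (simp add: complex_covector_def sum_distrib_left sum.distrib algebra_simps)

lemma covector_cext1:
  assumes L: "tlinear A p L"
  shows "complex_covector A p (cext1 L)"
  unfolding complex_covector_def
proof (intro ballI allI)
  fix x y a b assume xy: "x \<in> ctangent_space A p" "y \<in> ctangent_space A p"
  have m: "re_vec x \<in> tangent_space A p" "im_vec x \<in> tangent_space A p"
    "re_vec y \<in> tangent_space A p" "im_vec y \<in> tangent_space A p"
    using xy by (auto simp: ctangent_space_def)
  have 1: "re_vec (\<lambda>f. a * x f + b * y f) = (\<lambda>f. 1 * (Re a * re_vec x f + (- Im a) * im_vec x f)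
      + 1 * (Re b * re_vec y f + (- Im b) * im_vec y f))"
    "im_vec (\<lambda>f. a * x f + b * y f) = (\<lambda>f. 1 * (Im a * re_vec x f + Re a * im_vec x f)
      + 1 * (Im b * re_vec y f + Re b * im_vec y f))"
    by (auto simp: re_vec_def im_vec_def)
  show "cext1 L (\<lambda>f. a * x f + b * y f) = a * cext1 L x + b * cext1 L y"
    unfolding cext1_eq 1
    by (simp only: tlinearD[OF L] tangent_space_comb m) (simp add: complex_eq_iff algebra_simps)
qed

lemma cext4_slots:
  "cext4 T z1 z2 z3 z4 = (\<Sum>j<2. \<Sum>k<2. \<Sum>l<2. \<i> ^ (j + k + l) * cext1 (\<lambda>x. T x (part j z2) (part k z3) (part l z4)) z1)"
  "cext4 T z1 z2 z3 z4 = (\<Sum>j<2. \<Sum>k<2. \<Sum>l<2. \<i> ^ (j + k + l) * cext1 (\<lambda>x. T (part j z1) x (part k z3) (part l z4)) z2)"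
  "cext4 T z1 z2 z3 z4 = (\<Sum>j<2. \<Sum>k<2. \<Sum>l<2. \<i> ^ (j + k + l) * cext1 (\<lambda>x. T (part j z1) (part k z2) x (part l z4)) z3)"
  "cext4 T z1 z2 z3 z4 = (\<Sum>j<2. \<Sum>k<2. \<Sum>l<2. \<i> ^ (j + k + l) * cext1 (\<lambda>x. T (part j z1) (part k z2) (part l z3) x) z4)"
  unfolding cext4_def cext1_def sum_distrib_left
  subgoal
    by (rule trans[OF sum.swap], rule sum.cong[OF refl], rule trans[OF sum.swap], rule sum.cong[OF refl],
        rule trans[OF sum.swap], rule sum.cong[OF refl], rule sum.cong[OF refl])
      (simp add: power_add mult_ac)
  subgoal
    by (rule sum.cong[OF refl], rule trans[OF sum.swap], rule sum.cong[OF refl],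
        rule trans[OF sum.swap], rule sum.cong[OF refl], rule sum.cong[OF refl])
      (simp add: power_add mult_ac)
  subgoal
    by (rule sum.cong[OF refl], rule sum.cong[OF refl],
        rule trans[OF sum.swap], rule sum.cong[OF refl], rule sum.cong[OF refl])
      (simp add: power_add mult_ac)
  subgoal
    by (rule sum.cong[OF refl], rule sum.cong[OF refl], rule sum.cong[OF refl], rule sum.cong[OF refl])
      (simp add: power_add mult_ac)
  done

lemma cext2_slots:
  "cext2 b z w = (\<Sum>j<2. \<i> ^ j * cext1 (\<lambda>x. b x (part j w)) z)"
  "cext2 b z w = (\<Sum>j<2. \<i> ^ j * cext1 (\<lambda>x. b (part j z) x) w)"
  unfolding cext2_def cext1_def sum_distrib_left
  subgoal
    by (rule trans[OF sum.swap], rule sum.cong[OF refl], rule sum.cong[OF refl])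
      (simp add: power_add mult_ac)
  subgoal
    by (rule sum.cong[OF refl], rule sum.cong[OF refl]) (simp add: power_add mult_ac)
  done

lemma part_mem: "z \<in> ctangent_space A p \<Longrightarrow> part k z \<in> tangent_space A p"
  by (simp add: part_def ctangent_space_def)

definition tensor4 where
  "tensor4 A p T \<longleftrightarrow> (\<forall>u\<in>tangent_space A p. \<forall>v\<in>tangent_space A p. \<forall>w\<in>tangent_space A p.
     tlinear A p (\<lambda>x. T x u v w) \<and> tlinear A p (\<lambda>x. T u x v w) \<and>
     tlinear A p (\<lambda>x. T u v x w) \<and> tlinear A p (\<lambda>x. T u v w x))"

definition tensor2 where
  "tensor2 A p b \<longleftrightarrow> (\<forall>u\<in>tangent_space A p. tlinear A p (\<lambda>x. b x u) \<and> tlinear A p (\<lambda>x. b u x))"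

lemma covector_cext4:
  assumes T: "tensor4 A p T"
    and m: "z1 \<in> ctangent_space A p" "z2 \<in> ctangent_space A p" "z3 \<in> ctangent_space A p"
  shows "complex_covector A p (\<lambda>z. cext4 T z z1 z2 z3)"
    "complex_covector A p (\<lambda>z. cext4 T z1 z z2 z3)"
    "complex_covector A p (\<lambda>z. cext4 T z1 z2 z z3)"
    "complex_covector A p (\<lambda>z. cext4 T z1 z2 z3 z)"
proof -
  have s: "complex_covector A p (\<lambda>z. \<Sum>j<2. \<Sum>k<2. \<Sum>l<2. \<i> ^ (j + k + l) * cext1 (L j k l) z)"
    if "\<And>j k l. tlinear A p (L j k l)" for L :: "nat \<Rightarrow> nat \<Rightarrow> nat \<Rightarrow> _"
    using covector_cext1[OF that]
    by (simp add: complex_covector_def sum_distrib_left sum.distrib algebra_simps)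
  show "complex_covector A p (\<lambda>z. cext4 T z z1 z2 z3)"
    unfolding cext4_slots(1)[of T _ z1 z2 z3] by (rule s) (use T part_mem[OF m(1)] part_mem[OF m(2)] part_mem[OF m(3)] in \<open>auto simp: tensor4_def\<close>)
  show "complex_covector A p (\<lambda>z. cext4 T z1 z z2 z3)"
    unfolding cext4_slots(2)[of T z1 _ z2 z3] by (rule s) (use T part_mem[OF m(1)] part_mem[OF m(2)] part_mem[OF m(3)] in \<open>auto simp: tensor4_def\<close>)
  show "complex_covector A p (\<lambda>z. cext4 T z1 z2 z z3)"
    unfolding cext4_slots(3)[of T z1 z2 _ z3] by (rule s) (use T part_mem[OF m(1)] part_mem[OF m(2)] part_mem[OF m(3)] in \<open>auto simp: tensor4_def\<close>)
  show "complex_covector A p (\<lambda>z. cext4 T z1 z2 z3 z)"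
    unfolding cext4_slots(4)[of T z1 z2 z3] by (rule s) (use T part_mem[OF m(1)] part_mem[OF m(2)] part_mem[OF m(3)] in \<open>auto simp: tensor4_def\<close>)
qed

lemma covector_cext2:
  assumes b: "tensor2 A p b" and m: "w \<in> ctangent_space A p"
  shows "complex_covector A p (\<lambda>z. cext2 b z w)" "complex_covector A p (\<lambda>z. cext2 b w z)"
proof -
  show "complex_covector A p (\<lambda>z. cext2 b z w)"
    unfolding cext2_slots(1)[of b _ w] using b part_mem[OF m]
    by (intro covector_sum_pointwise covector_cext1) (auto simp: tensor2_def)
  show "complex_covector A p (\<lambda>z. cext2 b w z)"
    unfolding cext2_slots(2)[of b w] using b part_mem[OF m]
    by (intro covector_sum_pointwise covector_cext1) (auto simp: tensor2_def)
qed

lemma covector_bilinear_sum: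
  assumes B: "\<And>y. y \<in> ctangent_space A p \<Longrightarrow> complex_covector A p (\<lambda>x. B x y)"
    "\<And>x. x \<in> ctangent_space A p \<Longrightarrow> complex_covector A p (\<lambda>y. B x y)"
    and m: "\<And>i. i \<in> I \<Longrightarrow> x i \<in> ctangent_space A p" "\<And>i. i \<in> I \<Longrightarrow> y i \<in> ctangent_space A p"
  shows "B (\<lambda>f. \<Sum>i\<in>I. a i * x i f) (\<lambda>f. \<Sum>k\<in>I. b k * y k f) = (\<Sum>i\<in>I. \<Sum>k\<in>I. a i * b k * B (x i) (y k))"
proof -
  have "B (\<lambda>f. \<Sum>i\<in>I. a i * x i f) (\<lambda>f. \<Sum>k\<in>I. b k * y k f)
      = (\<Sum>i\<in>I. a i * B (x i) (\<lambda>f. \<Sum>k\<in>I. b k * y k f))"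
    using m by (intro covector_sum[OF B(1)] ctangent_space_sum) auto
  also have "\<dots> = (\<Sum>i\<in>I. a i * (\<Sum>k\<in>I. b k * B (x i) (y k)))"
  proof (intro sum.cong refl)
    fix i assume "i \<in> I"
    then show "a i * B (x i) (\<lambda>f. \<Sum>k\<in>I. b k * y k f) = a i * (\<Sum>k\<in>I. b k * B (x i) (y k))"
      using m by (subst covector_sum[OF B(2)]) auto
  qed
  finally show ?thesis by (simp add: sum_distrib_left mult.assoc)
qed

lemma real_vec_parts [simp]: "re_vec (real_vec u) = u" "im_vec (real_vec u) = (\<lambda>f. 0)"
  by (simp_all add: re_vec_def im_vec_def real_vec_def)

lemma cnj_vec_parts: "re_vec (cnj_vec z) = re_vec z" "im_vec (cnj_vec z) = (\<lambda>f. - im_vec z f)"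
  by (simp_all add: re_vec_def im_vec_def cnj_vec_def)

lemma real_vec_mem [simp]: "u \<in> tangent_space A p \<Longrightarrow> real_vec u \<in> ctangent_space A p"
  by (simp add: ctangent_space_def tangent_space_zero)

lemma cnj_vec_mem [simp]: "z \<in> ctangent_space A p \<Longrightarrow> cnj_vec z \<in> ctangent_space A p"
  by (simp add: ctangent_space_def cnj_vec_parts tangent_space_uminus)

lemma cnj_vec_cnj_vec [simp]: "cnj_vec (cnj_vec z) = z"
  by (simp add: cnj_vec_def)

lemma cext2_real:
  assumes "tensor2 A p b" "u \<in> tangent_space A p" "v \<in> tangent_space A p"
  shows "cext2 b (real_vec u) (real_vec v) = complex_of_real (b u v)"
proof -
  have "b u (\<lambda>f. 0) = 0" "b (\<lambda>f. 0) v = 0" "b (\<lambda>f. 0) (\<lambda>f. 0) = 0"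
    using assms tlinear_zero[of A p "\<lambda>x. b u x"] tlinear_zero[of A p "\<lambda>x. b x v"] tlinear_zero[of A p "\<lambda>x. b x (\<lambda>f. 0)"]
    by (auto simp: tensor2_def tangent_space_zero)
  then show ?thesis by (simp add: cext2_def numeral_2_eq_2 part_def)
qed

text \<open>
  The change of the curvature tensor is a product of this form, with factors \<open>dd\<^sup>cf\<close> and \<open>g (J \<cdot>) \<cdot>\<close>.
\<close>

lemma cext4_product:
  "cext4 (\<lambda>x y w t. b x y * c w t) z1 z2 z3 z4 = cext2 b z1 z2 * cext2 c z3 z4"
  unfolding cext4_def cext2_def sum_distrib_right
  unfolding sum_distrib_left
  by (rule sum.cong[OF refl], rule sum.cong[OF refl], rule sum.cong[OF refl], rule sum.cong[OF refl])
    (simp add: power_add mult_ac)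

lemma cext4_comb:
  "cext4 (\<lambda>x y w t. r * (T x y w t + S x y w t)) z1 z2 z3 z4
    = complex_of_real r * (cext4 T z1 z2 z3 z4 + cext4 S z1 z2 z3 z4)"
  by (simp add: cext4_def sum_distrib_left sum.distrib algebra_simps)

lemma cext4_cong:
  assumes "\<And>x y w t. x \<in> tangent_space A p \<Longrightarrow> y \<in> tangent_space A p \<Longrightarrow> w \<in> tangent_space A p \<Longrightarrow>
      t \<in> tangent_space A p \<Longrightarrow> T x y w t = S x y w t"
    and "z1 \<in> ctangent_space A p" "z2 \<in> ctangent_space A p" "z3 \<in> ctangent_space A p" "z4 \<in> ctangent_space A p"
  shows "cext4 T z1 z2 z3 z4 = cext4 S z1 z2 z3 z4"
  using assms by (simp add: cext4_def part_mem)

section \<open>The third Ricci form as a trace over a real frame\<close>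

text \<open>
  The components of a real tangent vector in \<open>T\<^sup>1\<^sup>,\<^sup>0\<close> and \<open>T\<^sup>0\<^sup>,\<^sup>1\<close>.
\<close>

definition proj10 :: "'a endo \<Rightarrow> 'a \<Rightarrow> 'a tvec \<Rightarrow> 'a cvec" where
  "proj10 J p u = (\<lambda>f. (complex_of_real (u f) - \<i> * complex_of_real (J p u f)) / 2)"

definition proj01 :: "'a endo \<Rightarrow> 'a \<Rightarrow> 'a tvec \<Rightarrow> 'a cvec" where
  "proj01 J p u = cnj_vec (proj10 J p u)"

text \<open>
  In place of the contractions \<open>h\<^sup>\<alpha>\<^sup>\<beta> T (x, z\<^sub>\<alpha>, z'\<^sub>\<beta>, w)\<close> and \<open>h\<^sup>\<alpha>\<^sup>\<beta> T (x, z'\<^sub>\<beta>, z\<^sub>\<alpha>, w)\<close> (with \<open>z'\<close> conjugate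
  to \<open>z\<close>), the traces over a real orthonormal frame \<open>e\<close> of \<open>N\<close> vectors.
\<close>

definition trace10 where
  "trace10 N J p e T x w = (\<Sum>i=1..N::nat. cext4 T x (proj10 J p (e i)) (proj01 J p (e i)) w)"

definition trace01 where
  "trace01 N J p e T x w = (\<Sum>i=1..N::nat. cext4 T x (proj01 J p (e i)) (proj10 J p (e i)) w)"

text \<open>
  The third Ricci form of a 4-tensor \<open>T\<close> without complex frames: summing the coefficients against the
  wedge products of the coframes evaluates them on the components of \<open>u\<close> and \<open>v\<close>.
\<close>

definition third_form where
  "third_form N J p e T u v =
     \<i> / 2 * (trace10 N J p e T (proj10 J p v) (proj10 J p u) - trace10 N J p e T (proj10 J p u) (proj10 J p v))
     + \<i> * (trace10 N J p e T (proj01 J p v) (proj10 J p u) - trace10 N J p e T (proj01 J p u) (proj10 J p v))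
     - \<i> / 2 * (trace01 N J p e T (proj01 J p v) (proj01 J p u) - trace01 N J p e T (proj01 J p u) (proj01 J p v))"

lemma covector_sum_fun:
  "(\<And>i. i \<in> I \<Longrightarrow> complex_covector A p (L i)) \<Longrightarrow> complex_covector A p (\<lambda>z. \<Sum>i\<in>I. L i z)"
  using covector_sum_pointwise[of I A p L "\<lambda>i. 1"] by simp

lemma sum_odd_even:
  fixes F :: "nat \<Rightarrow> 'b::comm_monoid_add"
  shows "(\<Sum>i=1..2 * n. F i) = (\<Sum>\<alpha>=1..n. F (2 * \<alpha> - 1) + F (2 * \<alpha>))"
  by (induction n) (simp_all add: add.assoc)

lemma wedge_sum:
  assumes Q: "\<And>y. y \<in> ctangent_space A p \<Longrightarrow> complex_covector A p (\<lambda>x. Q x y)"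
      "\<And>x. x \<in> ctangent_space A p \<Longrightarrow> complex_covector A p (\<lambda>y. Q x y)"
    and m: "\<And>i. i \<in> I \<Longrightarrow> x i \<in> ctangent_space A p" "\<And>i. i \<in> I \<Longrightarrow> y i \<in> ctangent_space A p"
  shows "(\<Sum>\<mu>\<in>I. \<Sum>\<kappa>\<in>I. Q (x \<mu>) (y \<kappa>) * wedge (a \<kappa>) (b \<mu>) u v)
    = Q (\<lambda>f. \<Sum>\<mu>\<in>I. b \<mu> v * x \<mu> f) (\<lambda>f. \<Sum>\<kappa>\<in>I. a \<kappa> u * y \<kappa> f)
      - Q (\<lambda>f. \<Sum>\<mu>\<in>I. b \<mu> u * x \<mu> f) (\<lambda>f. \<Sum>\<kappa>\<in>I. a \<kappa> v * y \<kappa> f)"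
proof -
  have *: "Q (\<lambda>f. \<Sum>\<mu>\<in>I. b \<mu> s * x \<mu> f) (\<lambda>f. \<Sum>\<kappa>\<in>I. a \<kappa> t * y \<kappa> f)
      = (\<Sum>\<mu>\<in>I. \<Sum>\<kappa>\<in>I. b \<mu> s * a \<kappa> t * Q (x \<mu>) (y \<kappa>))" for s t
    by (rule covector_bilinear_sum[OF Q m])
  show ?thesis
    unfolding * sum_subtractf[symmetric] by (simp add: wedge_def algebra_simps)
qed

context hermitian begin

lemma J_tlinear: "tlinear A p (\<lambda>u. J p u h)"
  by (simp add: tlinear_def J_lin)

lemma proj10_parts:
  "re_vec (proj10 J p u) = (\<lambda>f. (1/2) * u f)" "im_vec (proj10 J p u) = (\<lambda>f. (-1/2) * J p u f)"
  "re_vec (proj01 J p u) = (\<lambda>f. (1/2) * u f)" "im_vec (proj01 J p u) = (\<lambda>f. (1/2) * J p u f)"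
  by (simp_all add: re_vec_def im_vec_def proj10_def proj01_def cnj_vec_def)

lemma proj10_mem [simp]:
  assumes u: "u \<in> tangent_space A p"
  shows "proj10 J p u \<in> ctangent_space A p" "proj01 J p u \<in> ctangent_space A p"
proof -
  note scale = tangent_space_smult[OF u] tangent_space_smult[OF J_mem[OF u]]
  show "proj10 J p u \<in> ctangent_space A p" "proj01 J p u \<in> ctangent_space A p"
    unfolding ctangent_space_def mem_Collect_eq proj10_parts by (rule conjI; rule scale)+
qed

lemma proj10_T10: "u \<in> tangent_space A p \<Longrightarrow> proj10 J p u \<in> T10 A J p"
proof -
  assume u: "u \<in> tangent_space A p"
  have "J p (re_vec (proj10 J p u)) = (\<lambda>f. (1/2) * J p u f)"
    "J p (im_vec (proj10 J p u)) = (\<lambda>f. (-1/2) * - u f)"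
    unfolding proj10_parts J_scale[OF u] J_scale[OF J_mem[OF u]] J_J[OF u] by simp_all
  then show ?thesis using u by (simp add: T10_def fun_eq_iff) (simp add: proj10_def complex_eq_iff)
qed

lemma real_vec_split:
  "real_vec u = (\<lambda>f. proj10 J p u f + proj01 J p u f)"
  by (simp add: real_vec_def proj10_def proj01_def cnj_vec_def complex_eq_iff fun_eq_iff)

lemma proj10_J:
  assumes "u \<in> tangent_space A p"
  shows "proj10 J p (J p u) = (\<lambda>f. \<i> * proj10 J p u f)" "proj01 J p (J p u) = (\<lambda>f. - \<i> * proj01 J p u f)"
  using assms by (simp_all add: proj10_def proj01_def cnj_vec_def J_J fun_eq_iff complex_eq_iff)

lemma proj10_sum:
  assumes "\<And>i. i \<in> I \<Longrightarrow> x i \<in> tangent_space A p"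
  shows "proj10 J p (\<lambda>f. \<Sum>i\<in>I. c i * x i f) = (\<lambda>f. \<Sum>i\<in>I. complex_of_real (c i) * proj10 J p (x i) f)"
    "proj01 J p (\<lambda>f. \<Sum>i\<in>I. c i * x i f) = (\<lambda>f. \<Sum>i\<in>I. complex_of_real (c i) * proj01 J p (x i) f)"
proof -
  show 1: "proj10 J p (\<lambda>f. \<Sum>i\<in>I. c i * x i f) = (\<lambda>f. \<Sum>i\<in>I. complex_of_real (c i) * proj10 J p (x i) f)"
  proof
    fix f
    have *: "complex_of_real (c i) * proj10 J p (x i) f = (1/2) * complex_of_real (c i * x i f)
        - (\<i>/2) * complex_of_real (c i * J p (x i) f)" for i
      by (simp add: proj10_def field_simps)
    have J: "J p (\<lambda>f. \<Sum>i\<in>I. c i * x i f) f = (\<Sum>i\<in>I. c i * J p (x i) f)"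
      by (rule tlinear_sum[OF J_tlinear assms])
    from * have "(\<Sum>i\<in>I. complex_of_real (c i) * proj10 J p (x i) f)
        = (1/2) * complex_of_real (\<Sum>i\<in>I. c i * x i f) - (\<i>/2) * complex_of_real (\<Sum>i\<in>I. c i * J p (x i) f)"
      by (simp only: sum_subtractf sum_distrib_left[symmetric] of_real_sum[symmetric])
    then show "proj10 J p (\<lambda>f. \<Sum>i\<in>I. c i * x i f) f = (\<Sum>i\<in>I. complex_of_real (c i) * proj10 J p (x i) f)"
      using J by (simp add: proj10_def[of J p "\<lambda>f. \<Sum>i\<in>I. c i * x i f"] diff_divide_distrib)
  qed
  show "proj01 J p (\<lambda>f. \<Sum>i\<in>I. c i * x i f) = (\<lambda>f. \<Sum>i\<in>I. complex_of_real (c i) * proj01 J p (x i) f)"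
    unfolding proj01_def 1 by (simp add: cnj_vec_def)
qed

lemma g_tensor2: "tensor2 A p (g p)"
  by (simp add: tensor2_def g_tlinear1 g_tlinear2)

lemma g_zero: "u \<in> tangent_space A p \<Longrightarrow> g p u (\<lambda>f. 0) = 0" "u \<in> tangent_space A p \<Longrightarrow> g p (\<lambda>f. 0) u = 0"
  using tlinear_zero[OF g_tlinear1] tlinear_zero[OF g_tlinear2] by auto

lemma cext2_g_expand:
  "cext2 (g p) z w = complex_of_real (g p (re_vec z) (re_vec w)) - complex_of_real (g p (im_vec z) (im_vec w))
    + \<i> * (complex_of_real (g p (re_vec z) (im_vec w)) + complex_of_real (g p (im_vec z) (re_vec w)))"
  by (simp add: cext2_def numeral_2_eq_2 part_def algebra_simps)

lemma cext2_g_sym: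
  assumes "z \<in> ctangent_space A p" "w \<in> ctangent_space A p"
  shows "cext2 (g p) z w = cext2 (g p) w z"
  using assms by (simp add: cext2_g_expand ctangent_space_def g_sym[of "re_vec z"] g_sym[of "im_vec z"])

lemma T10_mem: "z \<in> T10 A J p \<Longrightarrow> z \<in> ctangent_space A p"
  by (simp add: T10_def)

text \<open>
  Vectors of type (1,0) have the form \<open>x - \<i> J x\<close> with \<open>x\<close> real.
\<close>

lemma T10_im:
  assumes "z \<in> T10 A J p"
  shows "im_vec z = (\<lambda>f. - J p (re_vec z) f)"
proof
  fix f
  have "Complex (J p (re_vec z) f) (J p (im_vec z) f) = \<i> * z f"
    using assms by (auto simp: T10_def dest: fun_cong)
  then have "J p (re_vec z) f = Re (\<i> * z f)" by (metis complex.sel(1))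
  then show "im_vec z f = - J p (re_vec z) f" by (simp add: im_vec_def)
qed

lemma g_T10_isotropic:
  assumes "z \<in> T10 A J p" "w \<in> T10 A J p"
  shows "cext2 (g p) z w = 0" "cext2 (g p) (cnj_vec z) (cnj_vec w) = 0"
proof -
  have m: "re_vec z \<in> tangent_space A p" "re_vec w \<in> tangent_space A p"
    using assms[THEN T10_mem] by (simp_all add: ctangent_space_def)
  show "cext2 (g p) z w = 0" "cext2 (g p) (cnj_vec z) (cnj_vec w) = 0"
    using m by (simp_all add: J_uminus J_J cext2_g_expand T10_im[OF assms(1)] T10_im[OF assms(2)]
        g_uminus tangent_space_uminus g_J_J g_J_left cnj_vec_parts)
qed

context
  fixes p :: 'a and e :: "nat \<Rightarrow> 'a tvec"
  assumes e: "adapted_frame A J g p e"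
begin

lemma real_vec_apply: "real_vec u f = complex_of_real (u f)"
  by (simp add: real_vec_def)

text \<open>
  A real orthonormal frame is also orthonormal for the complex bilinear extension of the metric.
\<close>

lemma complex_frame_expansion:
  assumes z: "z \<in> ctangent_space A p"
  shows "z = (\<lambda>f. \<Sum>i=1..DIM('e). cext2 (g p) z (real_vec (e i)) * real_vec (e i) f)"
proof
  fix f
  have m: "re_vec z \<in> tangent_space A p" "im_vec z \<in> tangent_space A p"
    using z by (auto simp: ctangent_space_def)
  have "z f = complex_of_real (re_vec z f) + \<i> * complex_of_real (im_vec z f)"
    by (simp add: complex_eq_iff re_vec_def im_vec_def)
  also have "\<dots> = complex_of_real (\<Sum>i=1..DIM('e). g p (re_vec z) (e i) * e i f)
      + \<i> * complex_of_real (\<Sum>i=1..DIM('e). g p (im_vec z) (e i) * e i f)"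
    using fun_cong[OF frame_expansion[OF e m(1)], of f] fun_cong[OF frame_expansion[OF e m(2)], of f] by simp
  also have "\<dots> = (\<Sum>i=1..DIM('e). cext2 (g p) z (real_vec (e i)) * real_vec (e i) f)"
    by (simp add: cext2_g_expand g_zero m frame_mem[OF e] real_vec_apply sum.distrib sum_distrib_left algebra_simps)
  finally show "z f = (\<Sum>i=1..DIM('e). cext2 (g p) z (real_vec (e i)) * real_vec (e i) f)" .
qed

lemma covector_frame:
  assumes "complex_covector A p L" "z \<in> ctangent_space A p"
  shows "L z = (\<Sum>i=1..DIM('e). cext2 (g p) z (real_vec (e i)) * L (real_vec (e i)))"
  by (subst complex_frame_expansion[OF assms(2)], rule covector_sum[OF assms(1)])
    (simp add: frame_mem[OF e])

lemma covector_proj10_frame: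
  assumes L: "complex_covector A p L" and u: "u \<in> tangent_space A p"
  shows "L (proj10 J p u) = (\<Sum>i=1..DIM('e). complex_of_real (g p u (e i)) * L (proj10 J p (e i)))"
    "L (proj01 J p u) = (\<Sum>i=1..DIM('e). complex_of_real (g p u (e i)) * L (proj01 J p (e i)))"
  by (subst frame_expansion[OF e u], subst proj10_sum, rule frame_mem[OF e], assumption,
      rule covector_sum[OF L], simp add: frame_mem[OF e])+

context
  fixes z :: "nat \<Rightarrow> 'a cvec" and \<zeta> \<eta> :: "nat \<Rightarrow> 'a covec" and H :: "nat \<Rightarrow> nat \<Rightarrow> complex"
  assumes z: "complex_frame A J p z" and dual: "dual_coframes A p z \<zeta> \<eta>"
    and H: "inverse_metric A g p z H"
begin

lemma z_T10: "\<alpha> \<in> {1..DIM('e) div 2} \<Longrightarrow> z \<alpha> \<in> T10 A J p"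
  using z by (simp add: complex_frame_def)

lemma z_mem: "\<alpha> \<in> {1..DIM('e) div 2} \<Longrightarrow> z \<alpha> \<in> ctangent_space A p"
  and zb_mem: "\<alpha> \<in> {1..DIM('e) div 2} \<Longrightarrow> cnj_vec (z \<alpha>) \<in> ctangent_space A p"
  using T10_mem[OF z_T10] by simp_all

lemma \<zeta>_covector: "\<alpha> \<in> {1..DIM('e) div 2} \<Longrightarrow> complex_covector A p (\<zeta> \<alpha>)"
  and \<eta>_covector: "\<alpha> \<in> {1..DIM('e) div 2} \<Longrightarrow> complex_covector A p (\<eta> \<alpha>)"
  and \<zeta>_z: "\<alpha> \<in> {1..DIM('e) div 2} \<Longrightarrow> \<beta> \<in> {1..DIM('e) div 2} \<Longrightarrow> \<zeta> \<alpha> (z \<beta>) = (if \<alpha> = \<beta> then 1 else 0)"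
  and \<zeta>_zb: "\<alpha> \<in> {1..DIM('e) div 2} \<Longrightarrow> \<beta> \<in> {1..DIM('e) div 2} \<Longrightarrow> \<zeta> \<alpha> (cnj_vec (z \<beta>)) = 0"
  and \<eta>_z: "\<alpha> \<in> {1..DIM('e) div 2} \<Longrightarrow> \<beta> \<in> {1..DIM('e) div 2} \<Longrightarrow> \<eta> \<alpha> (z \<beta>) = 0"
  and \<eta>_zb: "\<alpha> \<in> {1..DIM('e) div 2} \<Longrightarrow> \<beta> \<in> {1..DIM('e) div 2} \<Longrightarrow> \<eta> \<alpha> (cnj_vec (z \<beta>)) = (if \<alpha> = \<beta> then 1 else 0)"
  using dual unfolding dual_coframes_def by blast+

text \<open>
  The coefficients of the (1,0)-component in the frame are read off by the coframe \<open>\<zeta>\<close>, which kills the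
  (0,1)-component. Both expansions come from one, as the (0,1)-component is the conjugate.
\<close>

lemma proj10_expansion:
  assumes u: "u \<in> tangent_space A p"
  shows "proj10 J p u = (\<lambda>f. \<Sum>\<alpha>\<in>{1..DIM('e) div 2}. \<zeta> \<alpha> (real_vec u) * z \<alpha> f)"
    "proj01 J p u = (\<lambda>f. \<Sum>\<alpha>\<in>{1..DIM('e) div 2}. \<eta> \<alpha> (real_vec u) * cnj_vec (z \<alpha>) f)"
proof -
  obtain c where c: "proj10 J p u = (\<lambda>f. \<Sum>\<alpha>\<in>{1..DIM('e) div 2}. c \<alpha> * z \<alpha> f)"
    using z[unfolded complex_frame_def, THEN conjunct2, THEN conjunct1] proj10_T10[OF u] by blast
  have cb: "proj01 J p u = (\<lambda>f. \<Sum>\<alpha>\<in>{1..DIM('e) div 2}. cnj (c \<alpha>) * cnj_vec (z \<alpha>) f)"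
    by (simp add: proj01_def c cnj_vec_def)
  have L: "L (real_vec u) = (\<Sum>\<alpha>\<in>{1..DIM('e) div 2}. c \<alpha> * L (z \<alpha>))
      + (\<Sum>\<alpha>\<in>{1..DIM('e) div 2}. cnj (c \<alpha>) * L (cnj_vec (z \<alpha>)))" if L: "complex_covector A p L" for L
  proof -
    have "L (real_vec u) = L (proj10 J p u) + L (proj01 J p u)"
      by (subst real_vec_split[of _ p], rule covector_add[OF L]) (use u in auto)
    then show ?thesis
      unfolding c cb by (simp only: covector_sum[OF L z_mem] covector_sum[OF L zb_mem])
  qed
  have "\<zeta> \<beta> (real_vec u) = c \<beta>" "\<eta> \<beta> (real_vec u) = cnj (c \<beta>)" if \<beta>: "\<beta> \<in> {1..DIM('e) div 2}" for \<beta>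
  proof -
    have "\<zeta> \<beta> (real_vec u) = (\<Sum>\<alpha>\<in>{1..DIM('e) div 2}. if \<alpha> = \<beta> then c \<alpha> else 0) + (\<Sum>\<alpha>\<in>{1..DIM('e) div 2}. 0)"
      unfolding L[OF \<zeta>_covector[OF \<beta>]]
      by (intro arg_cong2[where f = plus] sum.cong refl; simp only: \<zeta>_z[OF \<beta>] \<zeta>_zb[OF \<beta>]; simp)
    then show "\<zeta> \<beta> (real_vec u) = c \<beta>" using \<beta> by simp
    have "\<eta> \<beta> (real_vec u) = (\<Sum>\<alpha>\<in>{1..DIM('e) div 2}. 0) + (\<Sum>\<alpha>\<in>{1..DIM('e) div 2}. if \<alpha> = \<beta> then cnj (c \<alpha>) else 0)"
      unfolding L[OF \<eta>_covector[OF \<beta>]]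
      by (intro arg_cong2[where f = plus] sum.cong refl; simp only: \<eta>_z[OF \<beta>] \<eta>_zb[OF \<beta>]; simp)
    then show "\<eta> \<beta> (real_vec u) = cnj (c \<beta>)" using \<beta> by simp
  qed
  then show "proj10 J p u = (\<lambda>f. \<Sum>\<alpha>\<in>{1..DIM('e) div 2}. \<zeta> \<alpha> (real_vec u) * z \<alpha> f)"
    "proj01 J p u = (\<lambda>f. \<Sum>\<alpha>\<in>{1..DIM('e) div 2}. \<eta> \<alpha> (real_vec u) * cnj_vec (z \<alpha>) f)"
    unfolding c cb by (intro ext sum.cong refl; simp)+
qed

text \<open>
  An explicit formula for the inverse metric \<open>h\<^sup>\<alpha>\<^sup>\<beta>\<close>, as the contraction of the coframes over a real
  orthonormal frame.
\<close>

definition coframe_gram :: "nat \<Rightarrow> nat \<Rightarrow> complex" where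
  "coframe_gram \<alpha> \<beta> = (\<Sum>i=1..DIM('e). \<zeta> \<alpha> (real_vec (e i)) * \<eta> \<beta> (real_vec (e i)))"

text \<open>
  The (0,1)-component of a real vector pairs to zero with a conjugate frame vector, since \<open>T\<^sup>0\<^sup>,\<^sup>1\<close> is
  isotropic. So the sum over the complex frame restores the full vector, and the sum over the real
  frame is the expansion of the conjugate frame vector, on which \<open>\<eta> \<beta>\<close> is evaluated.
\<close>

lemma coframe_gram_left_inverse:
  assumes \<beta>: "\<beta> \<in> {1..DIM('e) div 2}" and \<delta>: "\<delta> \<in> {1..DIM('e) div 2}"
  shows "(\<Sum>\<gamma>\<in>{1..DIM('e) div 2}. coframe_gram \<gamma> \<beta> * cext2 (g p) (z \<gamma>) (cnj_vec (z \<delta>))) = (if \<beta> = \<delta> then 1 else 0)"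
proof -
  note cov = covector_cext2[OF g_tensor2 zb_mem[OF \<delta>]]
  have *: "(\<Sum>\<gamma>\<in>{1..DIM('e) div 2}. \<zeta> \<gamma> (real_vec u) * cext2 (g p) (z \<gamma>) (cnj_vec (z \<delta>)))
      = cext2 (g p) (cnj_vec (z \<delta>)) (real_vec u)" if u: "u \<in> tangent_space A p" for u
  proof -
    have "cext2 (g p) (cnj_vec (z \<delta>)) (real_vec u) = cext2 (g p) (real_vec u) (cnj_vec (z \<delta>))"
      using u zb_mem[OF \<delta>] by (simp add: cext2_g_sym)
    also have "\<dots> = cext2 (g p) (proj10 J p u) (cnj_vec (z \<delta>)) + cext2 (g p) (proj01 J p u) (cnj_vec (z \<delta>))"
      by (subst real_vec_split[of _ p], rule covector_add[OF cov(1)]) (use u in auto)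
    also have "\<dots> = cext2 (g p) (proj10 J p u) (cnj_vec (z \<delta>))"
      using g_T10_isotropic(2)[OF proj10_T10[OF u] z_T10[OF \<delta>]] by (simp add: proj01_def)
    also have "\<dots> = (\<Sum>\<gamma>\<in>{1..DIM('e) div 2}. \<zeta> \<gamma> (real_vec u) * cext2 (g p) (z \<gamma>) (cnj_vec (z \<delta>)))"
      unfolding proj10_expansion(1)[OF u] by (rule covector_sum[OF cov(1) z_mem])
    finally show ?thesis by simp
  qed
  have "(\<Sum>\<gamma>\<in>{1..DIM('e) div 2}. coframe_gram \<gamma> \<beta> * cext2 (g p) (z \<gamma>) (cnj_vec (z \<delta>)))
      = (\<Sum>i=1..DIM('e). \<eta> \<beta> (real_vec (e i)) *
          (\<Sum>\<gamma>\<in>{1..DIM('e) div 2}. \<zeta> \<gamma> (real_vec (e i)) * cext2 (g p) (z \<gamma>) (cnj_vec (z \<delta>))))"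
    unfolding coframe_gram_def sum_distrib_right sum_distrib_left by (subst sum.swap) (simp add: mult_ac)
  also have "\<dots> = (\<Sum>i=1..DIM('e). cext2 (g p) (cnj_vec (z \<delta>)) (real_vec (e i)) * \<eta> \<beta> (real_vec (e i)))"
    by (intro sum.cong refl) (subst *, rule frame_mem[OF e], assumption, rule mult.commute)
  also have "\<dots> = \<eta> \<beta> (cnj_vec (z \<delta>))"
    by (rule covector_frame[OF \<eta>_covector[OF \<beta>] zb_mem[OF \<delta>], symmetric])
  finally show ?thesis using \<eta>_zb[OF \<beta> \<delta>] by simp
qed

text \<open>
  \<open>H\<close> inverts the metric from one side and \<open>coframe_gram\<close> from the other.
\<close>

lemma inverse_metric_eq:
  assumes \<alpha>: "\<alpha> \<in> {1..DIM('e) div 2}" and \<beta>: "\<beta> \<in> {1..DIM('e) div 2}"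
  shows "H \<alpha> \<beta> = coframe_gram \<alpha> \<beta>"
proof -
  let ?h = "\<lambda>\<gamma> \<delta>. cext2 (g p) (z \<gamma>) (cnj_vec (z \<delta>))"
  have "H \<alpha> \<beta> = (\<Sum>\<delta>\<in>{1..DIM('e) div 2}. if \<beta> = \<delta> then H \<alpha> \<delta> else 0)" using \<beta> by simp
  also have "\<dots> = (\<Sum>\<delta>\<in>{1..DIM('e) div 2}. H \<alpha> \<delta> * (\<Sum>\<gamma>\<in>{1..DIM('e) div 2}. coframe_gram \<gamma> \<beta> * ?h \<gamma> \<delta>))"
    by (intro sum.cong refl) (subst coframe_gram_left_inverse[OF \<beta>], simp_all)
  also have "\<dots> = (\<Sum>\<gamma>\<in>{1..DIM('e) div 2}. coframe_gram \<gamma> \<beta> * (\<Sum>\<delta>\<in>{1..DIM('e) div 2}. ?h \<gamma> \<delta> * H \<alpha> \<delta>))"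
    unfolding sum_distrib_left by (subst sum.swap) (simp add: mult_ac)
  also have "\<dots> = (\<Sum>\<gamma>\<in>{1..DIM('e) div 2}. if \<gamma> = \<alpha> then coframe_gram \<gamma> \<beta> else 0)"
  proof (intro sum.cong refl)
    fix \<gamma> assume \<gamma>: "\<gamma> \<in> {1..DIM('e) div 2}"
    have "(\<Sum>\<delta>\<in>{1..DIM('e) div 2}. ?h \<gamma> \<delta> * H \<alpha> \<delta>) = (if \<gamma> = \<alpha> then 1 else 0)"
      using H[unfolded inverse_metric_def] \<gamma> \<alpha> by blast
    then show "coframe_gram \<gamma> \<beta> * (\<Sum>\<delta>\<in>{1..DIM('e) div 2}. ?h \<gamma> \<delta> * H \<alpha> \<delta>) = (if \<gamma> = \<alpha> then coframe_gram \<gamma> \<beta> else 0)" by simp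
  qed
  also have "\<dots> = coframe_gram \<alpha> \<beta>" using \<alpha> by simp
  finally show ?thesis .
qed

text \<open>
  Substituting \<open>coframe_gram\<close> for \<open>H\<close> and summing over the complex frame first reassembles the two components
  of each \<open>e i\<close>.
\<close>

lemma hermitian_trace:
  assumes B: "\<And>y. y \<in> ctangent_space A p \<Longrightarrow> complex_covector A p (\<lambda>x. B x y)"
      "\<And>x. x \<in> ctangent_space A p \<Longrightarrow> complex_covector A p (\<lambda>y. B x y)"
  shows "(\<Sum>\<alpha>\<in>{1..DIM('e) div 2}. \<Sum>\<beta>\<in>{1..DIM('e) div 2}. H \<alpha> \<beta> * B (z \<alpha>) (cnj_vec (z \<beta>)))
    = (\<Sum>i=1..DIM('e). B (proj10 J p (e i)) (proj01 J p (e i)))"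
proof -
  have "(\<Sum>i=1..DIM('e). B (proj10 J p (e i)) (proj01 J p (e i)))
      = (\<Sum>i=1..DIM('e). \<Sum>\<alpha>\<in>{1..DIM('e) div 2}. \<Sum>\<beta>\<in>{1..DIM('e) div 2}. \<zeta> \<alpha> (real_vec (e i)) * \<eta> \<beta> (real_vec (e i)) * B (z \<alpha>) (cnj_vec (z \<beta>)))"
  proof (intro sum.cong refl)
    fix i assume "i \<in> {1..DIM('e)}"
    then have ei: "e i \<in> tangent_space A p" by (rule frame_mem[OF e])
    show "B (proj10 J p (e i)) (proj01 J p (e i))
      = (\<Sum>\<alpha>\<in>{1..DIM('e) div 2}. \<Sum>\<beta>\<in>{1..DIM('e) div 2}. \<zeta> \<alpha> (real_vec (e i)) * \<eta> \<beta> (real_vec (e i)) * B (z \<alpha>) (cnj_vec (z \<beta>)))"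
      unfolding proj10_expansion[OF ei]
      by (rule covector_bilinear_sum[OF B z_mem zb_mem])
  qed
  also have "\<dots> = (\<Sum>\<alpha>\<in>{1..DIM('e) div 2}. \<Sum>\<beta>\<in>{1..DIM('e) div 2}. coframe_gram \<alpha> \<beta> * B (z \<alpha>) (cnj_vec (z \<beta>)))"
    unfolding coframe_gram_def sum_distrib_right
    by (rule trans[OF sum.swap], rule sum.cong[OF refl], rule sum.swap)
  also have "\<dots> = (\<Sum>\<alpha>\<in>{1..DIM('e) div 2}. \<Sum>\<beta>\<in>{1..DIM('e) div 2}. H \<alpha> \<beta> * B (z \<alpha>) (cnj_vec (z \<beta>)))"
    by (intro sum.cong refl) (subst inverse_metric_eq, assumption+, rule refl)
  finally show ?thesis by simp
qed

lemma third_form_eq: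
  assumes T: "tensor4 A p T" and uv: "u \<in> tangent_space A p" "v \<in> tangent_space A p"
  defines "zb \<equiv> \<lambda>\<alpha>. cnj_vec (z \<alpha>)" and "R \<equiv> cext4 T"
  shows "(\<i> / 2) * (\<Sum>\<mu>\<in>{1..DIM('e) div 2}. \<Sum>\<kappa>\<in>{1..DIM('e) div 2}.
            (\<Sum>\<alpha>\<in>{1..DIM('e) div 2}. \<Sum>\<beta>\<in>{1..DIM('e) div 2}. H \<alpha> \<beta> * R (z \<mu>) (z \<alpha>) (zb \<beta>) (z \<kappa>)) *
            wedge (\<zeta> \<kappa>) (\<zeta> \<mu>) (real_vec u) (real_vec v))
       + \<i> * (\<Sum>\<mu>\<in>{1..DIM('e) div 2}. \<Sum>\<kappa>\<in>{1..DIM('e) div 2}.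
            (\<Sum>\<alpha>\<in>{1..DIM('e) div 2}. \<Sum>\<beta>\<in>{1..DIM('e) div 2}. H \<alpha> \<beta> * R (zb \<mu>) (z \<alpha>) (zb \<beta>) (z \<kappa>)) *
            wedge (\<zeta> \<kappa>) (\<eta> \<mu>) (real_vec u) (real_vec v))
       - (\<i> / 2) * (\<Sum>\<mu>\<in>{1..DIM('e) div 2}. \<Sum>\<kappa>\<in>{1..DIM('e) div 2}.
            (\<Sum>\<alpha>\<in>{1..DIM('e) div 2}. \<Sum>\<beta>\<in>{1..DIM('e) div 2}. H \<alpha> \<beta> * R (zb \<mu>) (zb \<beta>) (z \<alpha>) (zb \<kappa>)) *
            wedge (\<eta> \<kappa>) (\<eta> \<mu>) (real_vec u) (real_vec v))
    = third_form DIM('e) J p e T u v"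
proof -
  let ?N = "DIM('e)"
  note cov = covector_cext4[OF T]
  have em: "proj10 J p (e i) \<in> ctangent_space A p" "proj01 J p (e i) \<in> ctangent_space A p" if "i \<in> {1..?N}" for i
    using frame_mem[OF e that] by simp_all
  have t10: "(\<Sum>\<alpha>\<in>{1..DIM('e) div 2}. \<Sum>\<beta>\<in>{1..DIM('e) div 2}. H \<alpha> \<beta> * R x (z \<alpha>) (cnj_vec (z \<beta>)) w) = trace10 ?N J p e T x w"
    if "x \<in> ctangent_space A p" "w \<in> ctangent_space A p" for x w
    unfolding trace10_def R_def
    by (rule hermitian_trace[where B = "\<lambda>y y'. cext4 T x y y' w"]) (use cov that in auto)
  have t01: "(\<Sum>\<alpha>\<in>{1..DIM('e) div 2}. \<Sum>\<beta>\<in>{1..DIM('e) div 2}. H \<alpha> \<beta> * R x (cnj_vec (z \<beta>)) (z \<alpha>) w) = trace01 ?N J p e T x w"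
    if "x \<in> ctangent_space A p" "w \<in> ctangent_space A p" for x w
    unfolding trace01_def R_def
    by (rule hermitian_trace[where B = "\<lambda>y y'. cext4 T x y' y w"]) (use cov that in auto)
  have c10: "complex_covector A p (\<lambda>x. trace10 ?N J p e T x w)" "complex_covector A p (\<lambda>x. trace10 ?N J p e T w x)"
    if "w \<in> ctangent_space A p" for w
    unfolding trace10_def using that em by (auto intro!: covector_sum_fun cov)
  have c01: "complex_covector A p (\<lambda>x. trace01 ?N J p e T x w)" "complex_covector A p (\<lambda>x. trace01 ?N J p e T w x)"
    if "w \<in> ctangent_space A p" for w
    unfolding trace01_def using that em by (auto intro!: covector_sum_fun cov)
  note ex = proj10_expansion[OF uv(1)] proj10_expansion[OF uv(2)]
  (* Each of the three summands is an instance of wedge_sum for the bilinear form trace10 or trace01. *)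
  note cong = sum.cong[OF refl] arg_cong2[where f = times, OF _ refl]
  show ?thesis
    unfolding third_form_def zb_def ex
    by (intro arg_cong2[where f = minus] arg_cong2[where f = plus] arg_cong2[where f = times] refl;
        rule trans[OF _ wedge_sum[OF c10 z_mem z_mem]] trans[OF _ wedge_sum[OF c10 zb_mem z_mem]]
          trans[OF _ wedge_sum[OF c01 zb_mem zb_mem]];
        (intro cong t10 t01 z_mem zb_mem)?; assumption?)
qed

end
end
end

context hermitian begin

text \<open>
  On the (0,1)-component \<open>J\<close> acts as \<open>- \<i>\<close>, on the (1,0)-component as \<open>\<i>\<close>. The remaining factor is one half of
  the Hermitian product of \<open>w\<close> and \<open>u\<close>, or of its conjugate.
\<close>

lemma cext2_g_proj:
  assumes u: "u \<in> tangent_space A p" and w: "w \<in> tangent_space A p"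
  shows "cext2 (\<lambda>x y. g p (J p x) y) (proj01 J p u) (proj10 J p w)
      = - \<i> / 2 * (complex_of_real (g p w u) - \<i> * complex_of_real (g p (J p w) u))" (is "?L1 = ?R1")
    "cext2 (\<lambda>x y. g p (J p x) y) (proj10 J p u) (proj01 J p w)
      = \<i> / 2 * (complex_of_real (g p w u) + \<i> * complex_of_real (g p (J p w) u))" (is "?L2 = ?R2")
proof -
  have JJ: "g p (J p (J p x)) y = - g p x y" "g p x (J p (J p y)) = - g p x y"
    if "x \<in> tangent_space A p" "y \<in> tangent_space A p" for x y
    using that by (simp_all add: J_J g_uminus)
  note P = proj10_parts
  have e: "cext2 (\<lambda>x y. g p (J p x) y) z z' = complex_of_real (g p (J p (re_vec z)) (re_vec z'))
      - complex_of_real (g p (J p (im_vec z)) (im_vec z'))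
    + \<i> * (complex_of_real (g p (J p (re_vec z)) (im_vec z')) + complex_of_real (g p (J p (im_vec z)) (re_vec z')))" for z z'
    by (simp add: cext2_def numeral_2_eq_2 part_def algebra_simps)
  have gs: "g p u w = g p w u" "g p (J p w) u = g p u (J p w)"
    using u w g_sym[of w p u] g_sym[of "J p w" p u] by simp_all
  show "?L1 = ?R1"
    "?L2 = ?R2"
    unfolding e P
    using u w gs
    by (simp_all only: J_scale J_mem g_scale tangent_space_smult JJ g_J_J g_J_left)
      (simp_all add: complex_eq_iff field_simps)
qed

text \<open>
  With an adapted frame \<open>a\<^sub>1, b\<^sub>1 = J a\<^sub>1, a\<^sub>2, \<dots>\<close> take \<open>z\<^sub>\<alpha> = a\<^sub>\<alpha> - \<i> b\<^sub>\<alpha>\<close>. These are pairwise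
  Hermitian orthogonal with \<open>h = 2\<close> on the diagonal, which explains the factors one half in the
  coframes and in the inverse metric.
\<close>

lemma adapted_tuple_exists:
  assumes e: "adapted_frame A J g p e" and n: "DIM('e) = 2 * n"
  shows "\<exists>z \<zeta> \<eta> H. complex_frame A J p z \<and> dual_coframes A p z \<zeta> \<eta> \<and> inverse_metric A g p z H"
proof -
  let ?I = "{1..n}"
  have n2: "DIM('e) div 2 = n" using n by simp
  define a where "a = (\<lambda>\<alpha>. e (2 * \<alpha> - 1))"
  define b where "b = (\<lambda>\<alpha>. e (2 * \<alpha>))"
  have i: "2 * \<alpha> - 1 \<in> {1..DIM('e)}" "2 * \<alpha> \<in> {1..DIM('e)}" if "\<alpha> \<in> ?I" for \<alpha>
    using that n by auto
  have m: "a \<alpha> \<in> tangent_space A p" "b \<alpha> \<in> tangent_space A p" if "\<alpha> \<in> ?I" for \<alpha>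
    unfolding a_def b_def using i[OF that] by (simp_all only: frame_mem[OF e])
  have Ja: "J p (a \<alpha>) = b \<alpha>" if "\<alpha> \<in> ?I" for \<alpha>
    unfolding a_def b_def using frame_J[OF e, of \<alpha>] that n2 by simp
  have Jb: "J p (b \<alpha>) = (\<lambda>f. - a \<alpha> f)" if "\<alpha> \<in> ?I" for \<alpha>
    using Ja[OF that] J_J[OF m(1)[OF that]] by simp
  have neq: "2 * \<alpha> - 1 \<noteq> 2 * \<beta>" if "\<alpha> \<in> ?I" for \<alpha> \<beta> :: nat
  proof -
    have "\<alpha> \<ge> 1" using that by simp
    then show ?thesis by presburger
  qed
  have gab: "g p (a \<alpha>) (a \<beta>) = (if \<alpha> = \<beta> then 1 else 0)" "g p (b \<alpha>) (b \<beta>) = (if \<alpha> = \<beta> then 1 else 0)"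
    "g p (a \<alpha>) (b \<beta>) = 0" "g p (b \<alpha>) (a \<beta>) = 0" if "\<alpha> \<in> ?I" "\<beta> \<in> ?I" for \<alpha> \<beta>
  proof -
    have "2 * \<alpha> - 1 = 2 * \<beta> - 1 \<longleftrightarrow> \<alpha> = \<beta>" using that by auto
    then show "g p (a \<alpha>) (a \<beta>) = (if \<alpha> = \<beta> then 1 else 0)"
      unfolding a_def by (simp only: frame_orthonormal[OF e i(1)[OF that(1)] i(1)[OF that(2)]])
    show "g p (b \<alpha>) (b \<beta>) = (if \<alpha> = \<beta> then 1 else 0)"
      unfolding b_def by (simp only: frame_orthonormal[OF e i(2)[OF that(1)] i(2)[OF that(2)]]) simp
    show "g p (a \<alpha>) (b \<beta>) = 0"
      unfolding a_def b_def using neq[OF that(1)]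
      by (simp only: frame_orthonormal[OF e i(1)[OF that(1)] i(2)[OF that(2)]] if_False)
    show "g p (b \<alpha>) (a \<beta>) = 0"
      unfolding a_def b_def using neq[OF that(2), of \<alpha>, symmetric]
      by (simp only: frame_orthonormal[OF e i(2)[OF that(1)] i(1)[OF that(2)]] if_False)
  qed
  define z where "z = (\<lambda>\<alpha> f. complex_of_real (a \<alpha> f) - \<i> * complex_of_real (b \<alpha> f))"
  define \<zeta> where "\<zeta> = (\<lambda>\<alpha> w. (1/2) * cext2 (g p) w (real_vec (a \<alpha>)) + (\<i>/2) * cext2 (g p) w (real_vec (b \<alpha>)))"
  define \<eta> where "\<eta> = (\<lambda>\<alpha> w. (1/2) * cext2 (g p) w (real_vec (a \<alpha>)) + (- \<i>/2) * cext2 (g p) w (real_vec (b \<alpha>)))"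
  define H where "H = (\<lambda>\<alpha> \<beta> :: nat. if \<alpha> = \<beta> then 1/2 else 0 :: complex)"
  have zp: "re_vec (z \<alpha>) = a \<alpha>" "im_vec (z \<alpha>) = (\<lambda>f. - b \<alpha> f)" for \<alpha>
    by (simp_all add: z_def re_vec_def im_vec_def)
  have zm: "z \<alpha> \<in> ctangent_space A p" if "\<alpha> \<in> ?I" for \<alpha>
    using m[OF that] by (simp add: ctangent_space_def zp tangent_space_uminus)
  have zT: "z \<alpha> \<in> T10 A J p" if "\<alpha> \<in> ?I" for \<alpha>
    using zm[OF that] m[OF that] by (simp add: T10_def zp Ja[OF that] Jb[OF that] J_uminus) (simp add: z_def complex_eq_iff fun_eq_iff)
  have cov: "complex_covector A p (\<zeta> \<alpha>)" "complex_covector A p (\<eta> \<alpha>)" if "\<alpha> \<in> ?I" for \<alpha>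
  proof -
    have c: "complex_covector A p (\<lambda>w. c * cext2 (g p) w (real_vec (a \<alpha>)) + d * cext2 (g p) w (real_vec (b \<alpha>)))" for c d
      using covector_cext2(1)[OF g_tensor2 real_vec_mem[OF m(1)[OF that]]]
        covector_cext2(1)[OF g_tensor2 real_vec_mem[OF m(2)[OF that]]]
      by (simp add: complex_covector_def algebra_simps)
    show "complex_covector A p (\<zeta> \<alpha>)" "complex_covector A p (\<eta> \<alpha>)" unfolding \<zeta>_def \<eta>_def by (rule c)+
  qed
  have dual: "\<zeta> \<alpha> (z \<beta>) = (if \<alpha> = \<beta> then 1 else 0)" "\<zeta> \<alpha> (cnj_vec (z \<beta>)) = 0"
     "\<eta> \<alpha> (z \<beta>) = 0" "\<eta> \<alpha> (cnj_vec (z \<beta>)) = (if \<alpha> = \<beta> then 1 else 0)" if "\<alpha> \<in> ?I" "\<beta> \<in> ?I" for \<alpha> \<beta>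
    using m[OF that(1)] m[OF that(2)] gab[OF that(2,1)]
    by (simp_all add: \<zeta>_def \<eta>_def cext2_g_expand zp cnj_vec_parts g_uminus g_zero tangent_space_uminus complex_eq_iff)
  have h: "cext2 (g p) (z \<alpha>) (cnj_vec (z \<beta>)) = (if \<alpha> = \<beta> then 2 else 0)" if "\<alpha> \<in> ?I" "\<beta> \<in> ?I" for \<alpha> \<beta>
    using m[OF that(1)] m[OF that(2)] gab[OF that]
    by (simp add: cext2_g_expand zp cnj_vec_parts g_uminus g_zero tangent_space_uminus complex_eq_iff)
  have "complex_frame A J p z"
    unfolding complex_frame_def n2
  proof (intro conjI ballI allI impI)
    show "z \<alpha> \<in> T10 A J p" if "\<alpha> \<in> ?I" for \<alpha> using zT[OF that] .
    fix w assume w: "w \<in> T10 A J p"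
    let ?x = "re_vec w"
    have x: "?x \<in> tangent_space A p" using T10_mem[OF w] by (simp add: ctangent_space_def)
    let ?c = "\<lambda>\<alpha>. complex_of_real (g p ?x (a \<alpha>)) + \<i> * complex_of_real (g p ?x (b \<alpha>))"
    have xe: "?x = (\<lambda>f. \<Sum>i=1..2*n. g p ?x (e i) * e i f)"
      using frame_expansion[OF e x] n by simp
    have xf: "?x f = (\<Sum>\<alpha>\<in>?I. g p ?x (a \<alpha>) * a \<alpha> f + g p ?x (b \<alpha>) * b \<alpha> f)" for f
      by (subst xe) (simp only: sum_odd_even a_def b_def)
    have "J p ?x f = (\<Sum>i=1..2*n. g p ?x (e i) * J p (e i) f)" for f
      by (subst xe, rule tlinear_sum[OF J_tlinear]) (use frame_mem[OF e] n in auto)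
    then have "J p ?x f = (\<Sum>\<alpha>\<in>?I. g p ?x (a \<alpha>) * J p (a \<alpha>) f + g p ?x (b \<alpha>) * J p (b \<alpha>) f)" for f
      by (simp only: sum_odd_even a_def b_def)
    then have Jxf: "J p ?x f = (\<Sum>\<alpha>\<in>?I. g p ?x (a \<alpha>) * b \<alpha> f - g p ?x (b \<alpha>) * a \<alpha> f)" for f
      by (simp add: Ja Jb)
    have "w f = (\<Sum>\<alpha>\<in>?I. ?c \<alpha> * z \<alpha> f)" for f
    proof -
      have "w f = complex_of_real (?x f) - \<i> * complex_of_real (J p ?x f)"
        using fun_cong[OF T10_im[OF w], of f] by (simp add: complex_eq_iff re_vec_def im_vec_def)
      also have "\<dots> = (\<Sum>\<alpha>\<in>?I. complex_of_real (g p ?x (a \<alpha>) * a \<alpha> f + g p ?x (b \<alpha>) * b \<alpha> f)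
          - \<i> * complex_of_real (g p ?x (a \<alpha>) * b \<alpha> f - g p ?x (b \<alpha>) * a \<alpha> f))"
        unfolding xf[of f] Jxf[of f] of_real_sum by (simp only: sum_distrib_left sum_subtractf)
      also have "\<dots> = (\<Sum>\<alpha>\<in>?I. ?c \<alpha> * z \<alpha> f)"
        by (intro sum.cong refl) (simp add: z_def complex_eq_iff algebra_simps)
      finally show ?thesis .
    qed
    then show "\<exists>c. w = (\<lambda>f. \<Sum>\<alpha>\<in>?I. c \<alpha> * z \<alpha> f)" by (intro exI[of _ ?c] ext)
  next
    fix c \<beta> assume c: "(\<lambda>f. \<Sum>\<alpha>\<in>?I. c \<alpha> * z \<alpha> f) = (\<lambda>f. 0)" and \<beta>: "\<beta> \<in> ?I"
    have "0 = \<zeta> \<beta> (\<lambda>f. \<Sum>\<alpha>\<in>?I. c \<alpha> * z \<alpha> f)" unfolding c by (simp add: covector_zero[OF cov(1)[OF \<beta>]])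
    also have "\<dots> = (\<Sum>\<alpha>\<in>?I. c \<alpha> * \<zeta> \<beta> (z \<alpha>))" by (rule covector_sum[OF cov(1)[OF \<beta>] zm])
    also have "\<dots> = (\<Sum>\<alpha>\<in>?I. if \<alpha> = \<beta> then c \<alpha> else 0)"
      by (intro sum.cong refl) (simp only: dual(1)[OF \<beta>], simp)
    finally show "c \<beta> = 0" using \<beta> by simp
  qed
  moreover have "dual_coframes A p z \<zeta> \<eta>"
    unfolding dual_coframes_def n2 by (intro ballI conjI cov dual)
  moreover have "inverse_metric A g p z H"
    unfolding inverse_metric_def n2
  proof (intro ballI)
    fix \<alpha> \<beta> assume \<alpha>: "\<alpha> \<in> ?I" and \<beta>: "\<beta> \<in> ?I"
    have "(\<Sum>\<gamma>\<in>?I. cext2 (g p) (z \<alpha>) (cnj_vec (z \<gamma>)) * H \<beta> \<gamma>)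
        = (\<Sum>\<gamma>\<in>?I. if \<gamma> = \<beta> then (if \<alpha> = \<beta> then 1 else 0) else 0)"
      by (intro sum.cong refl) (simp only: h[OF \<alpha>], simp add: H_def)
    also have "\<dots> = (if \<alpha> = \<beta> then 1 else 0)" using \<beta> by simp
    finally show "(\<Sum>\<gamma>\<in>?I. cext2 (g p) (z \<alpha>) (cnj_vec (z \<gamma>)) * H \<beta> \<gamma>) = (if \<alpha> = \<beta> then 1 else 0)" .
  qed
  ultimately show ?thesis by blast
qed

lemma Rm_tensor4: "tangent_connection A D \<Longrightarrow> tensor4 A p (Rm D p)"
  by (simp add: tensor4_def Rm_tlinear)

text \<open>
  The definition chooses a complex frame, coframes and an inverse metric all at once. Such data exist,
  and the value does not depend on them.
\<close>

lemma third_ricci_eq: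
  assumes D: "tangent_connection A D" and e: "adapted_frame A J g p e" and n: "DIM('e) = 2 * n"
    and uv: "u \<in> tangent_space A p" "v \<in> tangent_space A p"
  shows "third_ricci A J g D p u v = third_form DIM('e) J p e (Rm D p) u v"
proof -
  let ?P = "\<lambda>(z, \<zeta>, \<eta>, H). complex_frame A J p z \<and> dual_coframes A p z \<zeta> \<eta> \<and> inverse_metric A g p z H"
  obtain z0 \<zeta>0 \<eta>0 H0 where "complex_frame A J p z0 \<and> dual_coframes A p z0 \<zeta>0 \<eta>0 \<and> inverse_metric A g p z0 H0"
    using adapted_tuple_exists[OF e n] by (elim exE)
  then have "?P (z0, \<zeta>0, \<eta>0, H0)" by simp
  then have "\<exists>t. ?P t" by (rule exI)
  then have t: "?P (SOME t. ?P t)" by (rule someI_ex)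
  obtain z \<zeta> \<eta> H where zH: "(SOME t. ?P t) = (z, \<zeta>, \<eta>, H)" by (rule prod_cases4)
  have P: "complex_frame A J p z" "dual_coframes A p z \<zeta> \<eta>" "inverse_metric A g p z H"
    using t unfolding zH by simp_all
  have R: "(\<lambda>x y w t. g p (curvature_at A D p x y w) t) = Rm D p"
    by (intro ext) (simp add: Rm_def D)
  show ?thesis
    unfolding third_ricci_def zH Let_def prod.case R
    by (rule third_form_eq[OF e P Rm_tensor4[OF D] uv])
qed

end

section \<open>The Ricci forms under a conformal change\<close>

lemma conformal_hermitian:
  assumes "hermitian A J g" "smooth_fun A f"
  shows "hermitian A J (conformal f g)"
proof -
  interpret hermitian A J g by fact
  have "smooth_fun A (\<lambda>p. exp (2 * f p) * g p (X p) (Y p))" if "X \<in> vector_fields A" "Y \<in> vector_fields A" for X Y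
    using that assms(2) by (intro smooth_fun_mult smooth_fun_exp smooth_fun_scale g_smooth)
  then have "riemannian_metric A (conformal f g)"
    unfolding riemannian_metric_def conformal_def
  proof (intro conjI ballI allI impI)
    fix p u v w a b
    assume u: "u \<in> tangent_space A p" and v: "v \<in> tangent_space A p"
    show "exp (2 * f p) * g p u v = exp (2 * f p) * g p v u" using g_sym[OF u v] by simp
    assume w: "w \<in> tangent_space A p"
    show "exp (2 * f p) * g p (\<lambda>f. a * u f + b * v f) w
        = a * (exp (2 * f p) * g p u w) + b * (exp (2 * f p) * g p v w)"
      using tlinearD[OF g_tlinear1[OF w] u v, of a b] by (simp add: algebra_simps)
  next
    fix p u assume "u \<in> tangent_space A p" "u \<noteq> (\<lambda>f. 0)"
    then show "0 < exp (2 * f p) * g p u u" using g_pos[of u p] by simp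
  qed
  moreover have "conformal f g p (J p u) (J p v) = conformal f g p u v"
    if "u \<in> tangent_space A p" "v \<in> tangent_space A p" for p u v
    using that by (simp add: conformal_def g_J_J)
  ultimately show ?thesis
    using almost_hermitian unfolding hermitian_def almost_hermitian_def by simp
qed

context hermitian begin

lemma conformal_frame:
  assumes e: "adapted_frame A J g p e"
  shows "adapted_frame A J (conformal f g) p (\<lambda>i h. exp (- f p) * e i h)"
proof -
  let ?c = "exp (- f p)"
  show ?thesis
    unfolding adapted_frame_def
  proof (intro conjI ballI)
    fix i assume i: "i \<in> {1..DIM('e)}"
    note ei = frame_mem[OF e i]
    show "(\<lambda>h. ?c * e i h) \<in> tangent_space A p" by (rule tangent_space_smult[OF ei])
    fix j assume j: "j \<in> {1..DIM('e)}"
    note ej = frame_mem[OF e j]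
    have "g p (\<lambda>h. ?c * e i h) (\<lambda>h. ?c * e j h) = ?c * (?c * g p (e i) (e j))"
      by (simp only: g_scale ei ej tangent_space_smult)
    then have "conformal f g p (\<lambda>h. ?c * e i h) (\<lambda>h. ?c * e j h) = (exp (2 * f p) * ?c * ?c) * g p (e i) (e j)"
      by (simp add: conformal_def)
    also have "exp (2 * f p) * ?c * ?c = 1" by (simp add: mult_exp_exp)
    finally show "conformal f g p (\<lambda>h. ?c * e i h) (\<lambda>h. ?c * e j h) = (if i = j then 1 else 0)"
      using frame_orthonormal[OF e i j] by simp
  next
    fix v assume v: "v \<in> tangent_space A p"
    have "v = (\<lambda>h. \<Sum>i=1..DIM('e). (exp (f p) * g p v (e i)) * (?c * e i h))"
    proof
      fix h
      have "(\<Sum>i=1..DIM('e). g p v (e i) * e i h) = (\<Sum>i=1..DIM('e). (exp (f p) * g p v (e i)) * (?c * e i h))"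
        by (intro sum.cong refl) (simp add: exp_minus)
      then show "v h = (\<Sum>i=1..DIM('e). (exp (f p) * g p v (e i)) * (?c * e i h))"
        using fun_cong[OF frame_expansion[OF e v], of h] by simp
    qed
    then show "\<exists>c. v = (\<lambda>h. \<Sum>i=1..DIM('e). c i * (?c * e i h))"
      by (intro exI[of _ "\<lambda>i. exp (f p) * g p v (e i)"])
  next
    fix \<alpha> assume \<alpha>: "\<alpha> \<in> {1..DIM('e) div 2}"
    then have "2 * \<alpha> - 1 \<in> {1..DIM('e)}" by auto
    from J_scale[OF frame_mem[OF e this], of ?c] frame_J[OF e \<alpha>]
    show "(\<lambda>h. ?c * e (2 * \<alpha>) h) = J p (\<lambda>h. ?c * e (2 * \<alpha> - 1) h)" by simp
  qed
qed

lemma proj10_scale: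
  assumes "u \<in> tangent_space A p"
  shows "proj10 J p (\<lambda>h. c * u h) = (\<lambda>h. complex_of_real c * proj10 J p u h)"
    "proj01 J p (\<lambda>h. c * u h) = (\<lambda>h. complex_of_real c * proj01 J p u h)"
  using J_scale[OF assms, of c]
  by (simp_all add: proj10_def proj01_def cnj_vec_def fun_eq_iff algebra_simps)

context
  fixes f :: "'a \<Rightarrow> real" and D D' :: "'a connection"
  assumes f: "smooth_fun A f"
    and D: "chern_connection A J g D"
    and D': "chern_connection A J (conformal f g) D'"
begin

interpretation C: hermitian A J "conformal f g"
  using conformal_hermitian[OF hermitian_axioms f] .

lemma Rm_conformal:
  assumes m: "x \<in> tangent_space A p" "y \<in> tangent_space A p" "w \<in> tangent_space A p" "t \<in> tangent_space A p"
  shows "C.Rm D' p x y w t = exp (2 * f p) * (Rm D p x y w t + ddc A J f p x y * g p (J p w) t)"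
proof -
  have "g p (\<lambda>h. 1 * curvature_at A D p x y w h + ddc A J f p x y * J p w h) t
      = 1 * g p (curvature_at A D p x y w) t + ddc A J f p x y * g p (J p w) t"
    by (rule tlinearD[OF g_tlinear1[OF m(4)]])
      (use m curvature_at_mem[OF conn_D[OF f D D'] m(1-3)] in auto)
  then show ?thesis
    using conn_D[OF f D D'] conn_D'[OF f D D']
    by (simp add: C.Rm_def Rm_def curvature_at_conformal[OF f D D' m(1-3)] conformal_def)
qed

lemma ddc_tensor2: "tensor2 A p (ddc A J f p)"
  using ddc_tlinear[OF f D D'] by (simp add: tensor2_def)

context
  fixes p :: 'a and e :: "nat \<Rightarrow> 'a tvec"
  assumes e: "adapted_frame A J g p e"
begin

abbreviation rescale :: real where "rescale \<equiv> exp (- f p)"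
abbreviation conf_frame :: "nat \<Rightarrow> 'a tvec" where "conf_frame \<equiv> \<lambda>i h. rescale * e i h"

lemma conf_frame: "adapted_frame A J (conformal f g) p conf_frame"
  by (rule conformal_frame[OF e])

lemma rescale_cancel: "rescale * (rescale * (exp (2 * f p) * x)) = x"
proof -
  have "rescale * (rescale * exp (2 * f p)) = 1" by (simp add: mult_exp_exp)
  then show ?thesis by (metis mult.assoc mult_1)
qed

text \<open>
  The trace of \<open>J\<close> against \<open>J\<close> is the real dimension, half of which is the factor \<open>n\<close>. In the frame
  rescaled by \<open>e\<^sup>-\<^sup>f\<close> all powers of the conformal factor cancel.
\<close>

lemma first_ricci_conformal:
  assumes uv: "u \<in> tangent_space A p" "v \<in> tangent_space A p"
  shows "first_ricci A J (conformal f g) D' p u v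
    = first_ricci A J g D p u v - (1/2) * real DIM('e) * ddc A J f p u v"
proof -
  note T = C.Rm_tlinear[OF conn_D'[OF f D D']]
  have "C.Rm D' p u v (conf_frame i) (J p (conf_frame i)) = Rm D p u v (e i) (J p (e i)) + ddc A J f p u v"
    if "i \<in> {1..DIM('e)}" for i
  proof -
    note ei = frame_mem[OF e that]
    have "C.Rm D' p u v (conf_frame i) (J p (conf_frame i)) = C.Rm D' p u v (\<lambda>h. rescale * e i h) (\<lambda>h. rescale * J p (e i) h)"
      unfolding J_scale[OF ei] ..
    also have "\<dots> = rescale * (rescale * C.Rm D' p u v (e i) (J p (e i)))"
      using tlinear_scale[OF T(3)[OF uv tangent_space_smult[OF J_mem[OF ei]]] ei, of rescale rescale]
        tlinear_scale[OF T(4)[OF uv ei] J_mem[OF ei], of rescale] by simp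
    also have "\<dots> = Rm D p u v (e i) (J p (e i)) + ddc A J f p u v * g p (J p (e i)) (J p (e i))"
      unfolding Rm_conformal[OF uv ei J_mem[OF ei]] rescale_cancel ..
    also have "g p (J p (e i)) (J p (e i)) = 1"
      using g_J_J[OF ei ei] frame_orthonormal[OF e that that] by simp
    finally show ?thesis by simp
  qed
  then have "(\<Sum>i=1..DIM('e). C.Rm D' p u v (conf_frame i) (J p (conf_frame i)))
      = (\<Sum>i=1..DIM('e). Rm D p u v (e i) (J p (e i)) + ddc A J f p u v)"
    by (intro sum.cong refl)
  then show ?thesis
    unfolding C.first_ricci_eq[OF conn_D'[OF f D D'] conf_frame uv] first_ricci_eq[OF conn_D[OF f D D'] e uv]
    by (simp add: sum.distrib algebra_simps)
qed

text \<open>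
  Here the trace runs over the two form arguments, so it falls on \<open>dd\<^sup>cf\<close> and leaves \<open>g (J u) v\<close>.
\<close>

lemma second_ricci_conformal:
  assumes uv: "u \<in> tangent_space A p" "v \<in> tangent_space A p"
  shows "second_ricci A J (conformal f g) D' p u v
    = second_ricci A J g D p u v - lefschetz_trace A J g (ddc A J f) p * fundamental_form J g p u v"
proof -
  note T = C.Rm_tlinear[OF conn_D'[OF f D D']]
  have "C.Rm D' p (conf_frame i) (J p (conf_frame i)) u v
      = Rm D p (e i) (J p (e i)) u v + ddc A J f p (e i) (J p (e i)) * g p (J p u) v"
    if "i \<in> {1..DIM('e)}" for i
  proof -
    note ei = frame_mem[OF e that]
    have "C.Rm D' p (conf_frame i) (J p (conf_frame i)) u v = C.Rm D' p (\<lambda>h. rescale * e i h) (\<lambda>h. rescale * J p (e i) h) u v"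
      unfolding J_scale[OF ei] ..
    also have "\<dots> = rescale * (rescale * C.Rm D' p (e i) (J p (e i)) u v)"
      using tlinear_scale[OF T(1)[OF tangent_space_smult[OF J_mem[OF ei]] uv] ei, of rescale rescale]
        tlinear_scale[OF T(2)[OF ei uv] J_mem[OF ei], of rescale] by simp
    also have "\<dots> = Rm D p (e i) (J p (e i)) u v + ddc A J f p (e i) (J p (e i)) * g p (J p u) v"
      unfolding Rm_conformal[OF ei J_mem[OF ei] uv] rescale_cancel ..
    finally show ?thesis .
  qed
  then have "(\<Sum>i=1..DIM('e). C.Rm D' p (conf_frame i) (J p (conf_frame i)) u v)
      = (\<Sum>i=1..DIM('e). Rm D p (e i) (J p (e i)) u v + ddc A J f p (e i) (J p (e i)) * g p (J p u) v)"
    by (intro sum.cong refl)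
  also have "\<dots> = (\<Sum>i=1..DIM('e). Rm D p (e i) (J p (e i)) u v)
      + (\<Sum>i=1..DIM('e). ddc A J f p (e i) (J p (e i))) * g p (J p u) v"
    by (simp only: sum.distrib sum_distrib_right)
  finally have sum: "(\<Sum>i=1..DIM('e). C.Rm D' p (conf_frame i) (J p (conf_frame i)) u v)
      = (\<Sum>i=1..DIM('e). Rm D p (e i) (J p (e i)) u v)
      + (\<Sum>i=1..DIM('e). ddc A J f p (e i) (J p (e i))) * g p (J p u) v" .
  have lt: "lefschetz_trace A J g (ddc A J f) p = (1/2) * (\<Sum>i=1..DIM('e). ddc A J f p (e i) (J p (e i)))"
    by (rule lefschetz_trace_eq[OF e]) (use ddc_tlinear[OF f D D'] in auto)
  show ?thesis
    unfolding C.second_ricci_eq[OF conn_D'[OF f D D'] conf_frame uv] second_ricci_eq[OF conn_D[OF f D D'] e uv]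
      sum lt fundamental_form_def
    by (simp only: distrib_left mult.assoc mult_minus_left diff_conv_add_uminus)
qed

abbreviation ddc_ext where "ddc_ext \<equiv> cext2 (ddc A J f p)"

lemma cext4_conformal:
  assumes x: "x \<in> ctangent_space A p" and yz: "y \<in> ctangent_space A p" "z \<in> ctangent_space A p"
    and w: "w \<in> ctangent_space A p"
  shows "cext4 (C.Rm D' p) x (\<lambda>h. complex_of_real rescale * y h) (\<lambda>h. complex_of_real rescale * z h) w
    = cext4 (Rm D p) x y z w + ddc_ext x y * cext2 (\<lambda>x y. g p (J p x) y) z w"
proof -
  note cov = covector_cext4[OF C.Rm_tensor4[OF conn_D'[OF f D D'], of p]]
  have cz: "(\<lambda>h. complex_of_real rescale * z h) \<in> ctangent_space A p"
    using ctangent_space_comb[OF yz(2) yz(2), of _ 0] by simp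
  have "cext4 (C.Rm D' p) x (\<lambda>h. complex_of_real rescale * y h) (\<lambda>h. complex_of_real rescale * z h) w
      = complex_of_real rescale * (complex_of_real rescale * cext4 (C.Rm D' p) x y z w)"
    using covector_scale[OF cov(2)[OF x cz w] yz(1)] covector_scale[OF cov(3)[OF x yz(1) w] yz(2)] by simp
  also have "cext4 (C.Rm D' p) x y z w
      = cext4 (\<lambda>x y w t. exp (2 * f p) * (Rm D p x y w t + ddc A J f p x y * g p (J p w) t)) x y z w"
    by (rule cext4_cong[OF Rm_conformal x yz w])
  also have "\<dots> = complex_of_real (exp (2 * f p)) * (cext4 (Rm D p) x y z w + ddc_ext x y * cext2 (\<lambda>x y. g p (J p x) y) z w)"
    unfolding cext4_comb cext4_product ..
  also have "complex_of_real rescale * (complex_of_real rescale * (complex_of_real (exp (2 * f p)) * X)) = X" for X :: complex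
  proof -
    have "complex_of_real rescale * (complex_of_real rescale * complex_of_real (exp (2 * f p))) = 1"
      unfolding of_real_mult[symmetric] using rescale_cancel[of 1] by simp
    then show ?thesis by (simp only: mult.assoc[symmetric] mult_1_left)
  qed
  finally show ?thesis .
qed

text \<open>
  The sums contract \<open>g\<close> against the frame. In the first one, half of \<open>g (w, e\<^sub>i)\<close> and half of
  \<open>- \<i> g (J w, e\<^sub>i)\<close> each restore half of the (1,0)-component of \<open>w\<close>; the factor \<open>- \<i>\<close> is \<open>J\<close> on (0,1)-vectors.
  The second one is its conjugate.
\<close>

lemma trace_ddc:
  assumes x: "x \<in> ctangent_space A p" and w: "w \<in> tangent_space A p"
  shows "(\<Sum>i=1..DIM('e). ddc_ext x (proj10 J p (e i)) * cext2 (\<lambda>x y. g p (J p x) y) (proj01 J p (e i)) (proj10 J p w))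
      = - \<i> * ddc_ext x (proj10 J p w)" (is "?L1 = ?R1")
    "(\<Sum>i=1..DIM('e). ddc_ext x (proj01 J p (e i)) * cext2 (\<lambda>x y. g p (J p x) y) (proj10 J p (e i)) (proj01 J p w))
      = \<i> * ddc_ext x (proj01 J p w)" (is "?L2 = ?R2")
proof -
  note cov = covector_cext2(2)[OF ddc_tensor2 x]
  note ex = covector_proj10_frame[OF e cov w] covector_proj10_frame[OF e cov J_mem[OF w]]
  have "ddc_ext x (proj10 J p (J p w)) = \<i> * ddc_ext x (proj10 J p w)"
    unfolding proj10_J[OF w] by (rule covector_scale[OF cov proj10_mem(1)[OF w]])
  moreover have "?L1
      = - \<i> / 2 * (ddc_ext x (proj10 J p w) - \<i> * ddc_ext x (proj10 J p (J p w)))"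
    unfolding ex sum_distrib_left sum_subtractf[symmetric]
    by (intro sum.cong refl) (subst cext2_g_proj(1)[OF frame_mem[OF e] w], assumption, simp add: algebra_simps)
  ultimately show "?L1 = ?R1" by simp
  have "ddc_ext x (proj01 J p (J p w)) = - \<i> * ddc_ext x (proj01 J p w)"
    unfolding proj10_J[OF w] by (rule covector_scale[OF cov proj10_mem(2)[OF w]])
  moreover have "?L2
      = \<i> / 2 * (ddc_ext x (proj01 J p w) + \<i> * ddc_ext x (proj01 J p (J p w)))"
    unfolding ex sum_distrib_left sum.distrib[symmetric]
    by (intro sum.cong refl) (subst cext2_g_proj(2)[OF frame_mem[OF e] w], assumption, simp add: algebra_simps)
  ultimately show "?L2 = ?R2" by simp
qed

lemma trace10_conformal:
  assumes x: "x \<in> ctangent_space A p" and w: "w \<in> tangent_space A p"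
  shows "trace10 DIM('e) J p conf_frame (C.Rm D' p) x (proj10 J p w)
      = trace10 DIM('e) J p e (Rm D p) x (proj10 J p w) - \<i> * ddc_ext x (proj10 J p w)" (is "?L1 = ?R1")
    "trace01 DIM('e) J p conf_frame (C.Rm D' p) x (proj01 J p w)
      = trace01 DIM('e) J p e (Rm D p) x (proj01 J p w) + \<i> * ddc_ext x (proj01 J p w)" (is "?L2 = ?R2")
proof -
  have "?L1 = (\<Sum>i=1..DIM('e).
      cext4 (Rm D p) x (proj10 J p (e i)) (proj01 J p (e i)) (proj10 J p w)
      + ddc_ext x (proj10 J p (e i)) * cext2 (\<lambda>x y. g p (J p x) y) (proj01 J p (e i)) (proj10 J p w))"
    unfolding trace10_def
  proof (intro sum.cong refl)
    fix i assume "i \<in> {1..DIM('e)}"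
    note ei = frame_mem[OF e this]
    show "cext4 (C.Rm D' p) x (proj10 J p (conf_frame i)) (proj01 J p (conf_frame i)) (proj10 J p w)
      = cext4 (Rm D p) x (proj10 J p (e i)) (proj01 J p (e i)) (proj10 J p w)
      + ddc_ext x (proj10 J p (e i)) * cext2 (\<lambda>x y. g p (J p x) y) (proj01 J p (e i)) (proj10 J p w)"
      unfolding proj10_scale[OF ei] by (rule cext4_conformal[OF x proj10_mem[OF ei] proj10_mem(1)[OF w]])
  qed
  then show "?L1 = ?R1"
    unfolding sum.distrib trace_ddc(1)[OF x w] by (simp add: trace10_def)
  have "?L2 = (\<Sum>i=1..DIM('e).
      cext4 (Rm D p) x (proj01 J p (e i)) (proj10 J p (e i)) (proj01 J p w)
      + ddc_ext x (proj01 J p (e i)) * cext2 (\<lambda>x y. g p (J p x) y) (proj10 J p (e i)) (proj01 J p w))"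
    unfolding trace01_def
  proof (intro sum.cong refl)
    fix i assume "i \<in> {1..DIM('e)}"
    note ei = frame_mem[OF e this]
    show "cext4 (C.Rm D' p) x (proj01 J p (conf_frame i)) (proj10 J p (conf_frame i)) (proj01 J p w)
      = cext4 (Rm D p) x (proj01 J p (e i)) (proj10 J p (e i)) (proj01 J p w)
      + ddc_ext x (proj01 J p (e i)) * cext2 (\<lambda>x y. g p (J p x) y) (proj10 J p (e i)) (proj01 J p w)"
      unfolding proj10_scale[OF ei] by (rule cext4_conformal[OF x proj10_mem(2,1)[OF ei] proj10_mem(2)[OF w]])
  qed
  then show "?L2 = ?R2"
    unfolding sum.distrib trace_ddc(2)[OF x w] by (simp add: trace01_def)
qed

text \<open>
  Here the trace pairs one argument of \<open>dd\<^sup>cf\<close> with one argument of \<open>g (J \<cdot>) \<cdot>\<close> and gives \<open>dd\<^sup>cf\<close> back, up to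
  a factor \<open>\<mp>\<i>\<close> that the coefficients of the third Ricci form compensate. Antisymmetry collects the terms
  to minus the value of \<open>dd\<^sup>cf\<close> on the sums of the components of \<open>u\<close> and \<open>v\<close>.
\<close>

lemma third_ricci_conformal:
  assumes n: "DIM('e) = 2 * n" and uv: "u \<in> tangent_space A p" "v \<in> tangent_space A p"
  shows "third_ricci A J (conformal f g) D' p u v
    = third_ricci A J g D p u v - complex_of_real (ddc A J f p u v)"
proof -
  have swap: "ddc_ext y x = - ddc_ext x y" if "x \<in> ctangent_space A p" "y \<in> ctangent_space A p" for x y
  proof -
    have s: "ddc A J f p (part j y) (part k x) = - ddc A J f p (part k x) (part j y)" for j k
      by (rule ddc_swap[OF f D D' part_mem[OF that(1)] part_mem[OF that(2)]])
    have "ddc_ext y x = (\<Sum>k<2. \<Sum>j<2. \<i> ^ (j + k) * complex_of_real (ddc A J f p (part j y) (part k x)))"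
      unfolding cext2_def by (rule sum.swap)
    also have "\<dots> = (\<Sum>k<2. \<Sum>j<2. - (\<i> ^ (k + j) * complex_of_real (ddc A J f p (part k x) (part j y))))"
      by (intro sum.cong refl) (subst s, subst add.commute, simp)
    also have "\<dots> = - ddc_ext x y" unfolding cext2_def by (simp only: sum_negf)
    finally show ?thesis .
  qed
  note mu = proj10_mem[OF uv(1)] and mv = proj10_mem[OF uv(2)]
  have "complex_of_real (ddc A J f p u v) = ddc_ext (real_vec u) (real_vec v)"
    by (rule cext2_real[OF ddc_tensor2 uv, symmetric])
  also have "\<dots> = ddc_ext (proj10 J p u) (real_vec v) + ddc_ext (proj01 J p u) (real_vec v)"
    by (subst real_vec_split[of u p], rule covector_add[OF covector_cext2(1)[OF ddc_tensor2]])
      (use uv mu in auto)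
  also have "\<dots> = ddc_ext (proj10 J p u) (proj10 J p v) + ddc_ext (proj10 J p u) (proj01 J p v)
      + (ddc_ext (proj01 J p u) (proj10 J p v) + ddc_ext (proj01 J p u) (proj01 J p v))"
    unfolding real_vec_split[of v p]
    using covector_add[OF covector_cext2(2)[OF ddc_tensor2 mu(1)] mv]
      covector_add[OF covector_cext2(2)[OF ddc_tensor2 mu(2)] mv] by simp
  finally have split: "complex_of_real (ddc A J f p u v) = ddc_ext (proj10 J p u) (proj10 J p v) + ddc_ext (proj10 J p u) (proj01 J p v)
      + (ddc_ext (proj01 J p u) (proj10 J p v) + ddc_ext (proj01 J p u) (proj01 J p v))" .
  show ?thesis
    unfolding C.third_ricci_eq[OF conn_D'[OF f D D'] conf_frame n uv] third_ricci_eq[OF conn_D[OF f D D'] e n uv]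
      third_form_def trace10_conformal(1)[OF mu(1) uv(2)] trace10_conformal(1)[OF mv(1) uv(1)]
      trace10_conformal(1)[OF mu(2) uv(2)] trace10_conformal(1)[OF mv(2) uv(1)]
      trace10_conformal(2)[OF mu(2) uv(2)] trace10_conformal(2)[OF mv(2) uv(1)] split
      swap[OF mu(1) mv(1)] swap[OF mu(2) mv(2)] swap[OF mu(1) mv(2)]
    by (simp add: algebra_simps)
qed

end
end
end

theorem corollary4p4:
  fixes A :: "('a::{t2_space,second_countable_topology}, 'e::euclidean_space) atlas"
    and J :: "'a endo" and g :: "'a two_tensor" and f :: "'a \<Rightarrow> real"
    and D D' :: "'a connection" and n :: nat
  assumes "almost_hermitian A J g"
    and "DIM('e) = 2 * n"
    and "smooth_fun A f"
    and "chern_connection A J g D"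
    and "chern_connection A J (conformal f g) D'"
  shows "\<forall>p. \<forall>u\<in>tangent_space A p. \<forall>v\<in>tangent_space A p.
      first_ricci A J (conformal f g) D' p u v
        = first_ricci A J g D p u v - real n * ddc A J f p u v \<and>
      second_ricci A J (conformal f g) D' p u v
        = second_ricci A J g D p u v
          - lefschetz_trace A J g (ddc A J f) p * fundamental_form J g p u v \<and>
      third_ricci A J (conformal f g) D' p u v
        = third_ricci A J g D p u v - complex_of_real (ddc A J f p u v)"
proof (intro allI ballI)
  interpret hermitian A J g using assms(1) by unfold_locales
  fix p u v assume uv: "u \<in> tangent_space A p" "v \<in> tangent_space A p"
  obtain e where e: "adapted_frame A J g p e" using adapted_frame_exists[OF assms(2)] by blast
  have half: "(1/2) * real DIM('e) = real n" using assms(2) by simp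
  show "first_ricci A J (conformal f g) D' p u v
        = first_ricci A J g D p u v - real n * ddc A J f p u v \<and>
      second_ricci A J (conformal f g) D' p u v
        = second_ricci A J g D p u v
          - lefschetz_trace A J g (ddc A J f) p * fundamental_form J g p u v \<and>
      third_ricci A J (conformal f g) D' p u v
        = third_ricci A J g D p u v - complex_of_real (ddc A J f p u v)"
    using first_ricci_conformal[OF assms(3-5) e uv] second_ricci_conformal[OF assms(3-5) e uv]
      third_ricci_conformal[OF assms(3-5) e assms(2) uv]
    unfolding half by (intro conjI)
qed

end
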